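(* For real $u>0$ and real $|v|<u$, the cumulants of the complex measure $\rho_{u,v}(x)\,dx$ satisfy $\kappa_1(\rho_{u,v})=-\frac{iv}{2}$ and, for every $k\ge2$, $\kappa_k(\rho_{u,v})=c_ku$, where $c_k\in\mathbb Q[\psi_2]$ does not depend on $u,v$, with $\psi_2:=\pi\theta(1)^4=\frac{\pi^2}{\Gamma(3/4)^4}$. Moreover, if $k\ge3$ is odd then $c_k=0$, while if $k\ge2$ is even then $c_k$ is an even polynomial of degree $k$ in $\psi_2$ with rational coefficients.
   Context: $\theta(t)=\sum_{n\in\mathbb Z}e^{-\pi n^2t}$ for $t>0$. For $\Re(w)<\Re(s)<0$, $Z_{\mathbb Q}(w,s)=\int_0^\infty\theta(t^2)^s\theta(1/t^2)^{w-s}\frac{dt}{t}$. For $u>0$, $|v|<u$, set $\rho_{u,v}(x)=\frac1{2\pi}\theta(1)^uZ_{\mathbb Q}(-u,-\frac{u+v}{2}+ix)$, $x\in\mathbb R$; $\int\rho_{u,v}=1$. The $k$-th cumulant of $\rho_{u,v}$ is $\kappa_k(\rho_{u,v})=i^{-k}\frac{d^k}{dz^k}\log\Bigl(\int_{-\infty}^\infty e^{izx}\rho_{u,v}(x)\,dx\Bigr)\Big|_{z=0}$ (logarithm normalized to vanish at $z=0$). *)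

theory Defs
  imports "HOL-Analysis.Analysis" "HOL-Computational_Algebra.Polynomial"
begin

definition theta :: "real \<Rightarrow> real" where
  "theta t = (\<Sum>\<^sub>\<infinity>n\<in>(UNIV :: int set). exp (- pi * (real_of_int n)\<^sup>2 * t))"

(* Meant for Re w < Re s < 0. As theta is positive on the positive half-line, the complex powers
   are taken with the real logarithm of the base. *)
definition Z_Q :: "complex \<Rightarrow> complex \<Rightarrow> complex" where
  "Z_Q w s =
    (LINT t:{0<..}|lborel.
      complex_of_real (theta (t\<^sup>2)) powr s * complex_of_real (theta (1 / t\<^sup>2)) powr (w - s)
        / complex_of_real t)"

(* Meant for u > 0 and \<bar>v\<bar> < u. *)
definition rho :: "real \<Rightarrow> real \<Rightarrow> real \<Rightarrow> complex" where
  "rho u v x =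
    complex_of_real (1 / (2 * pi) * theta 1 powr u)
      * Z_Q (- complex_of_real u) (- complex_of_real ((u + v) / 2) + \<i> * complex_of_real x)"

definition char_fun :: "(real \<Rightarrow> complex) \<Rightarrow> real \<Rightarrow> complex" where
  "char_fun f z = (LINT x|lborel. exp (\<i> * complex_of_real z * complex_of_real x) * f x)"

(* Meant for complex densities f of total mass 1: then the characteristic function is continuous
   with value 1 at 0, so near 0 the principal branch Ln is the branch of the logarithm that
   vanishes at z = 0. Derivatives are with respect to the real variable z. *)
definition cumulant :: "nat \<Rightarrow> (real \<Rightarrow> complex) \<Rightarrow> complex" where
  "cumulant k f =
    inverse (\<i> ^ k) *
      (((\<lambda>g z. vector_derivative g (at z)) ^^ k) (\<lambda>z. Ln (char_fun f z)) 0)"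

definition psi2 :: real where
  "psi2 = pi * theta 1 ^ 4"

definition rat_poly_eval :: "rat poly \<Rightarrow> real \<Rightarrow> real" where
  "rat_poly_eval p x = poly (map_poly of_rat p) x"

definition even_poly :: "'a::zero poly \<Rightarrow> bool" where
  "even_poly p \<longleftrightarrow> (\<forall>j. odd j \<longrightarrow> coeff p j = 0)"

end

theory Submission
  imports
    Defs
    "HOL-Number_Theory.Cong"
    "HOL-Probability.Distributions"
    "HOL-Probability.Levy"
    "HOL-Probability.Sinc_Integral"
    "HOL-Real_Asymp.Real_Asymp"
begin

text \<open>
  The functional equation of \<open>\<theta>\<close> and the substitution \<open>t = e\<^sup>y\<close> turn \<open>Z_Q\<close> into the Fourier transform of
  \<open>exp (v y / 2 - u L(y))\<close>, where \<open>L(y) = y / 2 + ln \<theta>(e\<^sup>2\<^sup>y)\<close> is even. By Fourier inversion the cumulants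
  are, up to the linear term in \<open>v\<close>, the Taylor coefficients of \<open>- u L\<close> at \<open>0\<close>.

  Everything about \<open>\<theta>\<close> comes from one identity, \<open>\<theta>(2t)\<^sup>2 = \<theta>(4t)\<^sup>2 + (\<theta>(t) - \<theta>(4t))\<^sup>2\<close>. It makes
  \<open>(\<theta>\<^sub>3\<^sup>2, \<theta>\<^sub>4\<^sup>2)\<close> at \<open>2t\<close> the arithmetic-geometric mean step of the same pair at \<open>t\<close>; Gauss's elliptic
  integral then yields the functional equation and the value \<open>\<theta>(1)\<close>. It also shows that the defects of the
  differential equations for \<open>\<theta>\<^sub>3\<close> and \<open>\<theta>\<^sub>4\<close> are invariant under \<open>t \<mapsto> 2t\<close>, and since they vanish at infinity
  the equations hold.

  In terms of \<open>p = L'\<close> they become the system \<open>p' = 2p\<^sup>2 + q - 1/2\<close>, \<open>q' = (8p - 16r)q\<close>, \<open>r' = q + 4pr\<close> with initial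
  value \<open>(0, \<psi>\<^sub>2\<^sup>2/8, 0)\<close>, so the Taylor coefficients are polynomials in \<open>\<psi>\<^sub>2\<close>. Their top coefficients solve the
  homogeneous system, which can be solved explicitly modulo \<open>5\<close>: after scaling, each of those that matter is
  congruent to \<open>1\<close>, so the degree is exact.
\<close>

section \<open>Taylor coefficients of the polynomial differential system\<close>

text \<open>The degree claim is a weight count. Give \<open>p\<close> and \<open>r\<close> weight 1,
  \<open>q\<close> weight 2, and let differentiation raise the weight by 1. Every term of the system
  is then homogeneous, except that the constant 1/2 stands in an equation of weight 2 but has degree
  0 in \<open>psi2\<close>. So the n-th derivative of \<open>p\<close> at 0 has degree at most n +
  1, with exponents of a single parity, and the constant never reaches the top degree. The obstacle
  is that the top coefficient must not vanish. Positivity cannot show this, because of the term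
  \<open>- 16 r q\<close>: for the homogeneous system with \<open>q = 1\<close> at 0, the first and
  third derivatives of \<open>p\<close> are 1 and -4. A congruence can. Modulo 5 all three
  coefficient sequences are periodic from index 1 on, with period dividing 4. The initial values
  come from the fixed point t = 1 of t -> 1/t, which exchanges the roles of \<open>theta2\<close>
  and \<open>theta4\<close>. There \<open>p\<close> and \<open>r\<close> vanish, so \<open>q\<close>
  is the only place where \<open>psi2\<close> enters.\<close>

definition binconv :: "(nat \<Rightarrow> 'a::comm_ring_1) \<Rightarrow> (nat \<Rightarrow> 'a) \<Rightarrow> nat \<Rightarrow> 'a" where
  "binconv X Y n = (\<Sum>i\<le>n. of_nat (n choose i) * X i * Y (n - i))"

text \<open>In \<open>ode_sol\<close> the recursive calls occur inside convolutions. This congruence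
  records that only indices up to \<open>n\<close> are consulted, which is what termination
  needs.\<close>

lemma binconv_cong [fundef_cong]:
  "n = m \<Longrightarrow> (\<And>i. i \<le> m \<Longrightarrow> X i = X' i) \<Longrightarrow> (\<And>i. i \<le> m \<Longrightarrow> Y i = Y' i) \<Longrightarrow>
    binconv X Y n = binconv X' Y' m"
  unfolding binconv_def by (auto intro!: sum.cong)

text \<open>Leibniz rule for the shift operator, by Pascal's rule for the binomial
  coefficients.\<close>

lemma binconv_Suc:
  "binconv X Y (Suc n) = binconv (\<lambda>i. X (Suc i)) Y n + binconv X (\<lambda>i. Y (Suc i)) n"
proof -
  have "binconv X Y (Suc n)
      = X 0 * Y (Suc n) + (\<Sum>i\<le>n. of_nat (Suc n choose Suc i) * X (Suc i) * Y (n - i))"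
    unfolding binconv_def by (subst sum.atMost_Suc_shift) simp
  also have "(\<Sum>i\<le>n. of_nat (Suc n choose Suc i) * X (Suc i) * Y (n - i))
      = binconv (\<lambda>i. X (Suc i)) Y n
        + (\<Sum>i\<le>n. of_nat (n choose Suc i) * X (Suc i) * Y (n - i))"
    unfolding binconv_def by (simp add: sum.distrib [symmetric] algebra_simps)
  also have "X 0 * Y (Suc n) + (binconv (\<lambda>i. X (Suc i)) Y n
        + (\<Sum>i\<le>n. of_nat (n choose Suc i) * X (Suc i) * Y (n - i)))
      = binconv (\<lambda>i. X (Suc i)) Y n
        + (\<Sum>i\<le>Suc n. of_nat (n choose i) * X i * Y (Suc n - i))"
    by (subst sum.atMost_Suc_shift) (simp add: algebra_simps del: sum.atMost_Suc)
  also have "(\<Sum>i\<le>Suc n. of_nat (n choose i) * X i * Y (Suc n - i))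
      = binconv X (\<lambda>i. Y (Suc i)) n"
    unfolding binconv_def by (subst sum.atMost_Suc) (auto intro!: sum.cong simp: Suc_diff_le binomial_eq_0)
  finally show ?thesis .
qed

text \<open>The Taylor coefficients (in the exponential normalisation) of a solution of
  \<open>p' = 2p\<^sup>2 + q - h\<close>, \<open>q' = (8p - 16r)q\<close>, \<open>r' = q + 4pr\<close>.\<close>

definition ode_seq :: "'a::comm_ring_1 \<Rightarrow> (nat \<Rightarrow> 'a) \<Rightarrow> (nat \<Rightarrow> 'a) \<Rightarrow> (nat \<Rightarrow> 'a) \<Rightarrow> bool" where
  "ode_seq h P Q R \<longleftrightarrow> (\<forall>n.
     P (Suc n) = 2 * binconv P P n + Q n - (if n = 0 then h else 0) \<and>
     Q (Suc n) = 8 * binconv P Q n - 16 * binconv R Q n \<and>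
     R (Suc n) = Q n + 4 * binconv P R n)"

fun ode_sol :: "'a::comm_ring_1 \<Rightarrow> 'a \<Rightarrow> 'a \<Rightarrow> 'a \<Rightarrow> nat \<Rightarrow> 'a \<times> 'a \<times> 'a" where
  "ode_sol h p q r 0 = (p, q, r)"
| "ode_sol h p q r (Suc n) =
    (2 * binconv (\<lambda>i. fst (ode_sol h p q r i)) (\<lambda>i. fst (ode_sol h p q r i)) n
       + fst (snd (ode_sol h p q r n)) - (if n = 0 then h else 0),
     8 * binconv (\<lambda>i. fst (ode_sol h p q r i)) (\<lambda>i. fst (snd (ode_sol h p q r i))) n
       - 16 * binconv (\<lambda>i. snd (snd (ode_sol h p q r i))) (\<lambda>i. fst (snd (ode_sol h p q r i))) n,
     fst (snd (ode_sol h p q r n))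
       + 4 * binconv (\<lambda>i. fst (ode_sol h p q r i)) (\<lambda>i. snd (snd (ode_sol h p q r i))) n)"

lemma ode_seq_exists:
  obtains P Q R where "ode_seq h P Q R" "P 0 = p" "Q 0 = q" "R 0 = r"
proof
  show "ode_seq h (\<lambda>i. fst (ode_sol h p q r i)) (\<lambda>i. fst (snd (ode_sol h p q r i)))
    (\<lambda>i. snd (snd (ode_sol h p q r i)))"
    unfolding ode_seq_def by simp
qed auto

lemma ode_seq_unique:
  assumes "ode_seq h P Q R" "ode_seq h P' Q' R'" "P 0 = P' 0" "Q 0 = Q' 0" "R 0 = R' 0"
  shows "P n = P' n \<and> Q n = Q' n \<and> R n = R' n"
proof (induction n rule: less_induct)
  case (less n)
  show ?case
  proof (cases n)
    case 0
    then show ?thesis using assms by simp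
  next
    case (Suc m)
    have "\<And>i. i \<le> m \<Longrightarrow> P i = P' i \<and> Q i = Q' i \<and> R i = R' i"
      using less Suc by auto
    then have "binconv P P m = binconv P' P' m" "binconv P Q m = binconv P' Q' m"
      "binconv R Q m = binconv R' Q' m" "binconv P R m = binconv P' R' m" "Q m = Q' m"
      by (auto intro!: binconv_cong)
    then show ?thesis using assms(1,2) unfolding ode_seq_def Suc by simp
  qed
qed

lemma binconv_zero:
  assumes "\<And>i. i \<le> n \<Longrightarrow> X i = 0 \<or> Y (n - i) = 0"
  shows "binconv X Y n = 0"
  unfolding binconv_def
proof (intro sum.neutral ballI)
  fix i assume "i \<in> {..n}"
  then show "of_nat (n choose i) * X i * Y (n - i) = 0" using assms[of i] by auto
qed

text \<open>The system is invariant under z -> -z together with (p, q, r) -> (-p, q, -r), and the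
  initial value is fixed by this symmetry.\<close>

lemma ode_seq_parity:
  assumes "ode_seq h P Q R" "P 0 = 0" "R 0 = 0"
  shows "(even n \<longrightarrow> P n = 0) \<and> (odd n \<longrightarrow> Q n = 0) \<and> (even n \<longrightarrow> R n = 0)"
proof (induction n rule: less_induct)
  case (less n)
  show ?case
  proof (cases n)
    case 0
    then show ?thesis using assms by simp
  next
    case (Suc m)
    have IH: "\<And>i. i \<le> m \<Longrightarrow> (even i \<longrightarrow> P i = 0) \<and> (odd i \<longrightarrow> Q i = 0) \<and> (even i \<longrightarrow> R i = 0)"
      using less Suc by auto
    have IH': "\<And>i. i \<le> m \<Longrightarrow> (even (m - i) \<longrightarrow> P (m - i) = 0) \<and> (odd (m - i) \<longrightarrow> Q (m - i) = 0) \<and>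
        (even (m - i) \<longrightarrow> R (m - i) = 0)"
      by (intro IH) simp
    have "binconv P P m = 0" if "odd m"
    proof (rule binconv_zero)
      fix i assume "i \<le> m"
      then show "P i = 0 \<or> P (m - i) = 0"
        using IH[of i] IH'[of i] that by (auto simp: even_diff_nat)
    qed
    moreover have "binconv P R m = 0" if "odd m"
    proof (rule binconv_zero)
      fix i assume "i \<le> m"
      then show "P i = 0 \<or> R (m - i) = 0"
        using IH[of i] IH'[of i] that by (auto simp: even_diff_nat)
    qed
    moreover have "binconv P Q m = 0" if "even m"
    proof (rule binconv_zero)
      fix i assume "i \<le> m"
      then show "P i = 0 \<or> Q (m - i) = 0"
        using IH[of i] IH'[of i] that by (auto simp: even_diff_nat)
    qed
    moreover have "binconv R Q m = 0" if "even m"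
    proof (rule binconv_zero)
      fix i assume "i \<le> m"
      then show "R i = 0 \<or> Q (m - i) = 0"
        using IH[of i] IH'[of i] that by (auto simp: even_diff_nat)
    qed
    moreover have "odd m \<Longrightarrow> Q m = 0"
      using IH by auto
    ultimately    show ?thesis using assms(1) unfolding ode_seq_def Suc by (auto elim: oddE)
  qed
qed

text \<open>The recursion uses ring operations only, so it commutes with ring homomorphisms. This
  moves it between integers, rational polynomials and reals.\<close>

lemma ode_seq_hom:
  assumes "ode_seq h P Q R" and f: "\<And>x y. f (x + y) = f x + f y" "\<And>x y. f (x * y) = f x * f y" "f 1 = 1"
  shows "ode_seq (f h) (\<lambda>n. f (P n)) (\<lambda>n. f (Q n)) (\<lambda>n. f (R n))"
proof -
  have f0: "f 0 = 0" using f(1)[of 0 0] by simp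
  have fm: "f (x - y) = f x - f y" for x y using f(1)[of "x - y" y] by simp
  have fn: "f (of_nat k) = of_nat k" for k by (induction k) (auto simp: f f0)
  have fs: "f (sum g {..n}) = (\<Sum>i\<le>n. f (g i))" for g and n :: nat by (induction n) (auto simp: f f0)
  have fb: "f (binconv X Y n) = binconv (\<lambda>n. f (X n)) (\<lambda>n. f (Y n)) n" for X Y n
    unfolding binconv_def by (simp add: fs f fn)
  have num: "f (numeral k) = numeral k" for k using fn[of "numeral k"] by simp
  show ?thesis
    using assms(1) unfolding ode_seq_def by (auto simp: f f0 fm fb num)
qed

section \<open>The homogeneous system modulo 5\<close>

lemma binconv_power: "binconv (\<lambda>i. a ^ i) (\<lambda>i. b ^ i) n = (a + b) ^ n"
  unfolding binconv_def by (simp add: binomial_ring)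

lemma binconv_add_left: "binconv (\<lambda>i. X i + Y i) Z n = binconv X Z n + binconv Y Z n"
  and binconv_add_right: "binconv Z (\<lambda>i. X i + Y i) n = binconv Z X n + binconv Z Y n"
  and binconv_mult_left: "binconv (\<lambda>i. c * X i) Z n = c * binconv X Z n"
  and binconv_mult_right: "binconv Z (\<lambda>i. c * X i) n = c * binconv Z X n"
  unfolding binconv_def
  by (simp_all add: algebra_simps sum.distrib sum_distrib_left)

lemma binconv_cong_mod:
  fixes X Y :: "nat \<Rightarrow> int"
  assumes "\<And>i. i \<le> n \<Longrightarrow> [X i = X' i] (mod m)" "\<And>i. i \<le> n \<Longrightarrow> [Y i = Y' i] (mod m)"
  shows "[binconv X Y n = binconv X' Y' n] (mod m)"
  unfolding binconv_def by (intro cong_sum cong_mult cong_refl assms) auto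

text \<open>Modulo 5 the relations \<open>q = 1 + r\<^sup>2\<close>, \<open>p = rq\<close>, \<open>r\<^sup>5 = 0\<close> define an invariant subscheme
  through the initial value; there \<open>p'' = p\<close>, and the sequences are
  combinations of the powers of the residues.\<close>

lemma ode_seq_mod_5:
  fixes P Q R :: "nat \<Rightarrow> int"
  assumes "ode_seq 0 P Q R" "P 0 = 0" "Q 0 = 1" "R 0 = 0"
  shows "[P n = 3 - 3 * 4 ^ n] (mod 5)"
proof -
  \<comment> \<open>Power sums over the residues \<open>a\<close> = 1, ..., 4. Modulo 5 the sum of
    \<open>- a ^ (n + 3)\<close> is 1 if n = 1 (mod 4) and 0 otherwise; this is \<open>R'\<close>.
    The weights \<open>- 2 * a ^ 2\<close> in \<open>Q'\<close> give 2 if n = 2 (mod 4) and 0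
    otherwise, and \<open>0 ^ n\<close> supplies the initial value 1. \<open>P'\<close> is 1 at odd
    and 0 at even indices. In this form \<open>binconv_power\<close> evaluates every
    convolution.\<close>
  define P' Q' R' :: "nat \<Rightarrow> int" where
    "P' = (\<lambda>n. 3 * 1 ^ n + (- 3) * 4 ^ n)" and
    "Q' = (\<lambda>n. 1 * 0 ^ n + (-2 * 1 ^ n + (-8 * 2 ^ n + (-18 * 3 ^ n + (-32 * 4 ^ n)))))" and
    "R' = (\<lambda>n. - 1 * 1 ^ n + (- 8 * 2 ^ n + (- 27 * 3 ^ n + (- 64 * 4 ^ n))))"
  \<comment> \<open>Convolving powers adds the bases, so bases up to 4 + 4 = 8 occur and have to be
    brought back to residues.\<close>
  have red: "[(5::int) ^ n = 0 ^ n] (mod 5)" "[(6::int) ^ n = 1 ^ n] (mod 5)"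
     "[(7::int) ^ n = 2 ^ n] (mod 5)" "[(8::int) ^ n = 3 ^ n] (mod 5)" for n
    by (intro cong_pow; simp add: cong_def)+
  note bc = binconv_add_left binconv_add_right binconv_mult_left binconv_mult_right binconv_power
  have *: "[P n = P' n] (mod 5) \<and> [Q n = Q' n] (mod 5) \<and> [R n = R' n] (mod 5)"
  proof (induction n rule: less_induct)
    case (less n)
    show ?case
    proof (cases n)
      case 0
      then show ?thesis using assms by (simp add: P'_def Q'_def R'_def cong_def)
    next
      case (Suc m)
      have IH: "\<And>i. i \<le> m \<Longrightarrow> [P i = P' i] (mod 5)" "\<And>i. i \<le> m \<Longrightarrow> [Q i = Q' i] (mod 5)"
        "\<And>i. i \<le> m \<Longrightarrow> [R i = R' i] (mod 5)"
        using less Suc by auto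
      obtain a where a: "(5::int) ^ m = 0 ^ m + 5 * a"
        using cong_sym[OF red(1)[of m]] by (auto simp: cong_iff_lin)
      obtain b where b: "(6::int) ^ m = 1 + 5 * b"
        using cong_sym[OF red(2)[of m]] by (auto simp: cong_iff_lin)
      obtain c where c: "(7::int) ^ m = 2 ^ m + 5 * c"
        using cong_sym[OF red(3)[of m]] by (auto simp: cong_iff_lin)
      obtain d where d: "(8::int) ^ m = 3 ^ m + 5 * d"
        using cong_sym[OF red(4)[of m]] by (auto simp: cong_iff_lin)
      note e = a b c d
      have "[P (Suc m) = 2 * binconv P' P' m + Q' m] (mod 5)"
        using assms(1) unfolding ode_seq_def
        by (auto intro!: cong_add cong_mult binconv_cong_mod IH)
      also have "[2 * binconv P' P' m + Q' m = P' (Suc m)] (mod 5)"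
        unfolding P'_def Q'_def bc by (simp add: e cong_iff_dvd_diff algebra_simps; presburger?)
      finally have 1: "[P (Suc m) = P' (Suc m)] (mod 5)" .
      have "[Q (Suc m) = 8 * binconv P' Q' m - 16 * binconv R' Q' m] (mod 5)"
        using assms(1) unfolding ode_seq_def
        by (auto intro!: cong_diff cong_mult binconv_cong_mod IH)
      also have "[8 * binconv P' Q' m - 16 * binconv R' Q' m = Q' (Suc m)] (mod 5)"
        unfolding P'_def Q'_def R'_def bc by (simp add: e cong_iff_dvd_diff algebra_simps; presburger?)
      finally have 2: "[Q (Suc m) = Q' (Suc m)] (mod 5)" .
      have "[R (Suc m) = Q' m + 4 * binconv P' R' m] (mod 5)"
        using assms(1) unfolding ode_seq_def
        by (auto intro!: cong_add cong_mult binconv_cong_mod IH)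
      also have "[Q' m + 4 * binconv P' R' m = R' (Suc m)] (mod 5)"
        unfolding P'_def Q'_def R'_def bc by (simp add: e cong_iff_dvd_diff algebra_simps; presburger?)
      finally have 3: "[R (Suc m) = R' (Suc m)] (mod 5)" .
      show ?thesis using 1 2 3 Suc by simp
    qed
  qed
  then show ?thesis by (simp add: P'_def)
qed

lemma ode_seq_odd_nonzero:
  fixes P Q R :: "nat \<Rightarrow> int"
  assumes "ode_seq 0 P Q R" "P 0 = 0" "Q 0 = 1" "R 0 = 0" "odd n"
  shows "P n \<noteq> 0"
proof
  assume "P n = 0"
  then have "[0 = 3 - 3 * (4::int) ^ n] (mod 5)"
    using ode_seq_mod_5[OF assms(1-4), of n] by simp
  moreover have "[(4::int) ^ n = (-1) ^ n] (mod 5)" by (intro cong_pow) (simp add: cong_def)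
  then have "[3 - 3 * (4::int) ^ n = 3 - 3 * (-1) ^ n] (mod 5)"
    by (intro cong_diff cong_mult) auto
  ultimately have "[0 = 3 - 3 * (-1::int) ^ n] (mod 5)" by (rule cong_trans)
  then show False using \<open>odd n\<close> by (simp add: cong_def)
qed

section \<open>Weight, parity and degree of polynomial coefficient sequences\<close>

definition wt_poly :: "nat \<Rightarrow> 'a::comm_ring_1 poly \<Rightarrow> bool" where
  "wt_poly d p \<longleftrightarrow> degree p \<le> d \<and> (\<forall>j. odd (d + j) \<longrightarrow> coeff p j = 0)"

lemma wt_poly_add: "wt_poly d p \<Longrightarrow> wt_poly d q \<Longrightarrow> wt_poly d (p + q)"
  and wt_poly_diff: "wt_poly d p \<Longrightarrow> wt_poly d q \<Longrightarrow> wt_poly d (p - q)"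
  by (auto simp: wt_poly_def degree_add_le degree_diff_le)

lemma wt_poly_0: "wt_poly d 0" by (simp add: wt_poly_def)

lemma wt_poly_mult:
  assumes "wt_poly d p" "wt_poly e q" shows "wt_poly (d + e) (p * q)"
  unfolding wt_poly_def
proof safe
  show "degree (p * q) \<le> d + e"
    using assms degree_mult_le[of p q] unfolding wt_poly_def by linarith
  fix j assume j: "odd (d + e + j)"
  have "coeff p i * coeff q (j - i) = 0" if "i \<le> j" for i
  proof (cases "odd (d + i)")
    case True
    then show ?thesis using assms by (simp add: wt_poly_def)
  next
    case False
    then have "odd (e + (j - i))" using j that by presburger
    then show ?thesis using assms by (simp add: wt_poly_def)
  qed
  then show "coeff (p * q) j = 0" unfolding coeff_mult by (intro sum.neutral) auto
qed

lemma wt_poly_sum: "(\<And>i. i \<in> A \<Longrightarrow> wt_poly d (f i)) \<Longrightarrow> wt_poly d (sum f A)"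
  by (induction A rule: infinite_finite_induct) (auto intro: wt_poly_add wt_poly_0)

lemma wt_poly_of_nat: "wt_poly 0 (of_nat k)"
  by (auto simp: wt_poly_def of_nat_poly coeff_pCons split: nat.splits)

lemma wt_poly_cmult: "wt_poly d p \<Longrightarrow> wt_poly d (of_nat k * p)"
  using wt_poly_mult[OF wt_poly_of_nat, of d p k] by simp

lemma wt_poly_binconv:
  assumes "\<And>i. i \<le> n \<Longrightarrow> wt_poly (d + i) (X i)" "\<And>i. i \<le> n \<Longrightarrow> wt_poly (e + i) (Y i)"
  shows "wt_poly (d + e + n) (binconv X Y n)"
  unfolding binconv_def
proof (intro wt_poly_sum)
  fix i assume "i \<in> {..n}"
  then have "wt_poly (0 + (d + i) + (e + (n - i))) (of_nat (n choose i) * X i * Y (n - i))"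
    by (intro wt_poly_mult wt_poly_of_nat assms) auto
  moreover have "0 + (d + i) + (e + (n - i)) = d + e + n" using \<open>i \<in> _\<close> by simp
  ultimately show "wt_poly (d + e + n) (of_nat (n choose i) * X i * Y (n - i))" by metis
qed

lemma coeff_mult_top:
  assumes "degree p \<le> d" "degree q \<le> e"
  shows "coeff (p * q) (d + e) = coeff p d * coeff q e"
proof -
  have "coeff (p * q) (d + e) = (\<Sum>i\<le>d + e. coeff p i * coeff q (d + e - i))" by (rule coeff_mult)
  also have "\<dots> = (\<Sum>i\<in>{d}. coeff p i * coeff q (d + e - i))"
  proof (intro sum.mono_neutral_right ballI)
    fix i assume "i \<in> {..d + e} - {d}"
    then have "i > d \<or> d + e - i > e" by auto
    then show "coeff p i * coeff q (d + e - i) = 0"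
      using assms by (auto simp: coeff_eq_0)
  qed auto
  finally show ?thesis by simp
qed

lemma coeff_binconv_top:
  assumes "\<And>i. i \<le> n \<Longrightarrow> wt_poly (d + i) (X i)" "\<And>i. i \<le> n \<Longrightarrow> wt_poly (e + i) (Y i)"
  shows "coeff (binconv X Y n) (d + e + n)
    = binconv (\<lambda>i. coeff (X i) (d + i)) (\<lambda>i. coeff (Y i) (e + i)) n"
  unfolding binconv_def coeff_sum
proof (intro sum.cong refl)
  fix i assume i: "i \<in> {..n}"
  have "coeff (of_nat (n choose i) * (X i * Y (n - i))) (d + e + n)
    = of_nat (n choose i) * coeff (X i * Y (n - i)) (d + e + n)"
    by (simp add: of_nat_poly)
  also have "coeff (X i * Y (n - i)) (d + e + n) = coeff (X i * Y (n - i)) ((d + i) + (e + (n - i)))"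
    using i by (simp add: add.assoc)
  also have "\<dots> = coeff (X i) (d + i) * coeff (Y (n - i)) (e + (n - i))"
    using assms(1)[of i] assms(2)[of "n - i"] i by (intro coeff_mult_top) (simp_all add: wt_poly_def)
  finally show "coeff (of_nat (n choose i) * X i * Y (n - i)) (d + e + n)
    = of_nat (n choose i) * coeff (X i) (d + i) * coeff (Y (n - i)) (e + (n - i))"
    by (simp add: mult.assoc)
qed

text \<open>A convolution adds weights and its top coefficient is the convolution of the top
  coefficients. Hence the weight bound propagates through the recursion, and the leading parts
  satisfy the same recursion with the constant removed.\<close>

lemma ode_seq_poly:
  fixes P Q R :: "nat \<Rightarrow> 'a::comm_ring_1 poly"
  assumes sys: "ode_seq [:h:] P Q R" and "P 0 = 0" "Q 0 = monom c 2" "R 0 = 0"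
  shows "wt_poly (1 + n) (P n) \<and> wt_poly (2 + n) (Q n) \<and> wt_poly (1 + n) (R n)"
    and "ode_seq 0 (\<lambda>n. coeff (P n) (1 + n)) (\<lambda>n. coeff (Q n) (2 + n)) (\<lambda>n. coeff (R n) (1 + n))"
proof -
  have num: "wt_poly d p \<Longrightarrow> wt_poly d (numeral k * p)" for d k and p :: "'a poly"
    using wt_poly_cmult[of d p "numeral k"] by simp
  have *: "wt_poly (1 + n) (P n) \<and> wt_poly (2 + n) (Q n) \<and> wt_poly (1 + n) (R n)" for n
  proof (induction n rule: less_induct)
    case (less n)
    show ?case
    proof (cases n)
      case 0
      then show ?thesis using assms by (auto simp: wt_poly_def degree_monom_le coeff_monom)
    next
      case (Suc m)
      have IH: "\<And>i. i \<le> m \<Longrightarrow> wt_poly (1 + i) (P i)" "\<And>i. i \<le> m \<Longrightarrow> wt_poly (2 + i) (Q i)"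
        "\<And>i. i \<le> m \<Longrightarrow> wt_poly (1 + i) (R i)"
        using less Suc by auto
      \<comment> \<open>The inhomogeneous term has degree two below its weight: the parity is right,
        but it is invisible in the top coefficient.\<close>
      have h: "wt_poly (2 + m) (if m = 0 then [:h:] else 0)"
        by (auto simp: wt_poly_def coeff_pCons split: nat.splits)
      have bc: "wt_poly (1 + 1 + m) (binconv P P m)" "wt_poly (1 + 2 + m) (binconv P Q m)"
        "wt_poly (1 + 2 + m) (binconv R Q m)" "wt_poly (1 + 1 + m) (binconv P R m)"
        using IH by (intro wt_poly_binconv; simp)+
      have eq: "1 + 1 + m = 2 + m" by simp
      have "wt_poly (2 + m) (P (Suc m))"
        using sys IH(2)[of m] h bc(1)[unfolded eq] unfolding ode_seq_def
        by (simp add: wt_poly_add wt_poly_diff num)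
      moreover have "wt_poly (1 + 2 + m) (Q (Suc m))"
        using sys bc(2,3) unfolding ode_seq_def by (simp only: wt_poly_diff num)
      moreover have "wt_poly (2 + m) (R (Suc m))"
        using sys IH(2)[of m] bc(4)[unfolded eq] unfolding ode_seq_def
        by (simp add: wt_poly_add num)
      moreover have "1 + Suc m = 2 + m" "2 + Suc m = 1 + 2 + m" by simp_all
      ultimately show ?thesis unfolding Suc by metis
    qed
  qed
  show "wt_poly (1 + n) (P n) \<and> wt_poly (2 + n) (Q n) \<and> wt_poly (1 + n) (R n)" by (rule *)
  have num: "coeff (numeral k * p) j = numeral k * coeff p j" for k and p :: "'a poly" and j
    by (simp add: numeral_poly)
  show "ode_seq 0 (\<lambda>n. coeff (P n) (1 + n)) (\<lambda>n. coeff (Q n) (2 + n)) (\<lambda>n. coeff (R n) (1 + n))"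
    unfolding ode_seq_def
  proof (intro allI conjI)
    fix n
    show "coeff (P (Suc n)) (1 + Suc n) = 2 * binconv (\<lambda>n. coeff (P n) (1 + n)) (\<lambda>n. coeff (P n) (1 + n)) n
        + coeff (Q n) (2 + n) - (if n = 0 then 0 else 0)"
      using coeff_binconv_top[of n 1 P 1 P] * sys
      by (auto simp: ode_seq_def num coeff_pCons split: nat.splits)
    show "coeff (Q (Suc n)) (2 + Suc n) = 8 * binconv (\<lambda>n. coeff (P n) (1 + n)) (\<lambda>n. coeff (Q n) (2 + n)) n
        - 16 * binconv (\<lambda>n. coeff (R n) (1 + n)) (\<lambda>n. coeff (Q n) (2 + n)) n"
      using coeff_binconv_top[of n 1 P 2 Q] coeff_binconv_top[of n 1 R 2 Q] * sys
      by (auto simp: ode_seq_def num)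
    show "coeff (R (Suc n)) (1 + Suc n) = coeff (Q n) (2 + n)
       + 4 * binconv (\<lambda>n. coeff (P n) (1 + n)) (\<lambda>n. coeff (R n) (1 + n)) n"
      using coeff_binconv_top[of n 1 P 1 R] * sys
      by (auto simp: ode_seq_def num)
  qed
qed

text \<open>The substitution (s p(s z), s^2 q(s z), s r(s z)) preserves solutions of the homogeneous
  system.\<close>

lemma ode_seq_scale:
  fixes s :: "'a::comm_ring_1"
  assumes "ode_seq 0 P Q R"
  shows "ode_seq 0 (\<lambda>n. s ^ (1 + n) * P n) (\<lambda>n. s ^ (2 + n) * Q n) (\<lambda>n. s ^ (1 + n) * R n)"
proof -
  have "binconv (\<lambda>n. s ^ (d + n) * X n) (\<lambda>n. s ^ (e + n) * Y n) n = s ^ (d + e + n) * binconv X Y n"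
    for d e n and X Y :: "nat \<Rightarrow> 'a"
    unfolding binconv_def sum_distrib_left
  proof (intro sum.cong refl)
    fix i assume "i \<in> {..n}"
    then have "s ^ (d + e + n) = s ^ (d + i) * s ^ (e + (n - i))"
      by (simp add: add.assoc flip: power_add)
    then show "of_nat (n choose i) * (s ^ (d + i) * X i) * (s ^ (e + (n - i)) * Y (n - i)) =
         s ^ (d + e + n) * (of_nat (n choose i) * X i * Y (n - i))"
      by (simp add: algebra_simps)
  qed
  note b = this[of 1 _ 1] this[of 1 _ 2]
  have "P (Suc n) = 2 * binconv P P n + Q n" "Q (Suc n) = 8 * binconv P Q n - 16 * binconv R Q n"
    "R (Suc n) = Q n + 4 * binconv P R n" for n
    using assms by (simp_all add: ode_seq_def)
  note eqs = this
  show ?thesis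
    unfolding ode_seq_def b eqs by (simp add: algebra_simps)
qed

lemma ode_seq_poly_degree:
  fixes P Q R :: "nat \<Rightarrow> rat poly"
  assumes sys: "ode_seq [:h:] P Q R" and init: "P 0 = 0" "Q 0 = monom (1/8) 2" "R 0 = 0" and "odd n"
  shows "degree (P n) = Suc n"
proof -
  \<comment> \<open>Chosen so that scaling turns the initial value 1/8 of \<open>q\<close> into 1,
    where the solution is integral. As \<open>s\<close> is irrational, the comparison with the
    integer solution takes place in the reals.\<close>
  define s :: real where "s = sqrt 8"
  have s2: "s ^ 2 = 8" by (simp add: s_def)
  define P1 where "P1 = (\<lambda>n. s ^ (1 + n) * of_rat (coeff (P n) (1 + n)))"
  define Q1 where "Q1 = (\<lambda>n. s ^ (2 + n) * of_rat (coeff (Q n) (2 + n)))"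
  define R1 where "R1 = (\<lambda>n. s ^ (1 + n) * of_rat (coeff (R n) (1 + n)))"
  have "ode_seq (of_rat 0 :: real) (\<lambda>n. of_rat (coeff (P n) (1 + n))) (\<lambda>n. of_rat (coeff (Q n) (2 + n)))
      (\<lambda>n. of_rat (coeff (R n) (1 + n)))"
    by (rule ode_seq_hom[OF ode_seq_poly(2)[OF sys init]]) (auto simp: of_rat_add of_rat_mult)
  then have 1: "ode_seq 0 P1 Q1 R1"
    unfolding P1_def Q1_def R1_def by (intro ode_seq_scale) simp
  obtain P2 Q2 R2 :: "nat \<Rightarrow> int" where 2: "ode_seq 0 P2 Q2 R2" "P2 0 = 0" "Q2 0 = 1" "R2 0 = 0"
    using ode_seq_exists .
  have 3: "ode_seq (real_of_int 0) (\<lambda>n. real_of_int (P2 n)) (\<lambda>n. of_int (Q2 n)) (\<lambda>n. of_int (R2 n))"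
    by (rule ode_seq_hom[OF 2(1)]) auto
  have "P1 n = of_int (P2 n)"
    using ode_seq_unique[OF 1, of "\<lambda>n. of_int (P2 n)" "\<lambda>n. of_int (Q2 n)" "\<lambda>n. of_int (R2 n)" n] 2 3 init s2
    by (simp add: P1_def Q1_def R1_def coeff_monom of_rat_divide power2_eq_square)
  then have "coeff (P n) (1 + n) \<noteq> 0"
    using ode_seq_odd_nonzero[OF 2 \<open>odd n\<close>] by (auto simp: P1_def)
  then show ?thesis
    using ode_seq_poly(1)[OF sys init, of n] le_degree[of "P n" "1 + n"] by (auto simp: wt_poly_def)
qed

section \<open>Theta series and doubling\<close>

definition theta_coeff :: "nat \<Rightarrow> real" where
  "theta_coeff n = (if n = 0 then 1 else if n \<in> range (\<lambda>k. k\<^sup>2) then 2 else 0)"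

text \<open>The theta series in the nome q = exp (- \<pi> t). As a power series it can be
  differentiated termwise, and its values at negative arguments give \<open>theta4\<close>.\<close>

definition thq :: "real \<Rightarrow> real" where "thq q = (\<Sum>n. theta_coeff n * q ^ n)"
definition thq' :: "real \<Rightarrow> real" where "thq' q = (\<Sum>n. diffs theta_coeff n * q ^ n)"
definition thq'' :: "real \<Rightarrow> real" where "thq'' q = (\<Sum>n. diffs (diffs theta_coeff) n * q ^ n)"

lemma theta_coeff_nonneg: "0 \<le> theta_coeff n" and theta_coeff_le: "theta_coeff n \<le> 2"
  by (auto simp: theta_coeff_def)

lemma summable_theta_coeff:
  assumes "\<bar>q\<bar> < 1" shows "summable (\<lambda>n. norm (theta_coeff n * q ^ n))"
proof (rule summable_comparison_test')
  show "summable (\<lambda>n. 2 * \<bar>q\<bar> ^ n)"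
    using assms by (intro summable_mult summable_geometric) auto
  show "norm (norm (theta_coeff n * q ^ n)) \<le> 2 * \<bar>q\<bar> ^ n" for n
    using theta_coeff_nonneg[of n] theta_coeff_le[of n]
    by (auto simp: abs_mult power_abs intro!: mult_right_mono)
qed

lemma thq_deriv:
  assumes "\<bar>q\<bar> < 1"
  shows "(thq has_real_derivative thq' q) (at q)" "(thq' has_real_derivative thq'' q) (at q)"
    "isCont thq'' q"
proof -
  obtain K where K: "\<bar>q\<bar> < K" "K < 1" using assms dense by blast
  obtain L where L: "K < L" "L < 1" using K dense by blast
  have s: "summable (\<lambda>n. theta_coeff n * x ^ n)" if "norm x < 1" for x
    using summable_theta_coeff[of x] that summable_norm_cancel by force
  have s1: "summable (\<lambda>n. diffs theta_coeff n * x ^ n)" if "norm x < 1" for x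
    using termdiff_converges[OF that s] by auto
  have s2: "summable (\<lambda>n. diffs (diffs theta_coeff) n * x ^ n)" if "norm x < 1" for x
    using termdiff_converges[OF that s1] by auto
  have n: "norm K < 1" "norm q < norm K" using K by auto
  show "(thq has_real_derivative thq' q) (at q)"
    using termdiffs_strong[OF s[OF n(1)] n(2)] unfolding thq_def thq'_def .
  show "(thq' has_real_derivative thq'' q) (at q)"
    using termdiffs_strong[OF s1[OF n(1)] n(2)] unfolding thq'_def thq''_def .
  show "isCont thq'' q"
    using isCont_powser[OF s2[OF n(1)] n(2)] unfolding thq''_def .
qed

lemmas thq_cont = thq_deriv(1)[THEN DERIV_isCont] thq_deriv(2)[THEN DERIV_isCont] thq_deriv(3)

lemma thq_0: "thq 0 = 1" "thq' 0 = 2"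
proof -
  have "(1::nat) \<in> range (\<lambda>k. k\<^sup>2)" by (rule image_eqI[of _ _ 1]) auto
  then show "thq 0 = 1" "thq' 0 = 2"
    unfolding thq_def thq'_def by (simp_all add: theta_coeff_def diffs_def)
qed

lemma thq_strict_mono:
  assumes "0 \<le> x" "x < y" "y < 1"
  shows "thq x < thq y"
proof -
  have s: "summable (\<lambda>n. theta_coeff n * x ^ n)" "summable (\<lambda>n. theta_coeff n * y ^ n)"
    using summable_theta_coeff[of x] summable_theta_coeff[of y] assms summable_norm_cancel by force+
  have "theta_coeff n * x ^ n \<le> theta_coeff n * y ^ n" for n
    using assms by (intro mult_left_mono power_mono theta_coeff_nonneg) auto
  moreover have "(1::nat) \<in> range (\<lambda>k. k\<^sup>2)" by (rule image_eqI[of _ _ 1]) auto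
  then have "theta_coeff 1 * x ^ 1 < theta_coeff 1 * y ^ 1"
    using assms by (simp add: theta_coeff_def)
  ultimately have "0 < (\<Sum>n. theta_coeff n * y ^ n - theta_coeff n * x ^ n)"
    by (intro suminf_pos2[of _ 1] summable_diff s) auto
  then show ?thesis unfolding thq_def using suminf_diff[OF s(2) s(1)] by simp
qed

lemma thq_ge_1: "0 \<le> q \<Longrightarrow> q < 1 \<Longrightarrow> 1 \<le> thq q"
  using thq_strict_mono[of 0 q] thq_0 by (cases "q = 0") auto

text \<open>The nonnegative integers hit every square once and the negative ones every nonzero
  square once. This accounts for the coefficients 1 at 0 and 2 at the other squares.\<close>

lemma thq_has_sum:
  assumes "\<bar>q\<bar> < 1"
  shows "((\<lambda>n::int. q ^ (nat \<bar>n\<bar>)\<^sup>2) has_sum thq q) UNIV"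
proof -
  define S where "S = range (\<lambda>k::nat. k\<^sup>2)"
  have sq: "m\<^sup>2 = n\<^sup>2 \<longleftrightarrow> m = n" for m n :: nat by (simp add: power_eq_iff_eq_base)
  have b1: "bij_betw (\<lambda>n::int. (nat \<bar>n\<bar>)\<^sup>2) {0..} S"
    unfolding bij_betw_def S_def
  proof safe
    show "inj_on (\<lambda>n::int. (nat \<bar>n\<bar>)\<^sup>2) {0..}" by (auto simp: inj_on_def sq)
    show "k\<^sup>2 \<in> (\<lambda>n::int. (nat \<bar>n\<bar>)\<^sup>2) ` {0..}" for k :: nat
      by (rule image_eqI[of _ _ "int k"]) auto
  qed auto
  have b2: "bij_betw (\<lambda>n::int. (nat \<bar>n\<bar>)\<^sup>2) {..<0} (S - {0})"
    unfolding bij_betw_def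
  proof (intro conjI equalityI subsetI)
    show "inj_on (\<lambda>n::int. (nat \<bar>n\<bar>)\<^sup>2) {..<0}" by (auto simp: inj_on_def sq)
    fix m assume "m \<in> S - {0}"
    then obtain k where "m = k\<^sup>2" "k \<noteq> 0" by (auto simp: S_def)
    then show "m \<in> (\<lambda>n::int. (nat \<bar>n\<bar>)\<^sup>2) ` {..<0}"
      by (intro image_eqI[of _ _ "- int k"]) auto
  qed (auto simp: S_def)
  have f: "(\<lambda>m. q ^ m) summable_on A" for A
    using assms by (intro summable_on_subset_banach[of _ UNIV A] norm_summable_imp_summable_on)
      (auto simp: power_abs summable_geometric)
  obtain a b where a: "((\<lambda>m. q ^ m) has_sum a) S" and b: "((\<lambda>m. q ^ m) has_sum b) (S - {0})"
    using f[of S] f[of "S - {0}"] unfolding summable_on_def by blast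
  have "((\<lambda>m. if m \<in> S then q ^ m else 0) has_sum a) UNIV"
    using a by (subst has_sum_cong_neutral[where S = UNIV and T = S and g = "\<lambda>m. q ^ m"]) auto
  moreover have "((\<lambda>m. if m \<in> S - {0} then q ^ m else 0) has_sum b) UNIV"
    using b by (subst has_sum_cong_neutral[where S = UNIV and T = "S - {0}" and g = "\<lambda>m. q ^ m"]) auto
  ultimately have "((\<lambda>m. (if m \<in> S then q ^ m else 0) + (if m \<in> S - {0} then q ^ m else 0)) has_sum (a + b)) UNIV"
    by (rule has_sum_add)
  also have "(\<lambda>m. (if m \<in> S then q ^ m else 0) + (if m \<in> S - {0} then q ^ m else 0))
      = (\<lambda>m. theta_coeff m * q ^ m)"
  proof -
    have "0 \<in> S" unfolding S_def by (rule image_eqI[of _ _ 0]) auto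
    then show ?thesis by (auto simp: theta_coeff_def S_def fun_eq_iff)
  qed
  finally have ab: "thq q = a + b"
    unfolding thq_def using has_sum_imp_sums sums_unique by metis
  have "((\<lambda>n::int. q ^ (nat \<bar>n\<bar>)\<^sup>2) has_sum (a + b)) ({0..} \<union> {..<0})"
    by (intro has_sum_Un_disjoint)
       (use a b has_sum_reindex_bij_betw[OF b1, of "\<lambda>m. q ^ m"] has_sum_reindex_bij_betw[OF b2, of "\<lambda>m. q ^ m"] in auto)
  moreover have "{0..} \<union> {..<0} = (UNIV :: int set)" by auto
  ultimately show ?thesis by (simp add: ab)
qed

lemma theta_eq_thq:
  assumes "t > 0" shows "theta t = thq (exp (- pi * t))"
proof -
  have "((\<lambda>n::int. exp (- pi * t) ^ (nat \<bar>n\<bar>)\<^sup>2) has_sum thq (exp (- pi * t))) UNIV"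
    using assms by (intro thq_has_sum) auto
  moreover have "exp (- pi * t) ^ (nat \<bar>n\<bar>)\<^sup>2 = exp (- pi * (real_of_int n)\<^sup>2 * t)" for n :: int
  proof -
    have "real ((nat \<bar>n\<bar>)\<^sup>2) = (real_of_int n)\<^sup>2" by simp
    then show ?thesis by (simp add: exp_of_nat_mult [symmetric] mult_ac del: of_nat_power)
  qed
  ultimately show ?thesis unfolding theta_def by (auto intro: infsumI)
qed

section \<open>Splitting the lattice by parity and the doubling formulas\<close>

lemma thq_has_sum_parity:
  assumes "\<bar>q\<bar> < 1"
  shows "((\<lambda>n::int. q ^ (nat \<bar>n\<bar>)\<^sup>2) has_sum thq (q ^ 4)) {n. even n}"
    and "((\<lambda>n::int. q ^ (nat \<bar>n\<bar>)\<^sup>2) has_sum (thq q - thq (q ^ 4))) {n. odd n}"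
proof -
  have q4: "\<bar>q ^ 4\<bar> < 1" using power_strict_mono[of "\<bar>q\<bar>" 1 4] assms by (simp add: power_abs)
  have b: "bij_betw (\<lambda>n::int. 2 * n) UNIV {n. even n}"
    by (auto simp: bij_betw_def inj_on_def elim!: evenE)
  have "((\<lambda>n::int. q ^ (nat \<bar>2 * n\<bar>)\<^sup>2) has_sum thq (q ^ 4)) UNIV"
    using thq_has_sum[OF q4] by (simp add: abs_mult nat_mult_distrib power_mult_distrib power_mult)
  then show e: "((\<lambda>n::int. q ^ (nat \<bar>n\<bar>)\<^sup>2) has_sum thq (q ^ 4)) {n. even n}"
    using has_sum_reindex_bij_betw[OF b, of "\<lambda>n. q ^ (nat \<bar>n\<bar>)\<^sup>2"] by simp
  have "((\<lambda>n::int. q ^ (nat \<bar>n\<bar>)\<^sup>2) has_sum (thq q - thq (q ^ 4))) (UNIV - {n. even n})"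
    by (intro has_sum_Diff thq_has_sum assms e) auto
  moreover have "UNIV - {n::int. even n} = {n. odd n}" by auto
  ultimately show "((\<lambda>n::int. q ^ (nat \<bar>n\<bar>)\<^sup>2) has_sum (thq q - thq (q ^ 4))) {n. odd n}" by simp
qed

text \<open>A square has the parity of its root, so the sign changes exactly the terms with odd
  index.\<close>

lemma thq_minus:
  assumes "\<bar>q\<bar> < 1" shows "thq (- q) = 2 * thq (q ^ 4) - thq q"
proof -
  have "((\<lambda>n::int. (- q) ^ (nat \<bar>n\<bar>)\<^sup>2) has_sum thq (q ^ 4)) {n. even n}"
    using thq_has_sum_parity(1)[of "- q"] assms by simp
  moreover have "((\<lambda>n::int. (- q) ^ (nat \<bar>n\<bar>)\<^sup>2) has_sum (thq (- q) - thq (q ^ 4))) {n. odd n}"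
    using thq_has_sum_parity(2)[of "- q"] assms by simp
  then have "((\<lambda>n::int. - (q ^ (nat \<bar>n\<bar>)\<^sup>2)) has_sum (thq (- q) - thq (q ^ 4))) {n. odd n}"
    by (rule has_sum_cong[THEN iffD1, rotated]) (auto simp: even_nat_iff)
  then have "((\<lambda>n::int. q ^ (nat \<bar>n\<bar>)\<^sup>2) has_sum - (thq (- q) - thq (q ^ 4))) {n. odd n}"
    by (simp add: has_sum_uminus)
  from has_sum_unique[OF this thq_has_sum_parity(2)[OF assms]] show ?thesis by simp
qed

lemma has_sum_product_nonneg:
  fixes f :: "'a \<Rightarrow> real" and g :: "'b \<Rightarrow> real"
  assumes f: "(f has_sum a) A" and g: "(g has_sum b) B"
    and "\<And>x. x \<in> A \<Longrightarrow> f x \<ge> 0" "\<And>y. y \<in> B \<Longrightarrow> g y \<ge> 0"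
  shows "((\<lambda>(x, y). f x * g y) has_sum (a * b)) (A \<times> B)"
proof (rule has_sum_SigmaI)
  show *: "((\<lambda>y. case (x, y) of (x, y) \<Rightarrow> f x * g y) has_sum (f x * b)) B" if "x \<in> A" for x
    using has_sum_cmult_right[OF g] by simp
  show **: "((\<lambda>x. f x * b) has_sum (a * b)) A"
    by (rule has_sum_cmult_left[OF f])
  show "(\<lambda>(x, y). f x * g y) summable_on A \<times> B"
    using * by (rule summable_on_SigmaI) (use ** assms in \<open>auto simp: summable_on_def\<close>)
qed

text \<open>Rotating the lattice by \<open>(a, b) \<mapsto> (a + b, a - b)\<close> gives
  \<open>\<theta>\<^sub>3(2\<tau>)\<^sup>2 = \<theta>\<^sub>3(4\<tau>)\<^sup>2 + \<theta>\<^sub>2(4\<tau>)\<^sup>2\<close>, from which all doubling formulas follow.\<close>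

lemma thq_square:
  assumes "0 \<le> q" "q < 1"
  shows "thq (q\<^sup>2) ^ 2 = thq (q ^ 4) ^ 2 + (thq q - thq (q ^ 4)) ^ 2"
proof -
  define f where "f = (\<lambda>n::int. q ^ (nat \<bar>n\<bar>)\<^sup>2)"
  define g where "g = (\<lambda>n::int. (q\<^sup>2) ^ (nat \<bar>n\<bar>)\<^sup>2)"
  define B where "B = ({n::int. even n} \<times> {n::int. even n}) \<union> ({n. odd n} \<times> {n. odd n})"
  have q: "\<bar>q\<bar> < 1" "\<bar>q\<^sup>2\<bar> < 1" using assms by (auto simp: power_less_one_iff abs_square_less_1)
  have nn: "f n \<ge> 0" "g n \<ge> 0" for n using assms by (auto simp: f_def g_def)
  have 1: "((\<lambda>(m, n). f m * f n) has_sum (thq (q ^ 4) * thq (q ^ 4)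
        + (thq q - thq (q ^ 4)) * (thq q - thq (q ^ 4)))) B"
    unfolding B_def
    using thq_has_sum_parity[OF q(1)] nn
    by (intro has_sum_Un_disjoint has_sum_product_nonneg) (auto simp: f_def)
  have 2: "((\<lambda>(m, n). g m * g n) has_sum (thq (q\<^sup>2) * thq (q\<^sup>2))) (UNIV \<times> UNIV)"
    using thq_has_sum[OF q(2)] nn
    by (intro has_sum_product_nonneg) (auto simp: g_def)
  have bij: "bij_betw (\<lambda>(a, b). (a + b, a - b)) (UNIV \<times> UNIV) B"
    unfolding bij_betw_def
  proof (intro conjI equalityI subsetI)
    show "inj_on (\<lambda>(a::int, b). (a + b, a - b)) (UNIV \<times> UNIV)" by (auto simp: inj_on_def)
    fix z assume "z \<in> B"
    then obtain m n where z: "z = (m, n)" "even (m + n)" by (cases z) (auto simp: B_def)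
    then have "z = (\<lambda>(a, b). (a + b, a - b)) ((m + n) div 2, m - (m + n) div 2)" by (auto elim!: evenE)
    then show "z \<in> (\<lambda>(a, b). (a + b, a - b)) ` (UNIV \<times> UNIV)" by blast
  qed (auto simp: B_def)
  have "f (a + b) * f (a - b) = g a * g b" for a b
  proof -
    have "int ((nat \<bar>a + b\<bar>)\<^sup>2 + (nat \<bar>a - b\<bar>)\<^sup>2) = int (2 * (nat \<bar>a\<bar>)\<^sup>2 + 2 * (nat \<bar>b\<bar>)\<^sup>2)"
      by (simp add: power2_eq_square algebra_simps)
    then have "(nat \<bar>a + b\<bar>)\<^sup>2 + (nat \<bar>a - b\<bar>)\<^sup>2 = 2 * (nat \<bar>a\<bar>)\<^sup>2 + 2 * (nat \<bar>b\<bar>)\<^sup>2"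
      by (simp only: of_nat_eq_iff)
    then show ?thesis unfolding f_def g_def by (simp flip: power_add power_mult)
  qed
  then have "((\<lambda>(a, b). f (a + b) * f (a - b)) has_sum (thq (q\<^sup>2) * thq (q\<^sup>2))) (UNIV \<times> UNIV)"
    using 2 by simp
  moreover have "(\<lambda>(a, b). f (a + b) * f (a - b)) = (\<lambda>x. (\<lambda>(m, n). f m * f n) ((\<lambda>(a, b). (a + b, a - b)) x))"
    by auto
  ultimately have "((\<lambda>(m, n). f m * f n) has_sum (thq (q\<^sup>2) * thq (q\<^sup>2))) B"
    using has_sum_reindex_bij_betw[OF bij, of "\<lambda>(m, n). f m * f n"] by simp
  from has_sum_unique[OF this 1] show ?thesis by (simp add: power2_eq_square)
qed

text \<open>The Jacobi theta constants \<open>\<theta>\<^sub>4\<close> and \<open>\<theta>\<^sub>2\<close>, expressed through \<open>\<theta> = \<theta>\<^sub>3\<close>.\<close>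

definition theta4 :: "real \<Rightarrow> real" where "theta4 t = 2 * theta (4 * t) - theta t"
definition theta2 :: "real \<Rightarrow> real" where "theta2 t = theta (t / 4) - theta t"

lemma theta4_eq_thq: "t > 0 \<Longrightarrow> theta4 t = thq (- exp (- pi * t))"
  using thq_minus[of "exp (- pi * t)"]
  by (simp add: theta4_def theta_eq_thq exp_of_nat_mult [symmetric] mult_ac)

lemma theta_square:
  assumes "t > 0"
  shows "theta (2 * t) ^ 2 = theta (4 * t) ^ 2 + (theta t - theta (4 * t)) ^ 2"
  using thq_square[of "exp (- pi * t)"] assms
  by (simp add: theta_eq_thq exp_of_nat_mult [symmetric] mult_ac)

lemma theta_ge_1: "t > 0 \<Longrightarrow> theta t \<ge> 1"
  by (simp add: theta_eq_thq thq_ge_1)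

lemma theta_pos: "t > 0 \<Longrightarrow> theta t > 0"
  using theta_ge_1[of t] by simp

lemma theta2_pos: "t > 0 \<Longrightarrow> theta2 t > 0"
  using thq_strict_mono[of "exp (- pi * t)" "exp (- pi * (t / 4))"]
  by (simp add: theta2_def theta_eq_thq)

lemma theta_double: "t > 0 \<Longrightarrow> theta t ^ 2 + theta4 t ^ 2 = 2 * theta (2 * t) ^ 2"
  using theta_square[of t] by (simp add: theta4_def power2_eq_square algebra_simps)

lemma theta4_double: "t > 0 \<Longrightarrow> theta4 (2 * t) ^ 2 = theta t * theta4 t"
  using theta_square[of t] theta_square[of "2 * t"]
  by (simp add: theta4_def power2_eq_square algebra_simps)

text \<open>With \<open>theta2_half\<close>: when t is halved, the pair of
  \<open>t * theta t ^ 2\<close> and \<open>t * theta2 t ^ 2\<close> makes one step of the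
  arithmetic-geometric mean. The factor t absorbs the halves in the means.\<close>

lemma theta_half: "t > 0 \<Longrightarrow> theta t ^ 2 + theta2 t ^ 2 = theta (t / 2) ^ 2"
  using theta_square[of "t / 4"] by (simp add: theta2_def power2_eq_square algebra_simps)

lemma theta2_half: "t > 0 \<Longrightarrow> 2 * theta t * theta2 t = theta2 (t / 2) ^ 2"
  using theta_square[of "t / 4"] theta_square[of "t / 8"]
  by (simp add: theta2_def power2_eq_square algebra_simps)

text \<open>The identity (A^2 + B^2)^2 = (A^2 - B^2)^2 + 4 A^2 B^2, with A and B the values of
  \<open>theta\<close> and \<open>theta4\<close> at t/2.\<close>

lemma theta_jacobi: "t > 0 \<Longrightarrow> theta t ^ 4 = theta4 t ^ 4 + theta2 t ^ 4"
proof -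
  assume t: "t > 0"
  have a: "2 * theta t ^ 2 = theta (t/2) ^ 2 + theta4 (t/2) ^ 2" using theta_double[of "t/2"] t by simp
  have b: "theta4 t ^ 2 = theta (t/2) * theta4 (t/2)" using theta4_double[of "t/2"] t by simp
  have "2 * theta2 t ^ 2 = theta (t/2) ^ 2 - theta4 (t/2) ^ 2"
    using theta_half[OF t] a by simp
  then have "4 * theta2 t ^ 4 = (theta (t/2) ^ 2 - theta4 (t/2) ^ 2) ^ 2"
    by algebra
  moreover have "4 * theta t ^ 4 = (theta (t/2) ^ 2 + theta4 (t/2) ^ 2) ^ 2"
    using a by algebra
  moreover have "theta4 t ^ 4 = theta (t/2) ^ 2 * theta4 (t/2) ^ 2"
    using b by algebra
  ultimately have "4 * theta t ^ 4 = 4 * (theta4 t ^ 4 + theta2 t ^ 4)" by algebra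
  then show ?thesis by simp
qed

lemma tendsto_exp_neg_pi: "((\<lambda>t. exp (- pi * t)) \<longlongrightarrow> 0) at_top"
  by real_asymp

lemma theta_at_top: "(theta \<longlongrightarrow> 1) at_top" "(theta4 \<longlongrightarrow> 1) at_top"
proof -
  have "((\<lambda>t. thq (exp (- pi * t))) \<longlongrightarrow> thq 0) at_top"
    by (intro isCont_tendsto_compose[OF thq_cont(1)] tendsto_exp_neg_pi) auto
  moreover have "eventually (\<lambda>t. thq (exp (- pi * t)) = theta t) at_top"
    by (rule eventually_mono[OF eventually_gt_at_top[of 0]]) (simp add: theta_eq_thq)
  ultimately show "(theta \<longlongrightarrow> 1) at_top"
    using Lim_transform_eventually thq_0 by fastforce
  have "((\<lambda>t. thq (- exp (- pi * t))) \<longlongrightarrow> thq 0) at_top"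
    using tendsto_minus[OF tendsto_exp_neg_pi]
    by (intro isCont_tendsto_compose[OF thq_cont(1)]) auto
  moreover have "eventually (\<lambda>t. thq (- exp (- pi * t)) = theta4 t) at_top"
    by (rule eventually_mono[OF eventually_gt_at_top[of 0]]) (simp add: theta4_eq_thq)
  ultimately show "(theta4 \<longlongrightarrow> 1) at_top"
    using Lim_transform_eventually thq_0 by fastforce
qed

text \<open>The geometric mean relation gives the sign. A zero would propagate to all
  \<open>2 ^ n * t\<close> and contradict the limit 1 at infinity.\<close>

lemma theta4_pos:
  assumes "t > 0" shows "theta4 t > 0"
proof -
  have nn: "theta4 s \<ge> 0" if "s > 0" for s
    using theta4_double[OF that] theta_pos[OF that] by (metis zero_le_mult_iff zero_le_power2 not_le)
  have "theta4 t \<noteq> 0"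
  proof
    assume 0: "theta4 t = 0"
    have "theta4 (2 ^ n * t) = 0" for n
    proof (induction n)
      case (Suc n)
      then show ?case using theta4_double[of "2 ^ n * t"] assms by (simp add: mult_ac)
    qed (use 0 in simp)
    moreover have "filterlim (\<lambda>n. 2 ^ n * t) at_top sequentially" using assms by real_asymp
    then have "(\<lambda>n. theta4 (2 ^ n * t)) \<longlonglongrightarrow> 1"
      by (rule filterlim_compose[OF theta_at_top(2)])
    ultimately show False by (simp add: LIMSEQ_const_iff)
  qed
  then show ?thesis using nn[OF assms] by simp
qed

section \<open>The arithmetic-geometric mean integral\<close>

definition agm_fun :: "real \<Rightarrow> real \<Rightarrow> real \<Rightarrow> real" where
  "agm_fun a b x = 1 / sqrt ((x\<^sup>2 + a\<^sup>2) * (x\<^sup>2 + b\<^sup>2))"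

text \<open>Gauss's complete elliptic integral, taken over the whole line so that its value is \<pi>
  divided by the arithmetic-geometric mean of a and b.\<close>

definition agm_int :: "real \<Rightarrow> real \<Rightarrow> real" where
  "agm_int a b = (LINT x|lborel. agm_fun a b x)"

lemma agm_fun_cont: "a > 0 \<Longrightarrow> b > 0 \<Longrightarrow> isCont (agm_fun a b) x"
  unfolding agm_fun_def
  by (intro continuous_intros) (auto simp: add_pos_pos sum_power2_gt_zero_iff pos_add_strict add_nonneg_eq_0_iff)

lemma agm_fun_pos: "a > 0 \<Longrightarrow> b > 0 \<Longrightarrow> agm_fun a b x > 0"
  by (simp add: agm_fun_def add_nonneg_pos)

lemma agm_fun_borel [measurable]: "agm_fun a b \<in> borel_measurable borel"
  unfolding agm_fun_def by measurable

lemma agm_fun_mono: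
  assumes "0 < a" "0 < b" "a \<le> a'" "b \<le> b'"
  shows "agm_fun a' b' x \<le> agm_fun a b x"
  unfolding agm_fun_def using assms
  by (intro divide_left_mono mult_pos_pos real_sqrt_le_mono mult_mono add_left_mono power_mono)
     (auto simp: add_nonneg_pos)

lemma agm_diag:
  assumes "c > 0"
  shows "integrable lborel (agm_fun c c)" "agm_int c c = pi / c"
proof -
  have 1: "has_bochner_integral lborel (\<lambda>x. inverse (1 + x\<^sup>2)) pi"
    using integrable_inverse_1_plus_square LBINT_inverse_1_plus_square
    by (simp add: has_bochner_integral_iff interval_lebesgue_integral_def set_integrable_def
        set_lebesgue_integral_def)
  have eq: "agm_fun c c (c * x) = inverse (1 + x\<^sup>2) / c\<^sup>2" for x
  proof -
    have "(c * x)\<^sup>2 + c\<^sup>2 = c\<^sup>2 * (1 + x\<^sup>2)" by algebra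
    moreover have "0 < c\<^sup>2 * (1 + x\<^sup>2)" using assms by (simp add: add_pos_nonneg)
    ultimately show ?thesis
      by (simp add: agm_fun_def real_sqrt_abs2 del: zero_less_mult_iff) (simp add: field_simps)
  qed
  have "has_bochner_integral lborel (\<lambda>x. agm_fun c c (0 + c * x)) (pi / c\<^sup>2)"
    using has_bochner_integral_divide_zero[OF 1] by (simp add: eq)
  then have "has_bochner_integral lborel (agm_fun c c) (c * (pi / c\<^sup>2))"
    using lborel_has_bochner_integral_real_affine_iff[of c "agm_fun c c" "c * (pi / c\<^sup>2)" 0] assms
    by (simp add: divide_simps)
  then show "integrable lborel (agm_fun c c)" "agm_int c c = pi / c"
    using assms by (simp_all add: has_bochner_integral_iff agm_int_def power2_eq_square)
qed

lemma agm_integrable: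
  assumes "a > 0" "b > 0" shows "integrable lborel (agm_fun a b)"
proof (rule Bochner_Integration.integrable_bound[OF agm_diag(1)[of "min a b"]])
  show "AE x in lborel. norm (agm_fun a b x) \<le> norm (agm_fun (min a b) (min a b) x)"
    using assms agm_fun_mono[of "min a b" "min a b" a b] agm_fun_pos
    by (intro AE_I2) (simp add: abs_of_pos less_imp_le)
qed (use assms in auto)

lemma agm_int_mono:
  assumes "0 < a" "0 < b" "a \<le> a'" "b \<le> b'"
  shows "agm_int a' b' \<le> agm_int a b"
  unfolding agm_int_def using assms by (intro integral_mono agm_integrable agm_fun_mono) auto

lemma agm_int_bounds:
  assumes "a > 0" "b > 0"
  shows "pi / max a b \<le> agm_int a b" "agm_int a b \<le> pi / min a b"
  using agm_int_mono[of a b "max a b" "max a b"] agm_int_mono[of "min a b" "min a b" a b]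
    agm_diag(2)[of "max a b"] agm_diag(2)[of "min a b"] assms by auto

lemma agm_int_scale:
  assumes "a > 0" "b > 0" "c > 0"
  shows "agm_int (c * a) (c * b) = agm_int a b / c"
proof -
  have eq: "agm_fun (c * a) (c * b) (c * x) = agm_fun a b x / c\<^sup>2" for x
  proof -
    have "((c * x)\<^sup>2 + (c * a)\<^sup>2) * ((c * x)\<^sup>2 + (c * b)\<^sup>2) = (c\<^sup>2)\<^sup>2 * ((x\<^sup>2 + a\<^sup>2) * (x\<^sup>2 + b\<^sup>2))"
      by algebra
    then show ?thesis unfolding agm_fun_def by (simp only: real_sqrt_mult real_sqrt_abs) simp
  qed
  have "agm_int (c * a) (c * b) = \<bar>c\<bar> *\<^sub>R (LINT x|lborel. agm_fun (c * a) (c * b) (0 + c * x))"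
    unfolding agm_int_def using assms by (intro lborel_integral_real_affine) auto
  then show ?thesis using assms by (simp add: eq agm_int_def power2_eq_square)
qed

lemma agm_int_half:
  assumes "a > 0" "b > 0"
  shows "set_integrable lborel (einterval 0 \<infinity>) (agm_fun a b)"
    "agm_int a b = 2 * (LBINT x=0..\<infinity>. agm_fun a b x)"
proof -
  have i: "set_integrable lborel A (agm_fun a b)" if "A \<in> sets borel" for A
    using agm_integrable[OF assms] that unfolding set_integrable_def
    by (intro integrable_mult_indicator) auto
  show "set_integrable lborel (einterval 0 \<infinity>) (agm_fun a b)" by (rule i) simp
  have "has_bochner_integral lborel (agm_fun a b) (2 *\<^sub>R (LBINT x:{0..}. agm_fun a b x))"
    using i[of "{0..}"]
    by (intro has_bochner_integral_even_function)
       (auto simp: agm_fun_def set_integrable_def set_lebesgue_integral_def has_bochner_integral_iff)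
  then have "agm_int a b = 2 * (LBINT x:{0..}. agm_fun a b x)"
    by (simp add: has_bochner_integral_iff agm_int_def)
  also have "(LBINT x:{0..}. agm_fun a b x) = (LBINT x=0..\<infinity>. agm_fun a b x)"
  proof -
    have "AE x in lborel. indicat_real {0..} x *\<^sub>R agm_fun a b x = indicat_real {0<..} x *\<^sub>R agm_fun a b x"
      using AE_lborel_singleton[of 0] by eventually_elim (auto simp: indicator_def)
    then have "(LBINT x:{0..}. agm_fun a b x) = (LBINT x:{0<..}. agm_fun a b x)"
      unfolding set_lebesgue_integral_def by (intro integral_cong_AE) auto
    then show ?thesis by (simp add: interval_lebesgue_integral_def zero_ereal_def einterval_eq)
  qed
  finally show "agm_int a b = 2 * (LBINT x=0..\<infinity>. agm_fun a b x)" .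
qed

text \<open>Landen's transformation in Newman's form, \<open>u = (x - ab/x)/2\<close>.\<close>

lemma agm_int_landen:
  assumes a: "a > 0" and b: "b > 0"
  shows "agm_int ((a + b) / 2) (sqrt (a * b)) = agm_int a b"
proof -
  define g where "g = (\<lambda>x. (x - a * b / x) / 2)"
  define g' where "g' = (\<lambda>x. (1 + a * b / x\<^sup>2) / 2)"
  define f where "f = agm_fun ((a + b) / 2) (sqrt (a * b))"
  have ab: "a * b > 0" using a b by simp
  \<comment> \<open>The factor 2 compensates for the domains: \<open>g\<close> maps the positive
    half-line onto the whole line. The two quadratic factors come from (x - ab/x)^2 + 4ab = (x +
    ab/x)^2 and x^2 ((x - ab/x)^2 + (a + b)^2) = (x^2 + a^2)(x^2 + b^2).\<close>
  have eq: "f (g x) * g' x = 2 * agm_fun a b x" if x: "x > 0" for x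
  proof -
    have 1: "(g x)\<^sup>2 + (sqrt (a * b))\<^sup>2 = ((x + a * b / x) / 2)\<^sup>2"
      using ab x by (simp add: g_def field_simps power2_eq_square)
    have 2: "(g x)\<^sup>2 + ((a + b) / 2)\<^sup>2 = (x\<^sup>2 + a\<^sup>2) * (x\<^sup>2 + b\<^sup>2) / (2 * x)\<^sup>2"
      using x by (simp add: g_def field_simps power2_eq_square)
    have 3: "g' x = (x + a * b / x) / 2 / x" using x by (simp add: g'_def field_simps power2_eq_square)
    have "x + a * b / x > 0" using ab x by (simp add: add_pos_pos)
    then have 4: "f (g x) = 1 / (sqrt ((x\<^sup>2 + a\<^sup>2) * (x\<^sup>2 + b\<^sup>2)) / (2 * x) * ((x + a * b / x) / 2))"
      unfolding f_def agm_fun_def 1 2 using x by (simp add: real_sqrt_mult real_sqrt_divide)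
    define c S where "c = x + a * b / x" and "S = sqrt ((x\<^sup>2 + a\<^sup>2) * (x\<^sup>2 + b\<^sup>2))"
    have "c > 0" "S > 0" using \<open>x + a * b / x > 0\<close> a b unfolding c_def S_def
      by (auto intro!: mult_pos_pos add_nonneg_pos)
    then show ?thesis
      unfolding 3 4 agm_fun_def c_def [symmetric] S_def [symmetric] using x by (simp add: field_simps)
  qed
  have cf: "isCont f x" for x unfolding f_def using a b by (intro agm_fun_cont) auto
  have half: "set_integrable lborel (einterval 0 \<infinity>) (\<lambda>x. 2 * agm_fun a b x)"
    using agm_int_half(1)[OF a b] by (rule set_integrable_mult_right)
  have "(LBINT x=-\<infinity>..\<infinity>. f x) = (LBINT x=0..\<infinity>. f (g x) * g' x)"
  proof (rule interval_integral_substitution_nonneg(2))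
    show "DERIV g x :> g' x" if "0 < ereal x" for x
      using that unfolding g_def g'_def
      by (auto intro!: derivative_eq_intros simp: power2_eq_square zero_ereal_def)
    show "isCont g' x" if "0 < ereal x" for x
      using that unfolding g'_def by (auto intro!: continuous_intros simp: zero_ereal_def)
    show "0 \<le> f (g x)" for x
      unfolding f_def using a b by (intro less_imp_le agm_fun_pos) auto
    show "0 \<le> g' x" for x unfolding g'_def using ab by simp
    have "filterlim g at_bot (at_right 0)" unfolding g_def using ab by real_asymp
    then show "((ereal \<circ> g \<circ> real_of_ereal) \<longlongrightarrow> - \<infinity>) (at_right 0)"
      by (simp add: zero_ereal_def ereal_tendsto_simps)
    have "filterlim g at_top at_top" unfolding g_def using ab by real_asymp
    then show "((ereal \<circ> g \<circ> real_of_ereal) \<longlongrightarrow> \<infinity>) (at_left \<infinity>)"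
      by (simp add: ereal_tendsto_simps)
    show "set_integrable lborel (einterval 0 \<infinity>) (\<lambda>x. f (g x) * g' x)"
      using half by (rule set_integrable_cong[THEN iffD1, rotated 3]) (auto simp: eq einterval_iff zero_ereal_def)
  qed (use cf in auto)
  also have "\<dots> = (LBINT x=0..\<infinity>. 2 * agm_fun a b x)"
    by (rule interval_integral_cong) (auto simp: eq einterval_iff zero_ereal_def)
  also have "\<dots> = agm_int a b"
    using agm_int_half[OF a b] by simp
  finally show ?thesis
    by (simp add: f_def agm_int_def interval_lebesgue_integral_def set_lebesgue_integral_def)
qed

text \<open>With s = x / sqrt (1 + x^2) the integrand becomes sqrt 2 ds / sqrt (1 - s^4), the
  lemniscate integrand. The further substitution y = s^4, which is \<open>g\<close>, leads to the
  Beta integral with parameters 1/4 and 1/2.\<close>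

lemma agm_int_lemniscate: "agm_int 1 (1 / sqrt 2) = pi * sqrt pi / Gamma (3/4) ^ 2"
proof -
  define g :: "real \<Rightarrow> real" where "g = (\<lambda>x. x ^ 4 / (1 + x\<^sup>2) ^ 2)"
  define g' :: "real \<Rightarrow> real" where "g' = (\<lambda>x. 4 * x ^ 3 / (1 + x\<^sup>2) ^ 3)"
  define f :: "real \<Rightarrow> real" where "f = (\<lambda>y. y powr (1/4 - 1) * (1 - y) powr (1/2 - 1))"
  have s: "(1::real) + x\<^sup>2 > 0" for x by (simp add: add_pos_nonneg)
  have 1: "1 - g x = (1 + 2 * x\<^sup>2) / (1 + x\<^sup>2) ^ 2" for x
    using s[of x] by (simp add: g_def field_simps) algebra
  have g01: "0 < g x" "g x < 1" if "x > 0" for x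
  proof -
    show "0 < g x" using that s[of x] by (simp add: g_def)
    have "0 < 1 - g x" unfolding 1 using s[of x] by (intro divide_pos_pos zero_less_power add_pos_nonneg) auto
    then show "g x < 1" by simp
  qed
  have eq: "f (g x) * g' x = 2 * sqrt 2 * agm_fun 1 (1 / sqrt 2) x" if x: "x > 0" for x
  proof -
    define c where "c = sqrt (1 + x\<^sup>2)"
    have c: "c > 0" "1 + x\<^sup>2 = c\<^sup>2" using s[of x] by (simp_all add: c_def)
    have "g x = (x / c) ^ 4" by (simp add: g_def c power_divide)
    then have "g x powr (1/4 - 1) = (x / c) powr (4 * (1/4 - 1))"
      using x c by (simp add: powr_powr flip: powr_numeral)
    also have "\<dots> = c ^ 3 / x ^ 3" using x c by (simp add: powr_minus powr_divide field_simps)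
    finally have 2: "g x powr (1/4 - 1) = c ^ 3 / x ^ 3" .
    have "(1 - g x) powr (1/2 - 1) = 1 / sqrt ((1 + 2 * x\<^sup>2) / (1 + x\<^sup>2) ^ 2)"
      using 1 g01(2)[OF x] by (simp add: powr_minus powr_half_sqrt field_simps)
    also have "\<dots> = c\<^sup>2 / sqrt (1 + 2 * x\<^sup>2)"
    proof -
      have "sqrt ((c\<^sup>2)\<^sup>2) = c\<^sup>2" by (rule real_sqrt_unique) auto
      then show ?thesis unfolding c(2) real_sqrt_divide by simp
    qed
    finally have 3: "(1 - g x) powr (1/2 - 1) = c\<^sup>2 / sqrt (1 + 2 * x\<^sup>2)" .
    have 4: "agm_fun 1 (1 / sqrt 2) x = sqrt 2 / (c * sqrt (1 + 2 * x\<^sup>2))"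
    proof -
      have 5: "(x\<^sup>2 + 1\<^sup>2) * (x\<^sup>2 + (1 / sqrt 2)\<^sup>2) = c\<^sup>2 * (1 + 2 * x\<^sup>2) / 2"
        by (simp flip: c(2) add: power_divide field_simps)
      show ?thesis unfolding agm_fun_def 5 real_sqrt_mult real_sqrt_divide using c by simp
    qed
    have "f (g x) * g' x = c ^ 3 / x ^ 3 * (c\<^sup>2 / sqrt (1 + 2 * x\<^sup>2)) * (4 * x ^ 3 / (c\<^sup>2) ^ 3)"
      unfolding f_def 2 3 g'_def c(2) ..
    also have "\<dots> = 2 * sqrt 2 * (sqrt 2 / (c * sqrt (1 + 2 * x\<^sup>2)))"
    proof -
      define d where "d = sqrt (1 + 2 * x\<^sup>2)"
      have "d > 0" unfolding d_def by (simp add: add_pos_nonneg)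
      then show ?thesis unfolding d_def [symmetric] using c x
        by (simp add: divide_simps) (simp add: power_numeral_reduce power2_eq_square)
    qed
    finally show ?thesis by (simp add: 4)
  qed
  have i: "set_integrable lborel (einterval 0 \<infinity>) (\<lambda>x. f (g x) * g' x)"
  proof -
    have "set_integrable lborel (einterval 0 \<infinity>) (\<lambda>x. 2 * sqrt 2 * agm_fun 1 (1 / sqrt 2) x)"
      by (intro set_integrable_mult_right agm_int_half) auto
    then show ?thesis
      by (rule set_integrable_cong[THEN iffD1, rotated 3]) (auto simp: eq einterval_iff zero_ereal_def)
  qed
  have d: "DERIV g x :> g' x" for x
    unfolding g_def g'_def using s[of x]
    by (auto intro!: derivative_eq_intros simp: divide_simps) algebra
  have cf: "isCont f (g x)" if "0 < ereal x" for x
    using g01[of x] that unfolding f_def by (intro continuous_intros) (auto simp: zero_ereal_def)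
  have l0: "((ereal \<circ> g \<circ> real_of_ereal) \<longlongrightarrow> 0) (at_right 0)"
  proof -
    have "(g \<longlongrightarrow> 0) (at_right 0)" unfolding g_def by real_asymp
    then show ?thesis by (simp add: zero_ereal_def ereal_tendsto_simps)
  qed
  have l1: "((ereal \<circ> g \<circ> real_of_ereal) \<longlongrightarrow> 1) (at_left \<infinity>)"
  proof -
    have "(g \<longlongrightarrow> 1) at_top" unfolding g_def by real_asymp
    then show ?thesis by (simp add: one_ereal_def ereal_tendsto_simps)
  qed
  have cg: "isCont g' x" for x
    unfolding g'_def using s[of x] by (intro continuous_intros) auto
  have fn: "0 \<le> f y" for y by (simp add: f_def)
  have gn: "0 \<le> g' x" if "0 \<le> ereal x" for x
    using that s[of x] by (simp add: g'_def zero_ereal_def)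
  note sub = interval_integral_substitution_nonneg[of 0 \<infinity> g g' f 0 1, OF _ d cf cg fn gn l0 l1 i]
  have si: "set_integrable lborel {0<..<1} f" and
    "(LBINT x=0..1. f x) = (LBINT x=0..\<infinity>. f (g x) * g' x)"
    using sub by (simp_all add: zero_ereal_def one_ereal_def einterval_eq)
  then have "(LBINT x:{0<..<1}. f x) = (LBINT x=0..\<infinity>. f (g x) * g' x)"
    by (simp add: interval_lebesgue_integral_def zero_ereal_def one_ereal_def einterval_eq)
  also have "\<dots> = (LBINT x=0..\<infinity>. 2 * sqrt 2 * agm_fun 1 (1 / sqrt 2) x)"
    by (rule interval_integral_cong) (auto simp: eq einterval_iff zero_ereal_def)
  also have "\<dots> = sqrt 2 * agm_int 1 (1 / sqrt 2)"
    using agm_int_half[of 1 "1 / sqrt 2"] by simp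
  finally have A: "(LBINT x:{0<..<1}. f x) = sqrt 2 * agm_int 1 (1 / sqrt 2)" .
  have "(f has_integral Beta (1/4) (1/2)) {0<..<1}"
    using has_integral_Beta_real[of "1/4" "1/2"] unfolding f_def by (simp add: has_integral_Icc_iff_Ioo)
  then have "Beta (1/4) (1/2) = (LBINT x:{0<..<1}. f x)"
    using set_borel_integral_eq_integral(2)[OF si] by (simp add: integral_unique)
  then have B: "Gamma (1/4) * sqrt pi / Gamma (3/4) = sqrt 2 * agm_int 1 (1 / sqrt 2)"
    using A by (simp add: Beta_def Gamma_one_half_real)
  \<comment> \<open>The reflection formula at 1/4 eliminates \<open>Gamma (1/4)\<close> in favour of
    \<open>Gamma (3/4)\<close>.\<close>
  have G: "Gamma (1/4) * Gamma (3/4) = pi * sqrt 2"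
  proof -
    have "complex_of_real (Gamma (1/4) * Gamma (3/4)) = of_real (pi / sin (pi * (1/4)))"
      using Gamma_reflection_complex[of "of_real (1/4)"]
      by (simp flip: Gamma_complex_of_real sin_of_real)
    then have "Gamma (1/4) * Gamma (3/4) = pi / sin (pi / 4)" by (simp only: of_real_eq_iff) simp
    moreover have "pi / (sqrt 2 / 2) = pi * sqrt 2" by (simp add: field_simps)
    ultimately show ?thesis by (simp only: sin_45)
  qed
  define g where "g = Gamma (3/4 :: real)"
  have "g > 0" unfolding g_def by (rule Gamma_real_pos) simp
  moreover have "Gamma (1/4) * g = pi * sqrt 2" using G by (simp add: g_def)
  ultimately have "Gamma (1/4) = pi * sqrt 2 / g" by (simp add: field_simps)
  then have "pi * sqrt 2 / g * sqrt pi / g = sqrt 2 * agm_int 1 (1 / sqrt 2)"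
    using B by (simp add: g_def)
  then show ?thesis unfolding g_def [symmetric] using \<open>g > 0\<close>
    by (simp add: field_simps power2_eq_square)
qed

section \<open>The functional equation\<close>

text \<open>With A the sum over n >= 0 of a decreasing Gaussian starting at 1, A exceeds the
  integral 1 / (2 sqrt s) by an amount between 0 and 1, and \<theta>(s) = 2A - 1. This crude bound
  is all the information at 0 that the functional equation requires.\<close>

lemma theta_bounds:
  assumes s: "s > 0" shows "\<bar>theta s - 1 / sqrt s\<bar> \<le> 1"
proof -
  define q where "q = exp (- pi * s)"
  define f where "f = (\<lambda>x. exp (- pi * s * x\<^sup>2))"
  have q: "\<bar>q\<bar> < 1" using s by (simp add: q_def)
  have fq: "f (of_nat n) = q ^ n\<^sup>2" for n
    by (simp add: f_def q_def exp_of_nat_mult [symmetric] mult_ac)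
  define h where "h = (\<lambda>n::int. q ^ (nat \<bar>n\<bar>)\<^sup>2)"
  have tot: "(h has_sum theta s) UNIV"
    using thq_has_sum[OF q] theta_eq_thq[OF s] by (simp add: q_def h_def)
  then obtain A where A: "(h has_sum A) {0..}"
    by (metis has_sum_imp_summable summable_on_subset_banach subset_UNIV summable_on_def)
  have "(h has_sum (A - h 0)) ({0..} - {0})"
    by (intro has_sum_Diff A) (auto simp: has_sum_finite_iff)
  moreover have "{0..} - {0} = {0::int<..}" by auto
  ultimately have "(h has_sum (A - 1)) {0<..}" by (simp add: h_def)
  moreover have "bij_betw uminus {..<0::int} {0<..}"
    by (rule bij_betwI[of _ _ _ uminus]) auto
  ultimately have "((\<lambda>n. h (- n)) has_sum (A - 1)) {..<0}"
    using has_sum_reindex_bij_betw[of uminus "{..<0::int}" "{0<..}" h] by simp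
  then have "(h has_sum (A - 1)) {..<0}" by (simp add: h_def)
  with A have "(h has_sum (A + (A - 1))) ({0..} \<union> {..<0})" by (intro has_sum_Un_disjoint) auto
  moreover have "{0..} \<union> {..<0} = (UNIV :: int set)" by auto
  ultimately have th: "theta s = 2 * A - 1" using has_sum_unique[OF tot] by simp
  have "bij_betw int UNIV {0..}"
    by (rule bij_betwI[of _ _ _ nat]) auto
  then have "((\<lambda>n. h (int n)) has_sum A) UNIV"
    using has_sum_reindex_bij_betw[of int UNIV "{0..}" h] A by simp
  then have "(\<lambda>n. f (of_nat n)) sums A" by (intro has_sum_imp_sums) (simp add: h_def fq)
  then have lim1: "(\<lambda>n. \<Sum>k\<le>n. f (of_nat k)) \<longlonglongrightarrow> A" by (simp add: sums_def_le)
  have fmono: "f y \<le> f x" if "0 \<le> x" "x \<le> y" for x y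
  proof -
    have "x\<^sup>2 \<le> y\<^sup>2" using that by (intro power_mono)
    then show ?thesis unfolding f_def using s by (simp add: mult_left_mono mult.assoc)
  qed
  have fc: "continuous_on S f" for S unfolding f_def by (intro continuous_intros)
  interpret antimono_fun_sum_integral_diff f
    by unfold_locales (use fmono fc in \<open>auto simp: f_def [abs_def]\<close>)
  have "0 \<le> sum_integral_diff_series n" "sum_integral_diff_series n \<le> 1" for n
  proof -
    have "sum_integral_diff_series 0 = f 0" by (simp add: sum_integral_diff_series_def)
    moreover have "f 0 = 1" by (simp add: f_def)
    ultimately show "0 \<le> sum_integral_diff_series n" "sum_integral_diff_series n \<le> 1"
      using sum_integral_diff_series_nonneg[of n] sum_integral_diff_series_antimono[of 0 n] by auto
  qed
  then have bd: "integral {0..of_nat n} f \<le> (\<Sum>k\<le>n. f (of_nat k))"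
     "(\<Sum>k\<le>n. f (of_nat k)) \<le> integral {0..of_nat n} f + 1" for n
    unfolding sum_integral_diff_series_def by (auto simp: algebra_simps)
  have lim2: "(\<lambda>n. integral {0..real n} f) \<longlonglongrightarrow> 1 / (2 * sqrt s)"
  proof -
    define c where "c = sqrt (pi * s)"
    have c: "c > 0" "c\<^sup>2 = pi * s" using s by (simp_all add: c_def)
    have g: "has_bochner_integral lborel (\<lambda>x. indicator {0..} x *\<^sub>R exp (- x\<^sup>2)) (sqrt pi / 2 :: real)"
      by (rule gaussian_moment_0)
    have "indicator {0..} (c * x) = (indicator {0..} x :: real)" for x
      using c(1) by (auto simp: indicator_def zero_le_mult_iff)
    moreover have "exp (- (c * x)\<^sup>2) = f x" for x by (simp add: f_def power_mult_distrib c(2))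
    ultimately have F0: "has_bochner_integral lborel (\<lambda>x. indicator {0..} x *\<^sub>R f x) ((sqrt pi / 2) /\<^sub>R \<bar>c\<bar>)"
      using g lborel_has_bochner_integral_real_affine_iff[of c "\<lambda>x. indicator {0..} x *\<^sub>R exp (- x\<^sup>2)" "sqrt pi / 2" 0] c
      by simp
    have F1: "(sqrt pi / 2) /\<^sub>R \<bar>c\<bar> = 1 / (2 * sqrt s)"
      using c(1) s by (simp add: c_def real_sqrt_mult field_simps)
    have F: "has_bochner_integral lborel (\<lambda>x. indicator {0..} x *\<^sub>R f x) (1 / (2 * sqrt s))"
      using F0 unfolding F1 .
    have "(\<lambda>n. LINT x|lborel. indicator {0..real n} x *\<^sub>R f x) \<longlonglongrightarrow> (LINT x|lborel. indicator {0..} x *\<^sub>R f x)"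
    proof (rule integral_dominated_convergence[where w = "\<lambda>x. indicator {0..} x *\<^sub>R f x"])
      show "integrable lborel (\<lambda>x. indicator {0..} x *\<^sub>R f x)" using F by (simp add: has_bochner_integral_iff)
      show "AE x in lborel. (\<lambda>n. indicator {0..real n} x *\<^sub>R f x) \<longlonglongrightarrow> indicator {0..} x *\<^sub>R f x"
      proof (intro AE_I2 tendsto_eventually)
        fix x :: real
        show "\<forall>\<^sub>F n in sequentially. indicator {0..real n} x *\<^sub>R f x = indicator {0..} x *\<^sub>R f x"
          using eventually_ge_at_top[of "nat \<lceil>x\<rceil>"]
        proof eventually_elim
          case (elim n)
          then have "x \<le> real n" by linarith
          then show ?case by (auto simp: indicator_def)
        qed
      qed
      show "AE x in lborel. norm (indicator {0..real n} x *\<^sub>R f x) \<le> indicator {0..} x *\<^sub>R f x" for n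
        by (auto simp: indicator_def f_def)
    qed (auto simp: f_def)
    moreover have "(LINT x|lborel. indicator {0..real n} x *\<^sub>R f x) = integral {0..real n} f" for n
      using set_borel_integral_eq_integral(2)[of "{0..real n}" f] borel_integrable_atLeastAtMost'[OF fc]
      by (simp add: set_lebesgue_integral_def)
    ultimately show ?thesis using F by (simp add: has_bochner_integral_iff)
  qed
  have "1 / (2 * sqrt s) \<le> A"
    by (rule LIMSEQ_le[OF lim2 lim1]) (use bd in auto)
  moreover have "A \<le> 1 / (2 * sqrt s) + 1"
    by (rule LIMSEQ_le[OF lim1 tendsto_add[OF lim2 tendsto_const]]) (use bd in auto)
  ultimately show ?thesis unfolding th by (simp add: abs_le_iff)
qed

lemma theta_at_0: "((\<lambda>s. sqrt s * theta s) \<longlongrightarrow> 1) (at_right 0)"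
proof -
  have "((\<lambda>s. sqrt s * theta s - 1) \<longlongrightarrow> 0) (at_right 0)"
  proof (rule Lim_null_comparison)
    show "\<forall>\<^sub>F s in at_right 0. norm (sqrt s * theta s - 1) \<le> sqrt s"
      using eventually_at_right_less[of 0]
    proof eventually_elim
      case (elim s)
      then have "sqrt s * \<bar>theta s - 1 / sqrt s\<bar> \<le> sqrt s * 1" by (intro mult_left_mono theta_bounds) auto
      moreover have "sqrt s * \<bar>theta s - 1 / sqrt s\<bar> = \<bar>sqrt s * (theta s - 1 / sqrt s)\<bar>"
        using elim by (simp add: abs_mult)
      ultimately show ?case using elim by (simp add: algebra_simps)
    qed
    show "(sqrt \<longlongrightarrow> 0) (at_right 0)" by real_asymp
  qed
  then show ?thesis by (simp add: LIM_zero_iff)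
qed

lemma theta2_at_0: "((\<lambda>s. sqrt s * theta2 s) \<longlongrightarrow> 1) (at_right 0)"
proof -
  have "filterlim (\<lambda>s::real. s / 4) (at_right 0) (at_right 0)" by real_asymp
  then have "((\<lambda>s. sqrt (s / 4) * theta (s / 4)) \<longlongrightarrow> 1) (at_right 0)"
    by (rule filterlim_compose[OF theta_at_0])
  then have "((\<lambda>s. 2 * (sqrt (s / 4) * theta (s / 4)) - sqrt s * theta s) \<longlongrightarrow> 2 * 1 - 1) (at_right 0)"
    by (intro tendsto_intros theta_at_0)
  then show ?thesis by (simp add: theta2_def real_sqrt_divide algebra_simps)
qed

text \<open>Doubling t is a step of the mean, so the integral is constant along t, 2t, 4t, ...; at
  infinity both arguments tend to 1, where the value is \<pi>.\<close>

lemma agm_theta4: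
  assumes "t > 0" shows "agm_int (theta t ^ 2) (theta4 t ^ 2) = pi"
proof -
  define K where "K = (\<lambda>t. agm_int (theta t ^ 2) (theta4 t ^ 2))"
  have step: "K (2 * t) = K t" if "t > 0" for t
  proof -
    have "sqrt (theta t ^ 2 * theta4 t ^ 2) = theta t * theta4 t"
      using theta_pos[OF that] theta4_pos[OF that] by (simp add: real_sqrt_mult)
    then show ?thesis
      using agm_int_landen[of "theta t ^ 2" "theta4 t ^ 2"] theta_pos[OF that] theta4_pos[OF that]
        theta_double[OF that] theta4_double[OF that] by (simp add: K_def)
  qed
  have "K (2 ^ n * t) = K t" for n
  proof (induction n)
    case (Suc n)
    then show ?case using step[of "2 ^ n * t"] assms by (simp add: mult_ac)
  qed simp
  moreover have "(\<lambda>n. K (2 ^ n * t)) \<longlonglongrightarrow> pi"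
  proof -
    have "(K \<longlongrightarrow> pi) at_top"
    proof (rule tendsto_sandwich)
      show "((\<lambda>t. pi / max (theta t ^ 2) (theta4 t ^ 2)) \<longlongrightarrow> pi) at_top"
        "((\<lambda>t. pi / min (theta t ^ 2) (theta4 t ^ 2)) \<longlongrightarrow> pi) at_top"
        by (auto intro!: tendsto_eq_intros theta_at_top)
      show "\<forall>\<^sub>F t in at_top. pi / max (theta t ^ 2) (theta4 t ^ 2) \<le> K t"
        using eventually_gt_at_top[of 0]
      proof eventually_elim
        case (elim t)
        then show ?case
          using agm_int_bounds(1)[of "theta t ^ 2" "theta4 t ^ 2"] theta_pos[of t] theta4_pos[of t]
          by (simp add: K_def)
      qed
      show "\<forall>\<^sub>F t in at_top. K t \<le> pi / min (theta t ^ 2) (theta4 t ^ 2)"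
        using eventually_gt_at_top[of 0]
      proof eventually_elim
        case (elim t)
        then show ?case
          using agm_int_bounds(2)[of "theta t ^ 2" "theta4 t ^ 2"] theta_pos[of t] theta4_pos[of t]
          by (simp add: K_def)
      qed
    qed
    moreover have "filterlim (\<lambda>n. 2 ^ n * t) at_top sequentially" using assms by real_asymp
    ultimately show ?thesis by (rule filterlim_compose)
  qed
  ultimately have "K t = pi" by (simp add: LIMSEQ_const_iff)
  then show ?thesis by (simp add: K_def)
qed

text \<open>The counterpart for halving: with the factor t both arguments tend to 1 at 0. Removing
  that factor by homogeneity produces the extra t on the right.\<close>

lemma agm_theta2:
  assumes "t > 0" shows "agm_int (theta t ^ 2) (theta2 t ^ 2) = pi * t"
proof -
  define K where "K = (\<lambda>t. agm_int (t * theta t ^ 2) (t * theta2 t ^ 2))"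
  have step: "K (t / 2) = K t" if "t > 0" for t
  proof -
    have "sqrt ((t * theta t ^ 2) * (t * theta2 t ^ 2)) = t * (theta t * theta2 t)"
      using theta_pos[OF that] theta2_pos[OF that] that by (simp add: real_sqrt_mult)
    also have "\<dots> = (t / 2) * theta2 (t / 2) ^ 2"
      using theta2_half[OF that] by (simp add: mult_ac)
    finally have 1: "sqrt ((t * theta t ^ 2) * (t * theta2 t ^ 2)) = (t / 2) * theta2 (t / 2) ^ 2" .
    have 2: "(t * theta t ^ 2 + t * theta2 t ^ 2) / 2 = (t / 2) * theta (t / 2) ^ 2"
      unfolding theta_half[OF that, symmetric] by (simp add: algebra_simps)
    show ?thesis
      using agm_int_landen[of "t * theta t ^ 2" "t * theta2 t ^ 2"] theta_pos[OF that] theta2_pos[OF that] that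
      unfolding 1 2 by (simp add: K_def)
  qed
  have "K (t / 2 ^ n) = K t" for n
  proof (induction n)
    case (Suc n)
    then show ?case using step[of "t / 2 ^ n"] assms by (simp add: mult_ac)
  qed simp
  moreover have "(\<lambda>n. K (t / 2 ^ n)) \<longlonglongrightarrow> pi"
  proof -
    have l: "((\<lambda>t. (sqrt t * theta t) ^ 2) \<longlongrightarrow> 1) (at_right 0)"
      "((\<lambda>t. (sqrt t * theta2 t) ^ 2) \<longlongrightarrow> 1) (at_right 0)"
      using tendsto_power[OF theta_at_0, of 2] tendsto_power[OF theta2_at_0, of 2] by simp_all
    have "(K \<longlongrightarrow> pi) (at_right 0)"
    proof (rule tendsto_sandwich)
      show "((\<lambda>t. pi / max ((sqrt t * theta t) ^ 2) ((sqrt t * theta2 t) ^ 2)) \<longlongrightarrow> pi) (at_right 0)"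
        "((\<lambda>t. pi / min ((sqrt t * theta t) ^ 2) ((sqrt t * theta2 t) ^ 2)) \<longlongrightarrow> pi) (at_right 0)"
        using tendsto_divide[OF tendsto_const[of pi] tendsto_max[OF l]]
          tendsto_divide[OF tendsto_const[of pi] tendsto_min[OF l]] by simp_all
      show "\<forall>\<^sub>F t in at_right 0. pi / max ((sqrt t * theta t) ^ 2) ((sqrt t * theta2 t) ^ 2) \<le> K t"
        using eventually_at_right_less[of 0]
      proof eventually_elim
        case (elim t)
        then show ?case
          using agm_int_bounds(1)[of "t * theta t ^ 2" "t * theta2 t ^ 2"] theta_pos[of t] theta2_pos[of t]
          by (simp add: K_def power_mult_distrib)
      qed
      show "\<forall>\<^sub>F t in at_right 0. K t \<le> pi / min ((sqrt t * theta t) ^ 2) ((sqrt t * theta2 t) ^ 2)"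
        using eventually_at_right_less[of 0]
      proof eventually_elim
        case (elim t)
        then show ?case
          using agm_int_bounds(2)[of "t * theta t ^ 2" "t * theta2 t ^ 2"] theta_pos[of t] theta2_pos[of t]
          by (simp add: K_def power_mult_distrib)
      qed
    qed
    moreover have "filterlim (\<lambda>n. t / 2 ^ n) (at_right 0) sequentially" using assms by real_asymp
    ultimately show ?thesis by (rule filterlim_compose)
  qed
  ultimately have "K t = pi" by (simp add: LIMSEQ_const_iff)
  then show ?thesis
    using agm_int_scale[of "theta t ^ 2" "theta2 t ^ 2" t] theta_pos[OF assms] theta2_pos[OF assms] assms
    by (simp add: K_def field_simps)
qed

text \<open>The moduli \<open>k' = \<theta>\<^sub>4\<^sup>2/\<theta>\<^sub>3\<^sup>2\<close> and \<open>k = \<theta>\<^sub>2\<^sup>2/\<theta>\<^sub>3\<^sup>2\<close> satisfy \<open>k\<^sup>2 + k'\<^sup>2 = 1\<close>, so \<open>k'(1/t) \<ge> k(t)\<close> forces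
  \<open>k(1/t) \<le> k'(t)\<close>; monotonicity of the elliptic integral then bounds
  \<open>\<theta>(1/t)\<^sup>2/t\<close> by \<open>\<theta>(t)\<^sup>2\<close> from both sides. This replaces Poisson summation.\<close>

theorem theta_functional:
  assumes t: "t > 0" shows "theta (1 / t) = sqrt t * theta t"
proof -
  define k where "k = (\<lambda>t. theta2 t ^ 2 / theta t ^ 2)"
  define k' where "k' = (\<lambda>t. theta4 t ^ 2 / theta t ^ 2)"
  have pos: "k s > 0" "k' s > 0" if "s > 0" for s
    using theta_pos[OF that] theta2_pos[OF that] theta4_pos[OF that] by (auto simp: k_def k'_def)
  have kk: "k s ^ 2 + k' s ^ 2 = 1" if "s > 0" for s
  proof -
    have "k s ^ 2 + k' s ^ 2 = (theta2 s ^ 4 + theta4 s ^ 4) / theta s ^ 4"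
      by (simp add: k_def k'_def power_divide add_divide_distrib flip: power_mult)
    then show ?thesis using theta_jacobi[OF that, symmetric] theta_pos[OF that] by (simp add: add.commute)
  qed
  \<comment> \<open>Homogeneity normalises the first argument to 1. The integral then depends on the
    modulus alone, in a decreasing way, and its values are the squares to be compared.\<close>
  have I: "agm_int 1 (k' s) = pi * theta s ^ 2" "agm_int 1 (k s) = pi * s * theta s ^ 2" if "s > 0" for s
    using agm_int_scale[of 1 "k' s" "theta s ^ 2"] agm_int_scale[of 1 "k s" "theta s ^ 2"]
      agm_theta4[OF that] agm_theta2[OF that] pos[OF that] theta_pos[OF that]
    by (simp_all add: k_def k'_def field_simps)
  have t': "1 / t > 0" using t by simp
  have "theta (1 / t) ^ 2 = t * theta t ^ 2"
  proof (cases "k' (1 / t) \<ge> k t")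
    case True
    have "k (1 / t) \<le> k' t"
    proof (rule power2_le_imp_le)
      have "k t ^ 2 \<le> k' (1 / t) ^ 2" using True pos[OF t] by (intro power_mono) auto
      then show "(k (1 / t))\<^sup>2 \<le> (k' t)\<^sup>2" using kk[OF t] kk[OF t'] by linarith
    qed (use pos[OF t] in auto)
    then have "pi * theta t ^ 2 \<le> pi * (1 / t) * theta (1 / t) ^ 2"
      using agm_int_mono[of 1 "k (1 / t)" 1 "k' t"] I(1)[OF t] I(2)[OF t'] pos[OF t'] by simp
    moreover have "pi * theta (1 / t) ^ 2 \<le> pi * t * theta t ^ 2"
      using agm_int_mono[of 1 "k t" 1 "k' (1 / t)"] I(2)[OF t] I(1)[OF t'] pos[OF t] True by simp
    ultimately show ?thesis using t by (simp add: field_simps)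
  next
    case False
    have "k' t \<le> k (1 / t)"
    proof (rule power2_le_imp_le)
      have "k' (1 / t) ^ 2 \<le> k t ^ 2" using False pos[OF t'] by (intro power_mono) auto
      then show "(k' t)\<^sup>2 \<le> (k (1 / t))\<^sup>2" using kk[OF t] kk[OF t'] by linarith
    qed (use pos[OF t'] in auto)
    then have "pi * (1 / t) * theta (1 / t) ^ 2 \<le> pi * theta t ^ 2"
      using agm_int_mono[of 1 "k' t" 1 "k (1 / t)"] I(1)[OF t] I(2)[OF t'] pos[OF t] by simp
    moreover have "pi * t * theta t ^ 2 \<le> pi * theta (1 / t) ^ 2"
      using agm_int_mono[of 1 "k' (1 / t)" 1 "k t"] I(2)[OF t] I(1)[OF t'] pos[OF t'] False by simp
    ultimately show ?thesis using t by (simp add: field_simps)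
  qed
  then have "sqrt (theta (1 / t) ^ 2) = sqrt (t * theta t ^ 2)" by simp
  then show ?thesis using theta_pos[OF t] theta_pos[OF t'] by (simp add: real_sqrt_mult)
qed

lemma theta2_functional:
  assumes "t > 0" shows "theta2 (1 / t) = sqrt t * theta4 t"
  using theta_functional[of "4 * t"] theta_functional[OF assms] assms
  by (simp add: theta2_def theta4_def real_sqrt_mult algebra_simps)

lemma theta4_functional:
  assumes "t > 0" shows "theta4 (1 / t) = sqrt t * theta2 t"
  using theta2_functional[of "1 / t"] assms by (simp add: real_sqrt_divide field_simps)

text \<open>At the fixed point t = 1 the values of \<open>theta2\<close> and \<open>theta4\<close>
  agree, so the modulus is 1 / sqrt 2 and the elliptic integral is the lemniscatic one.\<close>

lemma theta_1_power4: "theta 1 ^ 4 = pi / Gamma (3/4) ^ 4"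
proof -
  have "theta2 1 = theta4 1" using theta2_functional[of 1] by simp
  then have "theta 1 ^ 4 = 2 * theta4 1 ^ 4" using theta_jacobi[of 1] by simp
  then have "(theta 1 ^ 2) ^ 2 = (sqrt 2 * theta4 1 ^ 2) ^ 2"
    by (simp add: power_mult_distrib flip: power_mult)
  then have "theta 1 ^ 2 = sqrt 2 * theta4 1 ^ 2"
    by (rule power2_eq_imp_eq) auto
  then have "theta4 1 ^ 2 = theta 1 ^ 2 * (1 / sqrt 2)" by simp
  then have "pi = agm_int (theta 1 ^ 2 * 1) (theta 1 ^ 2 * (1 / sqrt 2))"
    using agm_theta4[of 1] by simp
  also have "\<dots> = agm_int 1 (1 / sqrt 2) / theta 1 ^ 2"
    using theta_pos[of 1] by (intro agm_int_scale) auto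
  finally have 1: "pi = pi * sqrt pi / Gamma (3/4) ^ 2 / theta 1 ^ 2"
    unfolding agm_int_lemniscate .
  define g where "g = Gamma (3/4 :: real)"
  have "g > 0" unfolding g_def by (rule Gamma_real_pos) simp
  then have "theta 1 ^ 2 = sqrt pi / g ^ 2"
    using 1 [folded g_def] theta_pos[of 1] by (simp add: field_simps)
  then have "theta 1 ^ 2 = sqrt pi / Gamma (3/4) ^ 2" by (simp only: g_def)
  then have "(theta 1 ^ 2) ^ 2 = (sqrt pi / Gamma (3/4) ^ 2) ^ 2" by simp
  then show ?thesis by (simp add: power_divide flip: power_mult)
qed

section \<open>Differential equations\<close>

definition dtheta :: "real \<Rightarrow> real" where
  "dtheta t = - pi * exp (- pi * t) * thq' (exp (- pi * t))"
definition dtheta4 :: "real \<Rightarrow> real" where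
  "dtheta4 t = pi * exp (- pi * t) * thq' (- exp (- pi * t))"
definition ddtheta :: "real \<Rightarrow> real" where
  "ddtheta t = pi\<^sup>2 * exp (- pi * t) * (thq' (exp (- pi * t)) + exp (- pi * t) * thq'' (exp (- pi * t)))"

lemma theta_deriv:
  assumes t: "t > 0"
  shows "(theta has_real_derivative dtheta t) (at t)"
    "(theta4 has_real_derivative dtheta4 t) (at t)"
    "(dtheta has_real_derivative ddtheta t) (at t)"
proof -
  have q: "\<bar>exp (- pi * t)\<bar> < 1" "\<bar>- exp (- pi * t)\<bar> < 1" using t by auto
  have e: "((\<lambda>t. exp (- pi * t)) has_real_derivative - pi * exp (- pi * t)) (at t)"
    by (auto intro!: derivative_eq_intros)
  have "((\<lambda>t. thq (exp (- pi * t))) has_real_derivative thq' (exp (- pi * t)) * (- pi * exp (- pi * t))) (at t)"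
    by (rule DERIV_chain2[OF thq_deriv(1)[OF q(1)] e])
  then have "((\<lambda>t. thq (exp (- pi * t))) has_real_derivative dtheta t) (at t)"
    by (simp add: dtheta_def mult_ac)
  then show "(theta has_real_derivative dtheta t) (at t)"
    by (rule has_field_derivative_transform_within_open[where S = "{0<..}"])
       (use t in \<open>auto simp: theta_eq_thq\<close>)
  have "((\<lambda>t. thq (- exp (- pi * t))) has_real_derivative thq' (- exp (- pi * t)) * (- (- pi * exp (- pi * t)))) (at t)"
    by (rule DERIV_chain2[OF thq_deriv(1)[OF q(2)] DERIV_minus[OF e]])
  then have "((\<lambda>t. thq (- exp (- pi * t))) has_real_derivative dtheta4 t) (at t)"
    by (simp add: dtheta4_def mult_ac)
  then show "(theta4 has_real_derivative dtheta4 t) (at t)"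
    by (rule has_field_derivative_transform_within_open[where S = "{0<..}"])
       (use t in \<open>auto simp: theta4_eq_thq\<close>)
  have "((\<lambda>t. thq' (exp (- pi * t))) has_real_derivative thq'' (exp (- pi * t)) * (- pi * exp (- pi * t))) (at t)"
    by (rule DERIV_chain2[OF thq_deriv(2)[OF q(1)] e])
  then show "(dtheta has_real_derivative ddtheta t) (at t)"
    unfolding dtheta_def [abs_def] ddtheta_def
    by (auto intro!: derivative_eq_intros simp: power2_eq_square algebra_simps)
qed

section \<open>Logarithmic derivatives of the squares and invariance under doubling\<close>

definition ldtheta :: "real \<Rightarrow> real" where "ldtheta t = 2 * dtheta t / theta t"
definition ldtheta4 :: "real \<Rightarrow> real" where "ldtheta4 t = 2 * dtheta4 t / theta4 t"

lemma theta_square_deriv: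
  assumes "t > 0"
  shows "((\<lambda>t. theta t ^ 2) has_real_derivative theta t ^ 2 * ldtheta t) (at t)"
    "((\<lambda>t. theta4 t ^ 2) has_real_derivative theta4 t ^ 2 * ldtheta4 t) (at t)"
  using assms theta_pos[OF assms] theta4_pos[OF assms] unfolding ldtheta_def ldtheta4_def
  by (auto intro!: derivative_eq_intros theta_deriv simp: power2_eq_square)

lemma dtheta_at_top:
  "((\<lambda>t. t\<^sup>2 * dtheta t) \<longlongrightarrow> 0) at_top" "((\<lambda>t. t\<^sup>2 * dtheta4 t) \<longlongrightarrow> 0) at_top"
  "((\<lambda>t. t\<^sup>2 * ddtheta t) \<longlongrightarrow> 0) at_top" "(dtheta \<longlongrightarrow> 0) at_top"
proof -
  have e: "((\<lambda>t. exp (- pi * t)) \<longlongrightarrow> 0) at_top" by (rule tendsto_exp_neg_pi)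
  have e': "((\<lambda>t. - exp (- pi * t)) \<longlongrightarrow> 0) at_top" using tendsto_minus[OF e] by simp
  have te: "((\<lambda>t. t\<^sup>2 * exp (- pi * t)) \<longlongrightarrow> 0) at_top" by real_asymp
  have 1: "((\<lambda>t. thq' (exp (- pi * t))) \<longlongrightarrow> thq' 0) at_top"
    "((\<lambda>t. thq' (- exp (- pi * t))) \<longlongrightarrow> thq' 0) at_top"
    "((\<lambda>t. thq'' (exp (- pi * t))) \<longlongrightarrow> thq'' 0) at_top"
    using e e' by (auto intro!: isCont_tendsto_compose[OF thq_cont(2)] isCont_tendsto_compose[OF thq_cont(3)])
  have "((\<lambda>t. - pi * (t\<^sup>2 * exp (- pi * t)) * thq' (exp (- pi * t))) \<longlongrightarrow> - pi * 0 * thq' 0) at_top"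
    by (intro tendsto_intros te 1)
  then show "((\<lambda>t. t\<^sup>2 * dtheta t) \<longlongrightarrow> 0) at_top" by (simp add: dtheta_def mult_ac)
  have "((\<lambda>t. pi * (t\<^sup>2 * exp (- pi * t)) * thq' (- exp (- pi * t))) \<longlongrightarrow> pi * 0 * thq' 0) at_top"
    by (intro tendsto_intros te 1)
  then show "((\<lambda>t. t\<^sup>2 * dtheta4 t) \<longlongrightarrow> 0) at_top" by (simp add: dtheta4_def mult_ac)
  have "((\<lambda>t. pi\<^sup>2 * (t\<^sup>2 * exp (- pi * t)) * (thq' (exp (- pi * t)) + exp (- pi * t) * thq'' (exp (- pi * t))))
      \<longlongrightarrow> pi\<^sup>2 * 0 * (thq' 0 + 0 * thq'' 0)) at_top"
    by (intro tendsto_intros te 1 e)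
  then show "((\<lambda>t. t\<^sup>2 * ddtheta t) \<longlongrightarrow> 0) at_top" by (simp add: ddtheta_def mult_ac)
  have "((\<lambda>t. - pi * exp (- pi * t) * thq' (exp (- pi * t))) \<longlongrightarrow> - pi * 0 * thq' 0) at_top"
    by (intro tendsto_intros e 1)
  then show "(dtheta \<longlongrightarrow> 0) at_top" by (simp add: dtheta_def [abs_def])
qed

lemma ldtheta_at_top:
  "((\<lambda>t. t\<^sup>2 * ldtheta t) \<longlongrightarrow> 0) at_top" "((\<lambda>t. t\<^sup>2 * ldtheta4 t) \<longlongrightarrow> 0) at_top"
proof -
  have "((\<lambda>t. 2 * (t\<^sup>2 * dtheta t) / theta t) \<longlongrightarrow> 2 * 0 / 1) at_top"
    by (intro tendsto_intros dtheta_at_top theta_at_top) auto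
  then show "((\<lambda>t. t\<^sup>2 * ldtheta t) \<longlongrightarrow> 0) at_top" by (simp add: ldtheta_def mult_ac)
  have "((\<lambda>t. 2 * (t\<^sup>2 * dtheta4 t) / theta4 t) \<longlongrightarrow> 2 * 0 / 1) at_top"
    by (intro tendsto_intros dtheta_at_top theta_at_top) auto
  then show "((\<lambda>t. t\<^sup>2 * ldtheta4 t) \<longlongrightarrow> 0) at_top" by (simp add: ldtheta4_def mult_ac)
qed

lemma doubling_invariant_eq:
  fixes f :: "real \<Rightarrow> real"
  assumes step: "\<And>t. t > 0 \<Longrightarrow> f (2 * t) = f t" and lim: "(f \<longlongrightarrow> c) at_top" and t: "t > 0"
  shows "f t = c"
proof -
  have "f (2 ^ n * t) = f t" for n
  proof (induction n)
    case (Suc n)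
    then show ?case using step[of "2 ^ n * t"] t by (simp add: mult_ac)
  qed simp
  moreover have "filterlim (\<lambda>n. 2 ^ n * t) at_top sequentially" using t by real_asymp
  then have "(\<lambda>n. f (2 ^ n * t)) \<longlonglongrightarrow> c" by (rule filterlim_compose[OF lim])
  ultimately show ?thesis by (simp add: LIMSEQ_const_iff)
qed

lemma ldtheta_double:
  assumes t: "t > 0"
  shows "theta t ^ 2 * ldtheta t + theta4 t ^ 2 * ldtheta4 t = 4 * theta (2 * t) ^ 2 * ldtheta (2 * t)"
    "ldtheta t + ldtheta4 t = 4 * ldtheta4 (2 * t)"
proof -
  have c: "((\<lambda>t. f (2 * t)) has_real_derivative d * 2) (at t)"
    if "(f has_real_derivative d) (at (2 * t))" for f d
    using DERIV_chain2[where f = f and g = "\<lambda>t. 2 * t" and s = UNIV, OF that, of 2]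
    by (auto intro!: derivative_eq_intros)
  have t2: "2 * t > 0" using t by simp
  have "((\<lambda>t. theta t ^ 2 + theta4 t ^ 2) has_real_derivative
      theta t ^ 2 * ldtheta t + theta4 t ^ 2 * ldtheta4 t) (at t)"
    by (intro DERIV_add theta_square_deriv t)
  then have "((\<lambda>t. 2 * theta (2 * t) ^ 2) has_real_derivative
      theta t ^ 2 * ldtheta t + theta4 t ^ 2 * ldtheta4 t) (at t)"
    by (rule has_field_derivative_transform_within_open[where S = "{0<..}"])
       (use t in \<open>auto simp: theta_double\<close>)
  moreover have "((\<lambda>t. 2 * theta (2 * t) ^ 2) has_real_derivative
      2 * (theta (2 * t) ^ 2 * ldtheta (2 * t) * 2)) (at t)"
    by (intro DERIV_cmult c[of "\<lambda>t. theta t ^ 2"] theta_square_deriv t2)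
  ultimately show "theta t ^ 2 * ldtheta t + theta4 t ^ 2 * ldtheta4 t
      = 4 * theta (2 * t) ^ 2 * ldtheta (2 * t)"
    using DERIV_unique by fastforce
  have "((\<lambda>t. theta t * theta4 t) has_real_derivative dtheta t * theta4 t + dtheta4 t * theta t) (at t)"
    by (intro DERIV_mult theta_deriv t)
  then have "((\<lambda>t. theta4 (2 * t) ^ 2) has_real_derivative dtheta t * theta4 t + dtheta4 t * theta t) (at t)"
    by (rule has_field_derivative_transform_within_open[where S = "{0<..}"])
       (use t in \<open>auto simp: theta4_double\<close>)
  moreover have "((\<lambda>t. theta4 (2 * t) ^ 2) has_real_derivative theta4 (2 * t) ^ 2 * ldtheta4 (2 * t) * 2) (at t)"
    by (intro c[of "\<lambda>t. theta4 t ^ 2"] theta_square_deriv t2)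
  ultimately have "dtheta t * theta4 t + dtheta4 t * theta t = theta4 (2 * t) ^ 2 * ldtheta4 (2 * t) * 2"
    using DERIV_unique by blast
  then have "dtheta t * theta4 t + dtheta4 t * theta t = theta t * theta4 t * ldtheta4 (2 * t) * 2"
    unfolding theta4_double[OF t] .
  then show "ldtheta t + ldtheta4 t = 4 * ldtheta4 (2 * t)"
    unfolding ldtheta_def ldtheta4_def[of t] using theta_pos[OF t] theta4_pos[OF t]
    by (simp add: field_simps)
qed

lemma theta_diff_pos: "t > 0 \<Longrightarrow> theta t ^ 4 - theta4 t ^ 4 > 0"
  using theta_jacobi[of t] theta2_pos[of t] by simp

text \<open>Under doubling, the numerator and the denominator of \<open>F\<close> both acquire the
  factor (a - b) / (4 (a + b)), where a and b are the squares of \<open>theta\<close> and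
  \<open>theta4\<close> at t. So \<open>F\<close> is invariant and equals its limit at
  infinity.\<close>

lemma ldtheta_diff:
  assumes t: "t > 0"
  shows "ldtheta4 t = ldtheta t + pi / 2 * (theta t ^ 4 - theta4 t ^ 4)"
proof -
  define F where "F = (\<lambda>t. (ldtheta t - ldtheta4 t) / (theta t ^ 4 - theta4 t ^ 4))"
  have "F t = - pi / 2"
  proof (rule doubling_invariant_eq[OF _ _ t])
    fix t :: real assume t: "t > 0"
    define a b H K where "a = theta t ^ 2" and "b = theta4 t ^ 2" and "H = ldtheta t" and "K = ldtheta4 t"
    have 4: "theta t ^ 4 = a\<^sup>2" "theta4 t ^ 4 = b\<^sup>2" by (simp_all add: a_def b_def flip: power_mult)
    have a: "a > 0" "b > 0" using theta_pos[OF t] theta4_pos[OF t] by (simp_all add: a_def b_def)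
    have "(a - b) * (a + b) > 0" using theta_diff_pos[OF t] unfolding 4 by (simp add: power2_eq_square algebra_simps)
    then have ab: "a - b > 0" using a by (simp add: zero_less_mult_iff)
    have a1: "theta (2 * t) ^ 2 = (a + b) / 2" using theta_double[OF t] by (simp add: a_def b_def)
    have "theta (2 * t) ^ 4 = (theta (2 * t) ^ 2)\<^sup>2" "theta4 (2 * t) ^ 4 = (theta4 (2 * t) ^ 2)\<^sup>2"
      by (simp_all flip: power_mult)
    then have "theta (2 * t) ^ 4 = ((a + b) / 2)\<^sup>2" "theta4 (2 * t) ^ 4 = a * b"
      unfolding a1 theta4_double[OF t] by (simp_all add: a_def b_def power_mult_distrib)
    then have d: "theta (2 * t) ^ 4 - theta4 (2 * t) ^ 4 = (a - b)\<^sup>2 / 4"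
      by (simp add: power2_eq_square field_simps)
    have H1: "ldtheta (2 * t) = (a * H + b * K) / (2 * (a + b))"
    proof -
      have "a * H + b * K = 4 * ((a + b) / 2) * ldtheta (2 * t)"
        using ldtheta_double(1)[OF t] unfolding a1 by (simp only: a_def b_def H_def K_def)
      then have "ldtheta (2 * t) * (2 * (a + b)) = a * H + b * K" by (simp add: algebra_simps)
      moreover have "2 * (a + b) \<noteq> 0" using a by simp
      ultimately show ?thesis by (metis nonzero_eq_divide_eq)
    qed
    have K1: "ldtheta4 (2 * t) = (H + K) / 4"
      using ldtheta_double(2)[OF t] by (simp add: H_def K_def)
    have "(a * H + b * K) / (2 * (a + b)) - (H + K) / 4 = (a - b) * (H - K) / (4 * (a + b))"
      using a by (simp add: field_simps)
    then have "F (2 * t) = (a - b) * (H - K) / (4 * (a + b)) / ((a - b)\<^sup>2 / 4)"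
      by (simp add: F_def H1 K1 d)
    also have "\<dots> = (H - K) / ((a - b) * (a + b))"
      using a ab by (simp add: divide_simps) (simp add: power2_eq_square)
    also have "(a - b) * (a + b) = a\<^sup>2 - b\<^sup>2" by (simp add: power2_eq_square algebra_simps)
    also have "(H - K) / (a\<^sup>2 - b\<^sup>2) = F t" by (simp add: F_def 4 H_def K_def)
    finally show "F (2 * t) = F t" .
  next
    \<comment> \<open>Numerator and denominator of \<open>F\<close> both vanish at infinity. In the
      nome they are \<open>q * N q\<close> and \<open>M q\<close>, with \<open>N\<close> tending to
      - 8 \<pi> and \<open>M q / q\<close> to the derivative 16 of \<open>M\<close> at 0; the
      quotient is - \<pi> / 2.\<close>
    define N where "N = (\<lambda>q. - 2 * pi * (thq' q / thq q + thq' (- q) / thq (- q)))"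
    define M where "M = (\<lambda>q. thq q ^ 4 - thq (- q) ^ 4)"
    have m0: "((\<lambda>q. thq (- q)) \<longlongrightarrow> thq 0) (at 0)" "((\<lambda>q. thq' (- q)) \<longlongrightarrow> thq' 0) (at 0)"
      using isCont_tendsto_compose[OF thq_cont(1)[of 0], of uminus "at 0"]
        isCont_tendsto_compose[OF thq_cont(2)[of 0], of uminus "at 0"] tendsto_minus[OF tendsto_ident_at[of 0 UNIV]]
      by auto
    have N: "(N \<longlongrightarrow> - 2 * pi * (thq' 0 / thq 0 + thq' 0 / thq 0)) (at 0)"
      unfolding N_def using thq_cont(1,2)[of 0, unfolded isCont_def] m0
      by (intro tendsto_intros) (auto simp: thq_0)
    have "((\<lambda>q. thq (- q)) has_real_derivative thq' (- 0) * (- 1)) (at 0)"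
      by (rule DERIV_chain2[of thq _ uminus]) (auto intro!: thq_deriv derivative_eq_intros)
    then have "(M has_real_derivative 16) (at 0)"
      unfolding M_def by (auto intro!: derivative_eq_intros thq_deriv simp: thq_0)
    then have M: "((\<lambda>q. M q / q) \<longlongrightarrow> 16) (at 0)"
      unfolding DERIV_def M_def by simp
    have "((\<lambda>q. N q / (M q / q)) \<longlongrightarrow> - 2 * pi * (thq' 0 / thq 0 + thq' 0 / thq 0) / 16) (at 0)"
      by (intro tendsto_divide N M) auto
    then have l: "((\<lambda>q. N q / (M q / q)) \<longlongrightarrow> - pi / 2) (at 0)" by (simp add: thq_0)
    have "filterlim (\<lambda>t. exp (- pi * t)) (at 0) at_top"
      using tendsto_exp_neg_pi by (simp add: filterlim_at)
    then have "((\<lambda>t. N (exp (- pi * t)) / (M (exp (- pi * t)) / exp (- pi * t))) \<longlongrightarrow> - pi / 2) at_top"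
      by (rule filterlim_compose[OF l])
    moreover have "\<forall>\<^sub>F t in at_top. N (exp (- pi * t)) / (M (exp (- pi * t)) / exp (- pi * t)) = F t"
      using eventually_gt_at_top[of 0]
    proof eventually_elim
      case (elim t)
      have "exp (- pi * t) * N (exp (- pi * t)) = ldtheta t - ldtheta4 t"
        using elim theta_eq_thq[of t] theta4_eq_thq[of t]
        by (simp add: N_def ldtheta_def ldtheta4_def dtheta_def dtheta4_def algebra_simps add_divide_distrib)
      moreover have "M (exp (- pi * t)) = theta t ^ 4 - theta4 t ^ 4"
        using elim theta_eq_thq[of t] theta4_eq_thq[of t] by (simp add: M_def)
      ultimately show ?case by (simp add: F_def mult.commute)
    qed
    ultimately show "(F \<longlongrightarrow> - pi / 2) at_top" by (rule Lim_transform_eventually)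
  qed
  then show ?thesis using theta_diff_pos[OF t] by (simp add: F_def field_simps)
qed

lemma ldtheta_deriv_raw:
  assumes t: "t > 0"
  shows "(ldtheta has_real_derivative 2 * ddtheta t / theta t - ldtheta t ^ 2 / 2) (at t)"
  unfolding ldtheta_def [abs_def] using theta_pos[OF t] t
  by (auto intro!: derivative_eq_intros theta_deriv simp: divide_simps power2_eq_square)

text \<open>A Riccati equation. Its defect \<delta> satisfies 4 \<delta>(2t) = \<delta>(t), hence
  \<open>t ^ 2\<close> times the defect is invariant under doubling and equals its limit 0.\<close>

lemma ldtheta_deriv:
  assumes t: "t > 0"
  shows "(ldtheta has_real_derivative
    ldtheta t ^ 2 + pi\<^sup>2 / 4 * (theta t ^ 4 - theta4 t ^ 4) * theta4 t ^ 4) (at t)"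
proof -
  define \<delta> where "\<delta> = (\<lambda>t. 2 * ddtheta t / theta t - ldtheta t ^ 2 / 2 - ldtheta t ^ 2
    - pi\<^sup>2 / 4 * (theta t ^ 4 - theta4 t ^ 4) * theta4 t ^ 4)"
  have "t\<^sup>2 * \<delta> t = 0"
  proof (rule doubling_invariant_eq[OF _ _ t])
    fix t :: real assume t: "t > 0"
    \<comment> \<open>Eliminating \<open>ldtheta4\<close> by \<open>ldtheta_diff\<close> leaves a
      doubling rule for \<open>ldtheta\<close> alone; differentiating it gives the rule for the
      derivative.\<close>
    have rel: "2 * ldtheta (2 * t) = ldtheta t + pi / 2 * (theta4 t ^ 2 * (theta t ^ 2 - theta4 t ^ 2))"
      if t: "t > 0" for t
    proof -
      define a b H where "a = theta t ^ 2" and "b = theta4 t ^ 2" and "H = ldtheta t"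
      have 4: "theta t ^ 4 = a\<^sup>2" "theta4 t ^ 4 = b\<^sup>2" by (simp_all add: a_def b_def flip: power_mult)
      have a: "a > 0" "b > 0" using theta_pos[OF t] theta4_pos[OF t] by (simp_all add: a_def b_def)
      have a1: "theta (2 * t) ^ 2 = (a + b) / 2" using theta_double[OF t] by (simp add: a_def b_def)
      define c where "c = pi / 2"
      have "a * H + b * (H + pi / 2 * (a\<^sup>2 - b\<^sup>2)) = 4 * ((a + b) / 2) * ldtheta (2 * t)"
        using ldtheta_double(1)[OF t] unfolding a1 ldtheta_diff[OF t] 4 by (simp only: a_def b_def H_def)
      moreover have "4 * ((a + b) / 2) = 2 * (a + b)" by simp
      ultimately have "a * H + b * (H + c * (a\<^sup>2 - b\<^sup>2)) = 2 * (a + b) * ldtheta (2 * t)"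
        by (simp only: c_def)
      then have "(a + b) * (2 * ldtheta (2 * t)) = (a + b) * (H + c * (b * (a - b)))"
        by algebra
      then have "(a + b) * (2 * ldtheta (2 * t)) = (a + b) * (H + pi / 2 * (b * (a - b)))"
        by (simp only: c_def)
      then show ?thesis using a by (simp add: a_def b_def H_def)
    qed
    define a b H K where "a = theta t ^ 2" and "b = theta4 t ^ 2" and "H = ldtheta t" and "K = ldtheta4 t"
    define H' where "H' = 2 * ddtheta t / theta t - ldtheta t ^ 2 / 2"
    define H1' where "H1' = 2 * ddtheta (2 * t) / theta (2 * t) - ldtheta (2 * t) ^ 2 / 2"
    have 4: "theta t ^ 4 = a\<^sup>2" "theta4 t ^ 4 = b\<^sup>2" by (simp_all add: a_def b_def flip: power_mult)
    have a1: "theta (2 * t) ^ 2 = (a + b) / 2" using theta_double[OF t] by (simp add: a_def b_def)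
    have "theta (2 * t) ^ 4 = (theta (2 * t) ^ 2)\<^sup>2" "theta4 (2 * t) ^ 4 = (theta4 (2 * t) ^ 2)\<^sup>2"
      by (simp_all flip: power_mult)
    then have 42: "theta (2 * t) ^ 4 = ((a + b) / 2)\<^sup>2" "theta4 (2 * t) ^ 4 = a * b"
      unfolding a1 theta4_double[OF t] by (simp_all add: a_def b_def power_mult_distrib)
    have K: "K = H + pi / 2 * (a\<^sup>2 - b\<^sup>2)"
      using ldtheta_diff[OF t] unfolding 4 by (simp add: K_def H_def)
    have H1: "2 * ldtheta (2 * t) = H + pi / 2 * (b * (a - b))"
      using rel[OF t] by (simp add: a_def b_def H_def)
    have d1: "((\<lambda>t. ldtheta t + pi / 2 * (theta4 t ^ 2 * (theta t ^ 2 - theta4 t ^ 2))) has_real_derivative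
        (H' + pi / 2 * (b * K * (a - b) + (a * H - b * K) * b))) (at t)"
      unfolding H'_def a_def b_def H_def K_def
      by (intro DERIV_add DERIV_cmult DERIV_mult DERIV_diff theta_square_deriv ldtheta_deriv_raw t)
    have "((\<lambda>t. 2 * ldtheta (2 * t)) has_real_derivative 2 * (H1' * 2)) (at t)"
      unfolding H1'_def
      by (intro DERIV_cmult DERIV_chain2[OF ldtheta_deriv_raw]) (use t in \<open>auto intro!: derivative_eq_intros\<close>)
    then have "((\<lambda>t. ldtheta t + pi / 2 * (theta4 t ^ 2 * (theta t ^ 2 - theta4 t ^ 2))) has_real_derivative 2 * (H1' * 2)) (at t)"
      by (rule has_field_derivative_transform_within_open[where S = "{0<..}"])
         (use t rel in auto)
    from DERIV_unique[OF this d1]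
    have H1': "4 * H1' = H' + pi / 2 * (b * K * (a - b) + (a * H - b * K) * b)" by simp
    have "4 * \<delta> (2 * t) = 4 * H1' - (2 * ldtheta (2 * t))\<^sup>2 - pi\<^sup>2 * (((a + b) / 2)\<^sup>2 - a * b) * (a * b)"
      unfolding \<delta>_def 42 H1'_def by (simp add: power_mult_distrib algebra_simps)
    also have "\<dots> = \<delta> t"
    proof -
      have "\<delta> t = H' - H\<^sup>2 - pi\<^sup>2 / 4 * (a\<^sup>2 - b\<^sup>2) * b\<^sup>2"
        by (simp only: \<delta>_def H'_def H_def 4)
      then show ?thesis
        unfolding H1' H1 K by (simp add: power2_eq_square field_simps)
    qed
    finally show "(2 * t)\<^sup>2 * \<delta> (2 * t) = t\<^sup>2 * \<delta> t" by (simp add: power_mult_distrib)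
  next
    \<comment> \<open>The defect rewritten so that every factor has a known limit:
      \<open>ldtheta_diff\<close> replaces the difference of fourth powers by a difference of
      logarithmic derivatives, which decays even after multiplication by
      \<open>t ^ 2\<close>.\<close>
    define E where "E = (\<lambda>t. 2 * (t\<^sup>2 * ddtheta t) / theta t - 3 / 2 * (t\<^sup>2 * ldtheta t) * (2 * dtheta t / theta t)
      - pi / 2 * (t\<^sup>2 * ldtheta4 t - t\<^sup>2 * ldtheta t) * theta4 t ^ 4)"
    have "(E \<longlongrightarrow> 2 * 0 / 1 - 3 / 2 * 0 * (2 * 0 / 1) - pi / 2 * (0 - 0) * 1 ^ 4) at_top"
      unfolding E_def by (intro tendsto_intros dtheta_at_top ldtheta_at_top theta_at_top) auto
    then have "(E \<longlongrightarrow> 0) at_top" by simp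
    moreover have "\<forall>\<^sub>F t in at_top. E t = t\<^sup>2 * \<delta> t"
      using eventually_gt_at_top[of 0]
    proof eventually_elim
      case (elim t)
      define H where "H = ldtheta t"
      have "2 * dtheta t / theta t = H" by (simp add: H_def ldtheta_def)
      then show ?case
        unfolding E_def \<delta>_def ldtheta_diff[OF elim] by (simp add: H_def power2_eq_square algebra_simps)
    qed
    ultimately show "((\<lambda>t. t\<^sup>2 * \<delta> t) \<longlongrightarrow> 0) at_top" by (rule Lim_transform_eventually)
  qed
  then have "2 * ddtheta t / theta t - ldtheta t ^ 2 / 2
      = ldtheta t ^ 2 + pi\<^sup>2 / 4 * (theta t ^ 4 - theta4 t ^ 4) * theta4 t ^ 4"
    using t by (simp add: \<delta>_def)
  with ldtheta_deriv_raw[OF t] show ?thesis by simp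
qed

section \<open>The logarithm of the theta function\<close>

text \<open>With \<open>t = e\<^sup>2\<^sup>z\<close>, \<open>B = \<pi>t\<theta>\<^sub>2(t)\<^sup>4\<close> and \<open>C = \<pi>t\<theta>\<^sub>4(t)\<^sup>4\<close>, the functions \<open>p\<close>, \<open>q\<close>, \<open>r\<close> of the system are
  \<open>lth'\<close>, \<open>BC/2\<close> and \<open>(C - B)/8\<close>; below \<open>\<theta>\<^sub>2\<^sup>4\<close> is written as \<open>\<theta>\<^sub>3\<^sup>4 - \<theta>\<^sub>4\<^sup>4\<close>.\<close>

definition lth :: "real \<Rightarrow> real" where "lth z = z / 2 + ln (theta (exp (2 * z)))"
definition lthP :: "real \<Rightarrow> real" where
  "lthP z = 1 / 2 + exp (2 * z) * ldtheta (exp (2 * z))"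
definition lthQ :: "real \<Rightarrow> real" where
  "lthQ z = pi\<^sup>2 / 2 * exp (2 * z) ^ 2 * (theta (exp (2 * z)) ^ 4 - theta4 (exp (2 * z)) ^ 4) * theta4 (exp (2 * z)) ^ 4"
definition lthR :: "real \<Rightarrow> real" where
  "lthR z = pi / 8 * exp (2 * z) * (2 * theta4 (exp (2 * z)) ^ 4 - theta (exp (2 * z)) ^ 4)"

text \<open>Here d/dz is 2t d/dt. The equation for p is the Riccati equation; those for q and r only
  need the logarithmic derivatives of the squares of \<open>theta\<close> and \<open>theta4\<close>,
  whose difference is known.\<close>

lemma lth_derivs:
  "(lth has_real_derivative lthP z) (at z)"
  "(lthP has_real_derivative 2 * lthP z ^ 2 + lthQ z - 1 / 2) (at z)"
  "(lthQ has_real_derivative (8 * lthP z - 16 * lthR z) * lthQ z) (at z)"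
  "(lthR has_real_derivative lthQ z + 4 * lthP z * lthR z) (at z)"
proof -
  define t where "t = exp (2 * z)"
  have t: "t > 0" by (simp add: t_def)
  define a b H K where "a = theta t ^ 2" and "b = theta4 t ^ 2" and "H = ldtheta t" and "K = ldtheta4 t"
  have 4: "theta s ^ 4 = (theta s ^ 2)\<^sup>2" "theta4 s ^ 4 = (theta4 s ^ 2)\<^sup>2" for s
    by (simp_all flip: power_mult)
  have K: "K = H + pi / 2 * (a\<^sup>2 - b\<^sup>2)"
    using ldtheta_diff[OF t] unfolding 4 by (simp add: K_def H_def a_def b_def)
  have e: "((\<lambda>z. exp (2 * z)) has_real_derivative 2 * t) (at z)"
    by (auto intro!: derivative_eq_intros simp: t_def)
  have c: "((\<lambda>z. f (exp (2 * z))) has_real_derivative d * (2 * t)) (at z)"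
    if "(f has_real_derivative d) (at t)" for f d
    by (rule DERIV_chain2[where f = f and g = "\<lambda>z. exp (2 * z)"]) (use that e in \<open>auto simp: t_def\<close>)
  have A: "((\<lambda>z. theta (exp (2 * z)) ^ 2) has_real_derivative a * H * (2 * t)) (at z)"
    and B: "((\<lambda>z. theta4 (exp (2 * z)) ^ 2) has_real_derivative b * K * (2 * t)) (at z)"
    using c[OF theta_square_deriv(1)[OF t]] c[OF theta_square_deriv(2)[OF t]]
    by (simp_all add: a_def b_def H_def K_def)
  have H: "((\<lambda>z. ldtheta (exp (2 * z))) has_real_derivative (H\<^sup>2 + pi\<^sup>2 / 4 * (a\<^sup>2 - b\<^sup>2) * b\<^sup>2) * (2 * t)) (at z)"
    using c[OF ldtheta_deriv[OF t]] unfolding 4 by (simp add: a_def b_def H_def)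
  have P: "lthP z = 1 / 2 + t * H" and Q: "lthQ z = pi\<^sup>2 / 2 * t\<^sup>2 * (a\<^sup>2 - b\<^sup>2) * b\<^sup>2"
    and R: "lthR z = pi / 8 * t * (2 * b\<^sup>2 - a\<^sup>2)"
    unfolding lthP_def lthQ_def lthR_def 4 by (simp_all add: t_def a_def b_def H_def)
  have dth: "dtheta t / theta t = H / 2" by (simp add: H_def ldtheta_def)
  have "(lth has_real_derivative 1 / 2 + dtheta t * (2 * t) / theta t) (at z)"
    unfolding lth_def [abs_def] using theta_pos[OF t] t
    by (auto intro!: derivative_eq_intros c[OF theta_deriv(1)[OF t]] simp: t_def)
  moreover have "1 / 2 + dtheta t * (2 * t) / theta t = lthP z"
  proof -
    have "dtheta t * (2 * t) / theta t = dtheta t / theta t * (2 * t)" by simp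
    then show ?thesis unfolding P dth by simp
  qed
  ultimately show "(lth has_real_derivative lthP z) (at z)" by simp
  have "(lthP has_real_derivative 0 + (2 * t * H
      + (H\<^sup>2 + pi\<^sup>2 / 4 * (a\<^sup>2 - b\<^sup>2) * b\<^sup>2) * (2 * t) * t)) (at z)"
    using DERIV_add[OF DERIV_const[of "1/2"] DERIV_mult[OF e H]] unfolding lthP_def [abs_def]
    by (simp add: t_def H_def)
  then show "(lthP has_real_derivative 2 * lthP z ^ 2 + lthQ z - 1 / 2) (at z)"
    unfolding P Q by (rule DERIV_cong) (simp add: power2_eq_square field_simps)
  define fa fb fe where "fa = (\<lambda>z. theta (exp (2 * z)) ^ 2)" and "fb = (\<lambda>z. theta4 (exp (2 * z)) ^ 2)"
    and "fe = (\<lambda>z::real. exp (2 * z))"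
  have z: "fa z = a" "fb z = b" "fe z = t" by (simp_all add: fa_def fb_def fe_def a_def b_def t_def)
  note d = A [folded fa_def] B [folded fb_def] e [folded fe_def]
  have "((\<lambda>z. pi\<^sup>2 / 2 * fe z ^ 2 * ((fa z)\<^sup>2 - (fb z)\<^sup>2) * (fb z)\<^sup>2)
      has_real_derivative (8 * lthP z - 16 * lthR z) * lthQ z) (at z)"
    unfolding P Q R
    by (auto intro!: derivative_eq_intros d simp: z K) (simp add: power2_eq_square field_simps)
  moreover have "(\<lambda>z. pi\<^sup>2 / 2 * fe z ^ 2 * ((fa z)\<^sup>2 - (fb z)\<^sup>2) * (fb z)\<^sup>2) = lthQ"
    unfolding lthQ_def [abs_def] 4 fa_def fb_def fe_def ..
  ultimately show "(lthQ has_real_derivative (8 * lthP z - 16 * lthR z) * lthQ z) (at z)" by simp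
  have "((\<lambda>z. pi / 8 * fe z * (2 * (fb z)\<^sup>2 - (fa z)\<^sup>2))
      has_real_derivative lthQ z + 4 * lthP z * lthR z) (at z)"
    unfolding P Q R
    by (auto intro!: derivative_eq_intros d simp: z K) (simp add: power2_eq_square field_simps)
  moreover have "(\<lambda>z. pi / 8 * fe z * (2 * (fb z)\<^sup>2 - (fa z)\<^sup>2)) = lthR"
    unfolding lthR_def [abs_def] 4 fa_def fb_def fe_def ..
  ultimately show "(lthR has_real_derivative lthQ z + 4 * lthP z * lthR z) (at z)" by simp
qed

text \<open>The functional equation contributes the factor sqrt t = exp z, which the summand z/2 of
  \<open>lth\<close> distributes evenly between z and -z.\<close>

lemma lth_even: "lth (- z) = lth z"
proof -
  have "theta (exp (2 * - z)) = exp z * theta (exp (2 * z))"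
    using theta_functional[of "exp (2 * z)"] by (simp add: exp_minus inverse_eq_divide exp_double)
  then show ?thesis using theta_pos[of "exp (2 * z)"] by (simp add: lth_def ln_mult)
qed

lemma lthP_odd: "lthP (- z) = - lthP z"
proof -
  have "((\<lambda>z. lth (- z)) has_real_derivative lthP (- z) * (- 1)) (at z)"
    by (rule DERIV_chain2[of lth _ uminus]) (auto intro!: lth_derivs derivative_eq_intros)
  then have "(lth has_real_derivative lthP (- z) * (- 1)) (at z)" by (simp add: lth_even)
  from DERIV_unique[OF this lth_derivs(1)] show ?thesis by simp
qed

text \<open>The inversion t -> 1/t exchanges the two factors B and C of \<open>lthQ\<close>.\<close>

lemma lthQ_even: "lthQ (- z) = lthQ z"
proof -
  define t where "t = exp (2 * z)"
  have t: "t > 0" "1 / t > 0" by (simp_all add: t_def)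
  have "exp (2 * - z) = 1 / t" by (simp add: t_def exp_minus inverse_eq_divide)
  moreover have "theta (1 / t) ^ 4 - theta4 (1 / t) ^ 4 = t\<^sup>2 * theta4 t ^ 4"
  proof -
    have "theta (1 / t) ^ 4 - theta4 (1 / t) ^ 4 = (sqrt t * theta4 t) ^ 4"
      using theta_jacobi[OF t(2)] theta2_functional[OF t(1)] by simp
    then show ?thesis using t by (simp add: power_mult_distrib power4_eq_xxxx power2_eq_square)
  qed
  moreover have "theta4 (1 / t) ^ 4 = t\<^sup>2 * (theta t ^ 4 - theta4 t ^ 4)"
    unfolding theta4_functional[OF t(1)] theta_jacobi[OF t(1)]
    using t by (simp add: power_mult_distrib power4_eq_xxxx power2_eq_square)
  ultimately show ?thesis
    using t by (simp add: lthQ_def flip: t_def) (simp add: field_simps)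
qed

text \<open>At t = 1 the quantities B and C coincide and add up to \<open>psi2\<close>, so both are
  \<open>psi2 / 2\<close>.\<close>

lemma lth_at_0: "lthP 0 = 0" "lthQ 0 = psi2\<^sup>2 / 8" "lthR 0 = 0"
proof -
  show "lthP 0 = 0" using lthP_odd[of 0] by simp
  have "theta2 1 = theta4 1" using theta2_functional[of 1] by simp
  then have 1: "theta 1 ^ 4 = 2 * theta4 1 ^ 4" using theta_jacobi[of 1] by simp
  then show "lthR 0 = 0" by (simp add: lthR_def)
  show "lthQ 0 = psi2\<^sup>2 / 8" by (simp add: lthQ_def psi2_def 1 power2_eq_square)
qed

text \<open>\<theta> >= 1 handles one direction and evenness the other. This growth makes
  \<open>phi u v\<close> decay exponentially when \<bar>v\<bar> < u.\<close>

lemma lth_lower: "lth z \<ge> \<bar>z\<bar> / 2"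
proof -
  have "lth z \<ge> z / 2" for z
    using theta_ge_1[of "exp (2 * z)"] by (simp add: lth_def)
  from this[of z] this[of "- z"] show ?thesis by (simp add: lth_even abs_if)
qed

section \<open>Global bounds for the logarithmic derivative\<close>

lemma bounded_half_line:
  fixes f :: "real \<Rightarrow> real"
  assumes "\<And>x. isCont f x" "(f \<longlongrightarrow> l) at_top"
  obtains C where "\<And>x. x \<ge> 0 \<Longrightarrow> \<bar>f x\<bar> \<le> C"
proof -
  have "eventually (\<lambda>x. dist (f x) l < 1) at_top" using assms(2) by (auto simp: tendsto_iff)
  then obtain X where X: "\<And>x. x \<ge> X \<Longrightarrow> dist (f x) l < 1" by (auto simp: eventually_at_top_linorder)
  have "compact (f ` {0..X})"
    using assms(1) by (intro compact_continuous_image continuous_at_imp_continuous_on) auto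
  then obtain B where "\<forall>y\<in>f ` {0..X}. norm y \<le> B"
    using compact_imp_bounded bounded_iff by metis
  then have B: "\<bar>f x\<bar> \<le> B" if "x \<in> {0..X}" for x using that by auto
  show ?thesis
  proof
    fix x :: real assume "x \<ge> 0"
    then show "\<bar>f x\<bar> \<le> max B (\<bar>l\<bar> + 1)"
      using X[of x] B[of x] by (cases "x \<le> X") (auto simp: dist_real_def)
  qed
qed

lemma lth_bounded:
  obtains C where "\<And>z. \<bar>lthP z\<bar> \<le> C" "\<And>z. \<bar>lthQ z\<bar> \<le> C"
proof -
  have e: "filterlim (\<lambda>z::real. exp (2 * z)) at_top at_top" by real_asymp
  have "((\<lambda>t. 1 / 2 + inverse t * (t\<^sup>2 * ldtheta t)) \<longlongrightarrow> 1 / 2 + 0 * 0) at_top"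
    by (intro tendsto_intros ldtheta_at_top tendsto_inverse_0_at_top filterlim_ident)
  moreover have "\<forall>\<^sub>F t in at_top. 1 / 2 + inverse t * (t\<^sup>2 * ldtheta t) = 1 / 2 + t * ldtheta t"
    using eventually_gt_at_top[of 0] by eventually_elim (simp add: power2_eq_square)
  ultimately have "((\<lambda>t. 1 / 2 + t * ldtheta t) \<longlongrightarrow> 1 / 2 + 0 * 0) at_top"
    by (rule Lim_transform_eventually)
  from filterlim_compose[OF this e] have 1: "(lthP \<longlongrightarrow> 1 / 2 + 0 * 0) at_top"
    by (simp add: lthP_def [abs_def])
  have "((\<lambda>t. pi * (t\<^sup>2 * ldtheta4 t - t\<^sup>2 * ldtheta t) * theta4 t ^ 4) \<longlongrightarrow> pi * (0 - 0) * 1 ^ 4) at_top"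
    by (intro tendsto_intros ldtheta_at_top theta_at_top)
  moreover have "\<forall>\<^sub>F t in at_top. pi * (t\<^sup>2 * ldtheta4 t - t\<^sup>2 * ldtheta t) * theta4 t ^ 4
      = pi\<^sup>2 / 2 * t ^ 2 * (theta t ^ 4 - theta4 t ^ 4) * theta4 t ^ 4"
    using eventually_gt_at_top[of 0]
    by eventually_elim (simp add: ldtheta_diff power2_eq_square algebra_simps)
  ultimately have "((\<lambda>t. pi\<^sup>2 / 2 * t ^ 2 * (theta t ^ 4 - theta4 t ^ 4) * theta4 t ^ 4) \<longlongrightarrow> pi * (0 - 0) * 1 ^ 4) at_top"
    by (rule Lim_transform_eventually)
  from filterlim_compose[OF this e] have 2: "(lthQ \<longlongrightarrow> pi * (0 - 0) * 1 ^ 4) at_top"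
    unfolding lthQ_def [abs_def] .
  obtain B where B: "\<And>z. z \<ge> 0 \<Longrightarrow> \<bar>lthP z\<bar> \<le> B"
    using bounded_half_line[OF DERIV_isCont[OF lth_derivs(2)] 1] by metis
  obtain C where C: "\<And>z. z \<ge> 0 \<Longrightarrow> \<bar>lthQ z\<bar> \<le> C"
    using bounded_half_line[OF DERIV_isCont[OF lth_derivs(3)] 2] by metis
  show ?thesis
  proof
    fix z
    have "\<bar>lthP z\<bar> = \<bar>lthP \<bar>z\<bar>\<bar>" "\<bar>lthQ z\<bar> = \<bar>lthQ \<bar>z\<bar>\<bar>"
      by (auto simp: abs_if lthP_odd lthQ_even)
    then show "\<bar>lthP z\<bar> \<le> max B C" "\<bar>lthQ z\<bar> \<le> max B C" using B[of "\<bar>z\<bar>"] C[of "\<bar>z\<bar>"]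
      by (auto simp: le_max_iff_disj)
  qed
qed

section \<open>Taylor coefficients at the origin as polynomials in \<open>psi2\<close>\<close>

lemma binconv_deriv:
  fixes X Y :: "real \<Rightarrow> nat \<Rightarrow> real"
  assumes "\<And>i. i \<le> n \<Longrightarrow> ((\<lambda>z. X z i) has_real_derivative X z (Suc i)) (at z)"
    "\<And>i. i \<le> n \<Longrightarrow> ((\<lambda>z. Y z i) has_real_derivative Y z (Suc i)) (at z)"
  shows "((\<lambda>z. binconv (X z) (Y z) n) has_real_derivative binconv (X z) (Y z) (Suc n)) (at z)"
proof -
  have "((\<lambda>z. binconv (X z) (Y z) n) has_real_derivative
      (\<Sum>i\<le>n. of_nat (n choose i) * (X z (Suc i) * Y z (n - i) + Y z (Suc (n - i)) * X z i))) (at z)"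
    unfolding binconv_def mult.assoc
    by (intro DERIV_sum DERIV_cmult DERIV_mult assms) auto
  moreover have "(\<Sum>i\<le>n. of_nat (n choose i) * (X z (Suc i) * Y z (n - i) + Y z (Suc (n - i)) * X z i))
      = binconv (X z) (Y z) (Suc n)"
    unfolding binconv_Suc unfolding binconv_def by (simp add: algebra_simps sum.distrib)
  ultimately show ?thesis by simp
qed

lemma rat_poly_eval_add: "rat_poly_eval (p + q) x = rat_poly_eval p x + rat_poly_eval q x"
proof -
  have "map_poly of_rat (p + q) = (map_poly of_rat p + map_poly of_rat q :: real poly)"
    by (rule poly_eqI) (simp add: coeff_map_poly of_rat_add)
  then show ?thesis by (simp add: rat_poly_eval_def)
qed

lemma rat_poly_eval_mult: "rat_poly_eval (p * q) x = rat_poly_eval p x * rat_poly_eval q x"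
proof -
  have "map_poly of_rat (p * q) = (map_poly of_rat p * map_poly of_rat q :: real poly)"
    by (rule poly_eqI) (simp add: coeff_map_poly coeff_mult of_rat_sum of_rat_mult)
  then show ?thesis by (simp add: rat_poly_eval_def)
qed

text \<open>The recursion is started at every point z, not only at 0: differentiating it by the
  Leibniz rule shows that its n-th term, as a function of z, is the n-th derivative of
  \<open>lthP\<close>. At 0 it is the image of the recursion over rational polynomials with an
  indeterminate in place of \<open>psi2\<close>.\<close>

lemma lth_taylor:
  obtains D where "D 0 = lthP" "\<And>n z. (D n has_real_derivative D (Suc n) z) (at z)"
    "\<And>n. even n \<Longrightarrow> D n 0 = 0"
    "\<And>n. odd n \<Longrightarrow> \<exists>p :: rat poly. even_poly p \<and> degree p = Suc n \<and> D n 0 = rat_poly_eval p psi2"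
proof -
  define P where "P = (\<lambda>z n. fst (ode_sol (1/2) (lthP z) (lthQ z) (lthR z) n))"
  define Q where "Q = (\<lambda>z n. fst (snd (ode_sol (1/2) (lthP z) (lthQ z) (lthR z) n)))"
  define R where "R = (\<lambda>z n. snd (snd (ode_sol (1/2) (lthP z) (lthQ z) (lthR z) n)))"
  have 0: "P z 0 = lthP z" "Q z 0 = lthQ z" "R z 0 = lthR z" for z
    by (simp_all add: P_def Q_def R_def)
  have S: "P z (Suc n) = 2 * binconv (P z) (P z) n + Q z n - (if n = 0 then 1/2 else 0)"
    "Q z (Suc n) = 8 * binconv (P z) (Q z) n - 16 * binconv (R z) (Q z) n"
    "R z (Suc n) = Q z n + 4 * binconv (P z) (R z) n" for z n
    by (simp_all add: P_def Q_def R_def)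
  have sys: "ode_seq (1/2) (P z) (Q z) (R z)" for z unfolding ode_seq_def using S by auto
  have b0: "binconv X Y 0 = X 0 * Y 0" for X Y :: "nat \<Rightarrow> real" by (simp add: binconv_def)
  have "((\<lambda>z. P z n) has_real_derivative P z (Suc n)) (at z) \<and>
      ((\<lambda>z. Q z n) has_real_derivative Q z (Suc n)) (at z) \<and>
      ((\<lambda>z. R z n) has_real_derivative R z (Suc n)) (at z)" for n z
  proof (induction n arbitrary: z rule: less_induct)
    case (less n)
    show ?case
    proof (cases n)
      case 0
      show ?thesis unfolding 0 using lth_derivs[of z]
        by (simp add: S b0 \<open>\<And>z. P z 0 = lthP z\<close> \<open>\<And>z. Q z 0 = lthQ z\<close> \<open>\<And>z. R z 0 = lthR z\<close> power2_eq_square algebra_simps)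
    next
      case (Suc m)
      have IH: "((\<lambda>z. P z i) has_real_derivative P z (Suc i)) (at z)"
        "((\<lambda>z. Q z i) has_real_derivative Q z (Suc i)) (at z)"
        "((\<lambda>z. R z i) has_real_derivative R z (Suc i)) (at z)" if "i \<le> m" for i z
        using less[of i z] that Suc by auto
      \<comment> \<open>The subtracted 0 is the derivative of the constant in the equation for
        p.\<close>
      have S': "P z (Suc (Suc m)) = 2 * binconv (P z) (P z) (Suc m) + Q z (Suc m) - 0"
        using S(1)[of z "Suc m"] by simp
      have "((\<lambda>z. P z (Suc m)) has_real_derivative P z (Suc (Suc m))) (at z)"
        unfolding S' unfolding S(1)[of _ m]
        by (intro DERIV_add DERIV_diff DERIV_cmult binconv_deriv IH DERIV_const) auto
      moreover have "((\<lambda>z. Q z (Suc m)) has_real_derivative Q z (Suc (Suc m))) (at z)"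
        unfolding S(2)[of _ "Suc m"] unfolding S(2)[of _ m]
        by (intro DERIV_add DERIV_diff DERIV_cmult binconv_deriv IH) auto
      moreover have "((\<lambda>z. R z (Suc m)) has_real_derivative R z (Suc (Suc m))) (at z)"
        unfolding S(3)[of _ "Suc m"] unfolding S(3)[of _ m]
        by (intro DERIV_add DERIV_diff DERIV_cmult binconv_deriv IH) auto
      ultimately show ?thesis unfolding Suc by blast
    qed
  qed
  then have der: "((\<lambda>z. P z n) has_real_derivative P z (Suc n)) (at z)" for n z by blast
  obtain P1 Q1 R1 :: "nat \<Rightarrow> rat poly" where
    1: "ode_seq [:1/2:] P1 Q1 R1" "P1 0 = 0" "Q1 0 = monom (1/8) 2" "R1 0 = 0"
    using ode_seq_exists .
  define ev where "ev = (\<lambda>p. rat_poly_eval p psi2)"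
  have "ode_seq (ev [:1/2:]) (\<lambda>n. ev (P1 n)) (\<lambda>n. ev (Q1 n)) (\<lambda>n. ev (R1 n))"
    by (rule ode_seq_hom[OF 1(1)])
       (simp_all add: ev_def rat_poly_eval_add rat_poly_eval_mult, simp add: rat_poly_eval_def)
  moreover have "ev [:1/2:] = 1/2" by (simp add: ev_def rat_poly_eval_def map_poly_pCons of_rat_divide)
  ultimately have ev: "ode_seq (1/2) (\<lambda>n. ev (P1 n)) (\<lambda>n. ev (Q1 n)) (\<lambda>n. ev (R1 n))" by simp
  have ev0: "ev 0 = 0" "ev (monom (1/8) 2) = psi2\<^sup>2 / 8"
    by (simp_all add: ev_def rat_poly_eval_def map_poly_monom poly_monom of_rat_divide)
  have P: "P 0 n = ev (P1 n)" for n
    using ode_seq_unique[OF sys[of 0] ev, of n] by (simp add: 0 1 ev0 lth_at_0)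
  show ?thesis
  proof (rule that[of "\<lambda>n z. P z n"])
    show "(\<lambda>z. P z 0) = lthP" by (simp add: 0)
    show "((\<lambda>z. P z n) has_real_derivative P z (Suc n)) (at z)" for n z by (rule der)
    show "P 0 n = 0" if "even n" for n
      using ode_seq_parity[OF sys[of 0], of n] that by (simp add: 0 lth_at_0)
    show "\<exists>p :: rat poly. even_poly p \<and> degree p = Suc n \<and> P 0 n = rat_poly_eval p psi2" if "odd n" for n
    proof (intro exI conjI)
      show "even_poly (P1 n)"
        using ode_seq_poly(1)[OF 1, of n] that by (auto simp: wt_poly_def even_poly_def)
      show "degree (P1 n) = Suc n" by (rule ode_seq_poly_degree[OF 1 that])
      show "P 0 n = rat_poly_eval (P1 n) psi2" by (simp add: P ev_def)
    qed
  qed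
qed

section \<open>Fourier inversion\<close>

lemma integrable_inverse_1_plus_square_lborel: "integrable lborel (\<lambda>x::real. 1 / (1 + x\<^sup>2))"
  using agm_diag(1)[of 1] by (simp add: agm_fun_def [abs_def] real_sqrt_abs2 add.commute)

lemma tendsto_average:
  fixes f :: "real \<Rightarrow> real"
  assumes c: "\<And>x. isCont f x"
  shows "(\<lambda>n. (LBINT x:{a<..a + 1 / real (Suc n)}. f x) * real (Suc n)) \<longlonglongrightarrow> f a"
proof -
  define F where "F = (\<lambda>x. integral {a..x} f)"
  have cont: "continuous_on S f" for S using c by (simp add: continuous_at_imp_continuous_on)
  have "(F has_vector_derivative f a) (at a within {a..a + 1})"
    unfolding F_def by (rule integral_has_vector_derivative[OF cont]) auto
  then have d: "((\<lambda>y. (F y - F a) / (y - a)) \<longlongrightarrow> f a) (at a within {a..a + 1})"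
    by (simp add: has_real_derivative_iff_has_vector_derivative [symmetric] has_field_derivative_iff)
  have "filterlim (\<lambda>n. a + 1 / real (Suc n)) (at a within {a..a + 1}) sequentially"
    unfolding filterlim_at
  proof
    have "(\<lambda>n. a + 1 / real (Suc n)) \<longlonglongrightarrow> a + 0"
      by (intro tendsto_intros LIMSEQ_Suc lim_1_over_n)
    then show "(\<lambda>n. a + 1 / real (Suc n)) \<longlonglongrightarrow> a" by simp
  qed (auto simp: field_simps)
  from filterlim_compose[OF d this]
  have "(\<lambda>n. F (a + 1 / real (Suc n)) * real (Suc n)) \<longlonglongrightarrow> f a" by (simp add: F_def)
  moreover have "F (a + 1 / real (Suc n)) = (LBINT x:{a<..a + 1 / real (Suc n)}. f x)" for n
  proof -
    have "F (a + 1 / real (Suc n)) = (LBINT x:{a..a + 1 / real (Suc n)}. f x)"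
      unfolding F_def
      by (rule set_borel_integral_eq_integral(2)[symmetric]) (rule borel_integrable_atLeastAtMost'[OF cont])
    also have "\<dots> = (LBINT x:{a<..a + 1 / real (Suc n)}. f x)"
      unfolding set_lebesgue_integral_def
    proof (rule integral_cong_AE)
      have [measurable]: "f \<in> borel_measurable borel" using cont by (rule borel_measurable_continuous_onI)
      show "(\<lambda>x. indicat_real {a..a + 1 / real (Suc n)} x *\<^sub>R f x) \<in> borel_measurable lborel"
        "(\<lambda>x. indicat_real {a<..a + 1 / real (Suc n)} x *\<^sub>R f x) \<in> borel_measurable lborel"
        by measurable
      show "AE x in lborel. indicat_real {a..a + 1 / real (Suc n)} x *\<^sub>R f x = indicat_real {a<..a + 1 / real (Suc n)} x *\<^sub>R f x"
        using AE_lborel_singleton[of a] by eventually_elim (auto simp: indicator_def)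
    qed
    finally show ?thesis .
  qed
  ultimately show ?thesis by simp
qed

text \<open>In Levy's inversion formula for the interval \<open>(a, a + h]\<close> first remove the cutoff, then divide by \<open>h\<close>
  and let \<open>h \<rightarrow> 0\<close>, both times by dominated convergence.\<close>

lemma fourier_inversion:
  fixes f :: "real \<Rightarrow> real"
  assumes cont: "\<And>x. isCont f x" and pos: "\<And>x. 0 < f x" and int: "integrable lborel f"
    and F: "\<And>x. F x = (CLBINT y. f y *\<^sub>R iexp (- (x * y)))"
    and intF: "integrable lborel F"
  shows "(CLBINT x. iexp (z * x) * F x) = 2 * pi * f z"
proof -
  have [measurable]: "f \<in> borel_measurable borel"
    using cont by (intro borel_measurable_continuous_onI continuous_at_imp_continuous_on) auto
  have [measurable]: "F \<in> borel_measurable borel" using intF by auto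
  define N where "N = (LBINT x. f x)"
  have N: "N > 0"
  proof -
    have "N \<ge> 0" unfolding N_def using pos by (intro integral_nonneg_AE) (auto simp: less_imp_le)
    moreover have "N \<noteq> 0"
    proof
      assume "N = 0"
      then have "AE x in lborel. f x = 0"
        unfolding N_def using integral_nonneg_eq_0_iff_AE[OF int] pos by (auto simp: less_imp_le)
      moreover have "f x = 0 \<longleftrightarrow> False" for x using pos[of x] by auto
      ultimately have "AE x in (lborel :: real measure). False" by simp
      then have "emeasure lborel (UNIV :: real set) = 0" by (simp add: AE_iff_measurable[OF _ refl])
      then show False by simp
    qed
    ultimately show ?thesis by simp
  qed
  \<comment> \<open>Normalising by the total mass makes the positive function a probability density,
    to which Levy's formula applies.\<close>
  define M where "M = density lborel (\<lambda>x. ennreal (f x / N))"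
  have fN: "f x / N \<ge> 0" for x using pos[of x] N by simp
  interpret M: real_distribution M
  proof (intro real_distribution.intro prob_spaceI real_distribution_axioms.intro)
    have "emeasure M (space M) = (\<integral>\<^sup>+ x. ennreal (f x / N) \<partial>lborel)"
      unfolding M_def by (subst emeasure_density) (auto intro!: nn_integral_cong)
    also have "\<dots> = ennreal (LBINT x. f x / N)"
      using int fN by (intro nn_integral_eq_integral) auto
    finally show "emeasure M (space M) = 1" using N by (simp add: N_def)
    show "sets M = sets borel" by (simp add: M_def)
  qed
  have char: "char M t = F (- t) / N" for t
  proof -
    have "char M t = (CLBINT x. (f x / N) *\<^sub>R iexp (t * x))"
      unfolding char_def M_def using fN by (intro integral_density) auto
    also have "\<dots> = (CLBINT x. f x *\<^sub>R iexp (- (- t * x)) / N)"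
      by (intro Bochner_Integration.integral_cong) (auto simp: scaleR_conv_of_real)
    finally show ?thesis unfolding F by simp
  qed
  have meas: "measure M A = (LBINT x:A. f x) / N" if [measurable]: "A \<in> sets borel" for A
  proof -
    have "emeasure M A = (\<integral>\<^sup>+ x. ennreal (indicator A x * f x / N) \<partial>lborel)"
      unfolding M_def by (subst emeasure_density) (auto intro!: nn_integral_cong split: split_indicator)
    also have "\<dots> = ennreal (LBINT x. indicator A x * f x / N)"
      using integrable_mult_indicator[of A lborel f] int pos N
      by (intro nn_integral_eq_integral) (auto simp: less_imp_le)
    finally show ?thesis
      using pos N by (simp add: measure_def set_lebesgue_integral_def integral_nonneg_AE less_imp_le)
  qed
  define a where "a = z"
  \<comment> \<open>The kernel of Levy's formula. It is bounded by the interval length h uniformly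
    in t, apart from the null set t = 0; this bound dominates in both limits.\<close>
  define D where "D = (\<lambda>h t. (iexp (- (t * a)) - iexp (- (t * (a + h)))) / (\<i> * t))"
  have D_bound: "cmod (D h t) \<le> h" if "h > 0" "t \<noteq> 0" for h t
    using Levy_Inversion_aux2[of "- (a + h)" "- a" t] that
    by (simp only: D_def mult_minus_right) simp
  have D_meas [measurable]: "D h \<in> borel_measurable borel" for h unfolding D_def by measurable
  have intc: "integrable lborel (\<lambda>t. F (- t) / N)"
    using lborel_integrable_real_affine[OF intF, of "- 1" 0] by simp
  have dom: "AE t in lborel. cmod (D h t * (F (- t) / N)) \<le> h * cmod (F (- t) / N)" if "h > 0" for h
    using AE_lborel_singleton[of 0]
    by eventually_elim (unfold norm_mult, intro mult_right_mono D_bound that, auto)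
  have inv: "1 / (2 * pi) * (CLBINT t. D h t * (F (- t) / N)) = measure M {a<..a + h}" if h: "h > 0" for h
  proof (rule LIMSEQ_unique)
    \<comment> \<open>Levy's formula needs endpoints without mass.\<close>
    have 0: "measure M {x} = 0" for x
    proof -
      have "AE y in lborel. indicat_real {x} y *\<^sub>R f y = 0"
        using AE_lborel_singleton[of x] by eventually_elim (auto simp: indicator_def)
      then have "(LBINT y:{x}. f y) = 0"
        unfolding set_lebesgue_integral_def by (rule integral_eq_zero_AE)
      then show ?thesis by (simp add: meas)
    qed
    show "(\<lambda>T::nat. 1 / (2 * pi) * (CLBINT t=- ereal (real T)..ereal (real T). D h t * (F (- t) / N))) \<longlonglongrightarrow> measure M {a<..a + h}"
      using M.Levy_Inversion[of a "a + h"] h by (simp add: 0 D_def char)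
    have "(\<lambda>T::nat. CLBINT t. indicator {- real T<..<real T} t *\<^sub>R (D h t * (F (- t) / N)))
        \<longlonglongrightarrow> (CLBINT t. D h t * (F (- t) / N))"
    proof (rule integral_dominated_convergence[where w = "\<lambda>t. h * cmod (F (- t) / N)"])
      show "integrable lborel (\<lambda>t. h * cmod (F (- t) / N))"
        using intc by (intro integrable_mult_right integrable_norm)
      show "AE t in lborel. (\<lambda>T. indicator {- real T<..<real T} t *\<^sub>R (D h t * (F (- t) / N)))
          \<longlonglongrightarrow> D h t * (F (- t) / N)"
      proof (intro AE_I2 tendsto_eventually)
        fix t :: real
        show "\<forall>\<^sub>F T in sequentially. indicator {- real T<..<real T} t *\<^sub>R (D h t * (F (- t) / N))
            = D h t * (F (- t) / N)"
          using eventually_gt_at_top[of "nat \<lceil>\<bar>t\<bar>\<rceil>"]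
        proof eventually_elim
          case (elim T)
          then have "\<bar>t\<bar> < real T" by linarith
          then show ?case by (auto simp: indicator_def abs_less_iff)
        qed
      qed
      show "AE t in lborel. norm (indicator {- real T<..<real T} t *\<^sub>R (D h t * (F (- t) / N)))
          \<le> h * cmod (F (- t) / N)" for T
        using dom[OF h] by eventually_elim (use h in \<open>auto simp: indicator_def\<close>)
    qed measurable
    moreover have "(CLBINT t=- ereal (real T)..ereal (real T). g t) = (CLBINT t. indicator {- real T<..<real T} t *\<^sub>R g t)"
      for T :: nat and g :: "real \<Rightarrow> complex"
      by (simp add: interval_lebesgue_integral_def set_lebesgue_integral_def)
    ultimately have "(\<lambda>T::nat. CLBINT t=- ereal (real T)..ereal (real T). D h t * (F (- t) / N)) \<longlonglongrightarrow> (CLBINT t. D h t * (F (- t) / N))"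
      by (simp only:)
    then show "(\<lambda>T::nat. 1 / (2 * pi) * (CLBINT t=- ereal (real T)..ereal (real T). D h t * (F (- t) / N)))
        \<longlonglongrightarrow> 1 / (2 * pi) * (CLBINT t. D h t * (F (- t) / N))"
      by (intro tendsto_intros)
  qed
  define h where "h = (\<lambda>n. 1 / real (Suc n))"
  have h: "h n > 0" for n by (simp add: h_def)
  have "(\<lambda>n. CLBINT t. D (h n) t * (F (- t) / N) * real (Suc n)) \<longlonglongrightarrow> (CLBINT t. iexp (- (t * a)) * (F (- t) / N))"
  proof (rule integral_dominated_convergence[where w = "\<lambda>t. cmod (F (- t) / N)"])
    show "integrable lborel (\<lambda>t. cmod (F (- t) / N))" using intc by (rule integrable_norm)
    show "AE t in lborel. (\<lambda>n. D (h n) t * (F (- t) / N) * real (Suc n)) \<longlonglongrightarrow> iexp (- (t * a)) * (F (- t) / N)"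
      using AE_lborel_singleton[of 0]
    proof eventually_elim
      case (elim t)
      have "((\<lambda>w. exp (- \<i> * t * w)) has_field_derivative - \<i> * t) (at 0)"
        by (auto intro!: derivative_eq_intros)
      then have lim: "((\<lambda>w. (exp (- \<i> * t * w) - 1) / w) \<longlongrightarrow> - \<i> * t) (at 0)"
        by (simp add: has_field_derivative_iff)
      have "filterlim (\<lambda>n. complex_of_real (h n)) (at 0) sequentially"
        unfolding filterlim_at
      proof
        have "h \<longlonglongrightarrow> 0" unfolding h_def by (intro LIMSEQ_Suc lim_1_over_n)
        then have "(\<lambda>n. complex_of_real (h n)) \<longlonglongrightarrow> of_real 0" by (rule tendsto_of_real)
        then show "(\<lambda>n. complex_of_real (h n)) \<longlonglongrightarrow> 0" by simp
      qed (use h in \<open>auto intro!: always_eventually simp: less_imp_neq[symmetric]\<close>)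
      from filterlim_compose[OF lim this]
      have "(\<lambda>n. - iexp (- (t * a)) / (\<i> * t) * ((exp (- \<i> * t * h n) - 1) / h n)) \<longlonglongrightarrow>
          - iexp (- (t * a)) / (\<i> * t) * (- \<i> * t)"
        by (rule tendsto_mult_left)
      moreover have "- iexp (- (t * a)) / (\<i> * t) * ((exp (- \<i> * t * h n) - 1) / h n) = D (h n) t * real (Suc n)" for n
      proof -
        have "iexp (- (t * (a + h n))) = iexp (- (t * a)) * exp (- \<i> * t * h n)"
          by (simp add: algebra_simps flip: exp_add)
        moreover have "1 / complex_of_real (h n) = real (Suc n)" by (simp add: h_def)
        moreover have "- e / c * ((x - 1) / y) = (e - e * x) / c * (1 / y)" for e c x y :: complex
          by (simp add: algebra_simps diff_divide_distrib)
        ultimately show ?thesis unfolding D_def by metis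
      qed
      moreover have "- iexp (- (t * a)) / (\<i> * t) * (- \<i> * t) = iexp (- (t * a))"
        using elim by simp
      ultimately have "(\<lambda>n. D (h n) t * real (Suc n)) \<longlonglongrightarrow> iexp (- (t * a))" by simp
      then have "(\<lambda>n. D (h n) t * real (Suc n) * (F (- t) / N)) \<longlonglongrightarrow> iexp (- (t * a)) * (F (- t) / N)"
        by (intro tendsto_intros)
      then show ?case by (simp add: mult_ac)
    qed
    show "AE t in lborel. cmod (D (h n) t * (F (- t) / N) * real (Suc n)) \<le> cmod (F (- t) / N)" for n
      using dom[OF h[of n]]
    proof eventually_elim
      case (elim t)
      then have "cmod (D (h n) t * (F (- t) / N)) * real (Suc n) \<le> h n * cmod (F (- t) / N) * real (Suc n)"
        by (rule mult_right_mono) simp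
      also have "h n * cmod (F (- t) / N) * real (Suc n) = cmod (F (- t) / N)"
        by (simp add: h_def)
      finally show ?case by (simp only: norm_mult norm_of_real norm_of_nat abs_of_nat)
    qed
  qed measurable
  then have "(\<lambda>n. 1 / (2 * pi) * (CLBINT t. D (h n) t * (F (- t) / N) * real (Suc n)))
      \<longlonglongrightarrow> 1 / (2 * pi) * (CLBINT t. iexp (- (t * a)) * (F (- t) / N))"
    by (rule tendsto_mult_left)
  then have "(\<lambda>n. 1 / (2 * pi) * (CLBINT t. D (h n) t * (F (- t) / N)) * real (Suc n))
      \<longlonglongrightarrow> 1 / (2 * pi) * (CLBINT t. iexp (- (t * a)) * (F (- t) / N))"
    unfolding integral_mult_left_zero by (simp only: mult.assoc)
  then have l1: "(\<lambda>n. complex_of_real (measure M {a<..a + h n}) * real (Suc n))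
      \<longlonglongrightarrow> 1 / (2 * pi) * (CLBINT t. iexp (- (t * a)) * (F (- t) / N))"
    unfolding inv[OF h] .
  have "(\<lambda>n. (LBINT x:{a<..a + h n}. f x) * real (Suc n) / N) \<longlonglongrightarrow> f a / N"
    unfolding h_def by (intro tendsto_intros tendsto_average cont) (use N in auto)
  then have "(\<lambda>n. measure M {a<..a + h n} * real (Suc n)) \<longlonglongrightarrow> f a / N"
    by (simp add: meas)
  then have "(\<lambda>n. complex_of_real (measure M {a<..a + h n} * real (Suc n))) \<longlonglongrightarrow> of_real (f a / N)"
    by (rule tendsto_of_real)
  then have l2: "(\<lambda>n. complex_of_real (measure M {a<..a + h n}) * real (Suc n)) \<longlonglongrightarrow> of_real (f a / N)"
    by simp
  have "1 / (2 * pi) * (CLBINT t. iexp (- (t * a)) * (F (- t) / N)) = of_real (f a / N)"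
    by (rule LIMSEQ_unique[OF l1 l2])
  moreover have "(CLBINT t. iexp (- (t * a)) * (F (- t) / N)) = (CLBINT t. iexp (t * a) * F t) / N"
    using lborel_integral_real_affine[of "- 1" "\<lambda>t. iexp (t * a) * (F t / N)" 0] by auto
  ultimately have "1 / (2 * pi) * ((CLBINT t. iexp (t * a) * F t) / N) = of_real (f a / N)"
    by (simp only:)
  then show ?thesis using N by (simp add: a_def mult.commute field_simps)
qed

section \<open>Cumulants\<close>

definition phi :: "real \<Rightarrow> real \<Rightarrow> real \<Rightarrow> real" where
  "phi u v y = exp (v * y / 2 - u * lth y)"

lemma isCont_phi: "isCont (phi u v) y"
  unfolding phi_def [abs_def]
  by (intro continuous_intros DERIV_isCont[OF lth_derivs(1)]) auto

lemma phi_pos: "phi u v y > 0" by (simp add: phi_def)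

lemma phi_borel [measurable]: "phi u v \<in> borel_measurable borel"
  using isCont_phi by (intro borel_measurable_continuous_onI continuous_at_imp_continuous_on) auto

text \<open>The exponent is at most -4c\<bar>y\<bar>, where 4c = (u - \<bar>v\<bar>) / 2 > 0. The
  quadratic Taylor bound for exp (c\<bar>y\<bar>), squared, turns this into rational decay of order
  4.\<close>

lemma phi_bound:
  assumes "\<bar>v\<bar> < u"
  obtains K where "K > 0" "\<And>y. phi u v y \<le> K / (1 + y\<^sup>2) ^ 2"
proof -
  define c where "c = (u - \<bar>v\<bar>) / 8"
  have c: "c > 0" using assms by (simp add: c_def)
  define m where "m = min 1 (c\<^sup>2 / 2)"
  have m: "m > 0" "m \<le> 1" "m \<le> c\<^sup>2 / 2" using c by (auto simp: m_def)
  have "phi u v y \<le> (1 / m\<^sup>2) / (1 + y\<^sup>2) ^ 2" for y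
  proof -
    have "u * \<bar>y\<bar> / 2 \<le> u * lth y"
      using lth_lower[of y] assms by (simp add: mult_left_mono flip: times_divide_eq_right)
    moreover have "v * y \<le> \<bar>v\<bar> * \<bar>y\<bar>" by (simp flip: abs_mult)
    moreover have "4 * c * \<bar>y\<bar> = u * \<bar>y\<bar> / 2 - \<bar>v\<bar> * \<bar>y\<bar> / 2"
      by (simp add: c_def field_simps)
    ultimately have "v * y / 2 - u * lth y \<le> - (4 * c * \<bar>y\<bar>)" by linarith
    then have 1: "phi u v y \<le> exp (- (4 * c * \<bar>y\<bar>))" by (simp add: phi_def)
    have "m * (1 + y\<^sup>2) \<le> 1 + c * \<bar>y\<bar> + (c * \<bar>y\<bar>)\<^sup>2 / 2"
    proof -
      have "m * y\<^sup>2 \<le> c\<^sup>2 / 2 * y\<^sup>2" by (rule mult_right_mono[OF m(3)]) simp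
      moreover have "0 \<le> c * \<bar>y\<bar>" using c by simp
      ultimately show ?thesis using m(2) by (simp add: power_mult_distrib algebra_simps)
    qed
    also have "\<dots> \<le> exp (c * \<bar>y\<bar>)" using c by (intro exp_lower_Taylor_quadratic) auto
    finally have "(m * (1 + y\<^sup>2)) ^ 2 \<le> exp (c * \<bar>y\<bar>) ^ 2"
      using m by (intro power_mono) auto
    also have "\<dots> \<le> exp (4 * c * \<bar>y\<bar>)" using c by (simp flip: exp_of_nat_mult)
    finally have "exp (- (4 * c * \<bar>y\<bar>)) \<le> 1 / (m * (1 + y\<^sup>2)) ^ 2"
      unfolding exp_minus inverse_eq_divide using m
      by (intro divide_left_mono mult_pos_pos zero_less_power) (auto simp: add_pos_nonneg)
    with 1 show ?thesis by (simp add: power_mult_distrib)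
  qed
  with m show ?thesis by (intro that[of "1 / m\<^sup>2"]) auto
qed

lemma phi_integrable:
  assumes "\<bar>v\<bar> < u"
  shows "integrable lborel (phi u v)"
proof -
  obtain K where K: "K > 0" "\<And>y. phi u v y \<le> K / (1 + y\<^sup>2) ^ 2" using phi_bound[OF assms] by blast
  have "phi u v y \<le> K * (1 / (1 + y\<^sup>2))" for y
  proof -
    have "(1 + y\<^sup>2) ^ 1 \<le> (1 + y\<^sup>2) ^ 2" by (rule power_increasing) auto
    then have "K / (1 + y\<^sup>2) ^ 2 \<le> K / (1 + y\<^sup>2)"
      using K(1) by (intro divide_left_mono mult_pos_pos zero_less_power) (auto simp: add_pos_nonneg)
    with K(2)[of y] show ?thesis by simp
  qed
  then show ?thesis
    using phi_pos K(1)
    by (intro Bochner_Integration.integrable_bound[OF integrable_mult_right[OF integrable_inverse_1_plus_square_lborel, of K]])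
       (auto simp: abs_of_pos less_imp_le intro!: AE_I2)
qed

section \<open>The Fourier transform of \<open>phi\<close> and its decay\<close>

definition phi_hat :: "real \<Rightarrow> real \<Rightarrow> real \<Rightarrow> complex" where
  "phi_hat u v x = (CLBINT y. phi u v y *\<^sub>R iexp (- (x * y)))"

lemma set_integrable_phi:
  assumes "\<bar>v\<bar> < u" "A \<in> sets borel"
  shows "set_integrable lborel A (phi u v)"
  using integrable_mult_indicator[of A lborel "phi u v"] phi_integrable[OF assms(1)] assms(2)
  by (simp add: set_integrable_def)

text \<open>The substitution \<open>t = e\<^sup>y\<close> turns the Mellin-type integral into a Fourier transform,
  since \<open>\<theta>(e\<^sup>2\<^sup>y) = exp (lth y - y/2)\<close> and \<open>lth\<close> is even.\<close>

lemma Z_Q_eq_phi_hat: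
  assumes uv: "\<bar>v\<bar> < u"
  shows "Z_Q (- complex_of_real u) (- complex_of_real ((u + v) / 2) + \<i> * complex_of_real x) = phi_hat u v x"
proof -
  define f where "f = (\<lambda>t. (1 / t) *\<^sub>R (phi u v (ln t) *\<^sub>R iexp (- (x * ln t))))"
  define fr where "fr = (\<lambda>t. phi u v (ln t) / t)"
  have eq: "complex_of_real (theta (t\<^sup>2)) powr (- complex_of_real ((u + v) / 2) + \<i> * complex_of_real x)
      * complex_of_real (theta (1 / t\<^sup>2)) powr (- complex_of_real u - (- complex_of_real ((u + v) / 2) + \<i> * complex_of_real x))
        / complex_of_real t = f t" if t: "t > 0" for t
  proof -
    define y where "y = ln t"
    have ty: "t = exp y" using t by (simp add: y_def)
    have t2: "t\<^sup>2 = exp (2 * y)" "1 / t\<^sup>2 = exp (2 * - y)"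
      by (simp_all add: ty exp_double exp_minus inverse_eq_divide)
    have ln_theta: "ln (theta (exp (2 * y))) = lth y - y / 2" for y by (simp add: lth_def)
    have pw: "complex_of_real (theta (exp (2 * y))) powr s = exp (s * of_real (lth y - y / 2))" for s y
      using theta_pos[of "exp (2 * y)"] by (simp add: powr_def Ln_of_real ln_theta)
    show ?thesis
    proof -
      define r where "r = - complex_of_real ((u + v) / 2) + \<i> * complex_of_real x"
      \<comment> \<open>The terms with r cancel in front of \<open>lth y\<close>, leaving -u; the
        linear terms add up to (-r - u/2) y = (v/2 - i x) y.\<close>
      have "r * of_real (lth y - y / 2) + (- complex_of_real u - r) * of_real (lth y - (- y) / 2)
          = of_real (v * y / 2 - u * lth y) + \<i> * of_real (- (x * y))"
        by (simp add: r_def field_simps)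
      then have "exp (r * of_real (lth y - y / 2)) * exp ((- complex_of_real u - r) * of_real (lth y - (- y) / 2))
          = of_real (phi u v y) * iexp (- (x * y))"
        by (simp add: phi_def flip: exp_add exp_of_real)
      then show ?thesis
        unfolding t2(2) unfolding t2(1) pw lth_even r_def [symmetric] f_def y_def [symmetric]
        by (simp add: scaleR_conv_of_real)
    qed
  qed
  have cl: "isCont f t" if "t > 0" for t
    using that unfolding f_def
    by (intro continuous_intros isCont_o2[OF _ isCont_phi]) auto
  have cr: "isCont fr t" if "t > 0" for t
    using that unfolding fr_def
    by (intro continuous_intros isCont_o2[OF _ isCont_phi]) auto
  have A: "((ereal \<circ> exp \<circ> real_of_ereal) \<longlongrightarrow> 0) (at_right (- \<infinity>))"
    using exp_at_bot by (simp add: zero_ereal_def ereal_tendsto_simps)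
  have B: "((ereal \<circ> exp \<circ> real_of_ereal) \<longlongrightarrow> \<infinity>) (at_left \<infinity>)"
    using exp_at_top by (simp add: ereal_tendsto_simps)
  \<comment> \<open>\<open>fr\<close> is the modulus of \<open>f\<close> on the half-line. The
    nonnegative form of the substitution rule yields its integrability, which the complex form then
    takes as a hypothesis.\<close>
  have ir: "set_integrable lborel (einterval 0 \<infinity>) fr"
  proof (rule interval_integral_substitution_nonneg(1)[of "- \<infinity>" \<infinity> exp exp fr, OF _ _ _ _ _ _ A B])
    show "set_integrable lborel (einterval (- \<infinity>) \<infinity>) (\<lambda>x. fr (exp x) * exp x)"
      using set_integrable_phi[OF uv, of UNIV] by (simp add: fr_def)
  qed (auto intro!: cr [unfolded fr_def] simp: fr_def phi_pos less_imp_le)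
  have il: "set_integrable lborel (einterval 0 \<infinity>) f"
    using ir
  proof (rule set_integrable_bound)
    show "set_borel_measurable lborel (einterval 0 \<infinity>) f"
      unfolding f_def set_borel_measurable_def by measurable
    show "AE t in lborel. t \<in> einterval 0 \<infinity> \<longrightarrow> norm (f t) \<le> norm (fr t)"
      by (intro AE_I2) (simp add: f_def fr_def norm_mult)
  qed
  have "(LBINT t=0..\<infinity>. f t) = (LBINT y=-\<infinity>..\<infinity>. exp y *\<^sub>R f (exp y))"
  proof (rule interval_integral_substitution_integrable[OF _ _ _ _ _ A B _ il])
    have "norm (phi u v y *\<^sub>R iexp (- (x * y))) = norm (phi u v y)" for y by simp
    then have "integrable lborel (\<lambda>y. phi u v y *\<^sub>R iexp (- (x * y)))"
      by (intro Bochner_Integration.integrable_bound[OF phi_integrable[OF uv]]) (auto intro!: AE_I2)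
    then show "set_integrable lborel (einterval (- \<infinity>) \<infinity>) (\<lambda>y. exp y *\<^sub>R f (exp y))"
      by (simp add: f_def set_integrable_def)
  qed (auto intro!: cl)
  then have "(LBINT t:{0<..}. f t) = phi_hat u v x"
    by (simp add: interval_lebesgue_integral_def zero_ereal_def einterval_eq set_lebesgue_integral_def f_def phi_hat_def)
  moreover have "Z_Q (- complex_of_real u) (- complex_of_real ((u + v) / 2) + \<i> * complex_of_real x)
      = (LBINT t:{0<..}. f t)"
    unfolding Z_Q_def by (intro set_lebesgue_integral_cong allI impI eq) auto
  ultimately show ?thesis by simp
qed

text \<open>Two integrations by parts: the bounds on \<open>lthP\<close> and \<open>lthQ\<close> give \<open>\<bar>\<phi>''\<bar> \<le> C \<phi>\<close>.\<close>

lemma phi_hat_decay: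
  assumes uv: "\<bar>v\<bar> < u"
  obtains C where "\<And>x. cmod (phi_hat u v x) \<le> C / (1 + x\<^sup>2)"
proof -
  define d1 where "d1 = (\<lambda>y. v / 2 - u * lthP y)"
  define d2 where "d2 = (\<lambda>y. d1 y ^ 2 - u * (2 * lthP y ^ 2 + lthQ y - 1 / 2))"
  have D1: "(phi u v has_real_derivative d1 y * phi u v y) (at y)" for y
    unfolding phi_def [abs_def] d1_def by (auto intro!: derivative_eq_intros lth_derivs)
  have "(d1 has_real_derivative - u * (2 * lthP y ^ 2 + lthQ y - 1 / 2)) (at y)" for y
    unfolding d1_def by (auto intro!: derivative_eq_intros lth_derivs simp: algebra_simps)
  then have D2: "((\<lambda>y. d1 y * phi u v y) has_real_derivative d2 y * phi u v y) (at y)" for y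
    by (rule DERIV_cong[OF DERIV_mult[OF _ D1]]) (simp add: d2_def power2_eq_square algebra_simps)
  have cd2: "isCont d2 y" for y
    unfolding d2_def d1_def
    by (intro continuous_intros DERIV_isCont[OF lth_derivs(2)] DERIV_isCont[OF lth_derivs(3)])
  have [measurable]: "d2 \<in> borel_measurable borel"
    using cd2 by (intro borel_measurable_continuous_onI continuous_at_imp_continuous_on) auto
  obtain C where C: "\<And>z. \<bar>lthP z\<bar> \<le> C" "\<And>z. \<bar>lthQ z\<bar> \<le> C" using lth_bounded by metis
  have C0: "C \<ge> 0" using C(1)[of 0] by simp
  have u: "u > 0" using uv by simp
  define M1 where "M1 = \<bar>v\<bar> / 2 + u * C"
  have M1: "\<bar>d1 y\<bar> \<le> M1" for y
  proof -
    have "\<bar>d1 y\<bar> \<le> \<bar>v / 2\<bar> + \<bar>u * lthP y\<bar>" unfolding d1_def by (rule abs_triangle_ineq4)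
    also have "\<bar>u * lthP y\<bar> \<le> u * C" using C(1)[of y] u by (simp add: abs_mult)
    finally show ?thesis by (simp add: M1_def)
  qed
  define M where "M = M1 ^ 2 + u * (2 * C ^ 2 + C + 1 / 2)"
  have M: "\<bar>d2 y\<bar> \<le> M" for y
  proof -
    have "\<bar>d1 y ^ 2\<bar> \<le> M1 ^ 2" using M1[of y] power_mono[of "\<bar>d1 y\<bar>" M1 2] by simp
    moreover have "lthP y ^ 2 \<le> C ^ 2" using power_mono[OF C(1)[of y], of 2] by simp
    then have "\<bar>2 * lthP y ^ 2 + lthQ y - 1 / 2\<bar> \<le> 2 * C ^ 2 + C + 1 / 2"
      using C(2)[of y] zero_le_power2[of "lthP y"] unfolding abs_le_iff by linarith
    then have "\<bar>u * (2 * lthP y ^ 2 + lthQ y - 1 / 2)\<bar> \<le> u * (2 * C ^ 2 + C + 1 / 2)"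
      using u by (simp add: abs_mult)
    ultimately show ?thesis
      unfolding d2_def M_def using abs_triangle_ineq4[of "d1 y ^ 2" "u * (2 * lthP y ^ 2 + lthQ y - 1 / 2)"]
      by linarith
  qed
  define N where "N = (LBINT y. phi u v y)"
  have "cmod (phi_hat u v x) \<le> (M + 1) * N / (1 + x\<^sup>2)" for x
  proof -
    define e where "e = (\<lambda>y. iexp (- (x * y)))"
    have ne: "cmod (e y) = 1" for y by (simp add: e_def)
    have [measurable]: "e \<in> borel_measurable borel" unfolding e_def by measurable
    have De: "(e has_vector_derivative - \<i> * x * e y) (at y)" for y
    proof -
      have "((\<lambda>w. exp (- \<i> * x * w)) has_field_derivative - \<i> * x * exp (- \<i> * x * of_real y)) (at (of_real y))"
        by (auto intro!: derivative_eq_intros)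
      from has_vector_derivative_real_field[OF this] show ?thesis
        by (simp add: e_def mult_ac)
    qed
    \<comment> \<open>Both integrations by parts at once: \<open>G\<close> is (\<phi>' + i x \<phi>)
      e, a primitive of (\<phi>'' + x^2 \<phi>) e that vanishes at both ends. So x^2 times the
      transform is minus the transform of \<phi>''.\<close>
    define G where "G = (\<lambda>y. complex_of_real (d1 y * phi u v y) * e y + \<i> * x * (complex_of_real (phi u v y) * e y))"
    define g where "g = (\<lambda>y. complex_of_real ((d2 y + x\<^sup>2) * phi u v y) * e y)"
    have dG: "(G has_vector_derivative g y) (at y)" for y
    proof -
      have "(G has_vector_derivative
          (complex_of_real (d1 y * phi u v y) * (- \<i> * x * e y) + complex_of_real (d2 y * phi u v y) * e y)
          + \<i> * x * (complex_of_real (phi u v y) * (- \<i> * x * e y) + complex_of_real (d1 y * phi u v y) * e y)) (at y)"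
        unfolding G_def
        by (intro has_vector_derivative_add has_vector_derivative_mult has_vector_derivative_mult_right De
          has_vector_derivative_of_real D1 D2)
      also have "(complex_of_real (d1 y * phi u v y) * (- \<i> * x * e y) + complex_of_real (d2 y * phi u v y) * e y)
          + \<i> * x * (complex_of_real (phi u v y) * (- \<i> * x * e y) + complex_of_real (d1 y * phi u v y) * e y) = g y"
        by (simp add: g_def algebra_simps power2_eq_square)
      finally show ?thesis .
    qed
    have ip: "integrable lborel (\<lambda>y. phi u v y *\<^sub>R e y)"
      by (intro Bochner_Integration.integrable_bound[OF phi_integrable[OF uv]]) (auto intro!: AE_I2 simp: ne)
    have i2: "integrable lborel (\<lambda>y. (d2 y * phi u v y) *\<^sub>R e y)"
    proof (rule Bochner_Integration.integrable_bound)
      show "integrable lborel (\<lambda>y. M * phi u v y)" using phi_integrable[OF uv] by simp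
      show "AE y in lborel. norm ((d2 y * phi u v y) *\<^sub>R e y) \<le> norm (M * phi u v y)"
      proof (rule AE_I2)
        fix y
        have "\<bar>d2 y\<bar> * phi u v y \<le> \<bar>M\<bar> * phi u v y"
          using M[of y] phi_pos[of u v y] by (intro mult_right_mono) auto
        then show "norm ((d2 y * phi u v y) *\<^sub>R e y) \<le> norm (M * phi u v y)"
          using phi_pos[of u v y] by (simp add: ne abs_mult)
      qed
    qed measurable
    have geq: "g = (\<lambda>y. (d2 y * phi u v y) *\<^sub>R e y + of_real (x\<^sup>2) * (phi u v y *\<^sub>R e y))"
      by (auto simp: g_def scaleR_conv_of_real algebra_simps)
    have ig: "integrable lborel g" unfolding geq by (intro Bochner_Integration.integrable_add i2 integrable_mult_right ip)
    obtain K where K: "K > 0" "\<And>y. phi u v y \<le> K / (1 + y\<^sup>2) ^ 2" using phi_bound[OF uv] by blast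
    have nG: "norm (G y) \<le> (M1 + \<bar>x\<bar>) * (K / (1 + y\<^sup>2) ^ 2)" for y
    proof -
      have "norm (G y) \<le> \<bar>d1 y\<bar> * phi u v y + \<bar>x\<bar> * phi u v y"
        unfolding G_def using phi_pos[of u v y]
        by (intro norm_triangle_le) (simp add: norm_mult ne abs_mult)
      also have "\<dots> \<le> (M1 + \<bar>x\<bar>) * phi u v y"
        using M1[of y] phi_pos[of u v y] by (simp add: distrib_right mult_right_mono)
      also have "\<dots> \<le> (M1 + \<bar>x\<bar>) * (K / (1 + y\<^sup>2) ^ 2)"
        using M1[of 0] by (intro mult_left_mono K) auto
      finally show ?thesis .
    qed
    have lim: "(G \<longlongrightarrow> 0) F" if "((\<lambda>y. (M1 + \<bar>x\<bar>) * (K / (1 + y\<^sup>2) ^ 2)) \<longlongrightarrow> 0) F" for F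
      by (rule Lim_null_comparison[OF _ that]) (intro always_eventually allI nG)
    have l1: "(G \<longlongrightarrow> 0) at_top" by (rule lim) real_asymp
    have l2: "(G \<longlongrightarrow> 0) at_bot" by (rule lim) real_asymp
    have "(LBINT y=-\<infinity>..\<infinity>. g y) = 0 - 0"
    proof (rule interval_integral_FTC_integrable)
      show "isCont g y" for y
        unfolding g_def by (intro continuous_intros cd2 isCont_phi has_vector_derivative_continuous[OF De])
      show "set_integrable lborel (einterval (- \<infinity>) \<infinity>) g" using ig by (simp add: set_integrable_def)
    qed (use dG l1 l2 in \<open>auto simp: ereal_tendsto_simps\<close>)
    then have "(CLBINT y. g y) = 0" by (simp add: interval_lebesgue_integral_def set_lebesgue_integral_def)
    moreover have "(CLBINT y. g y) = (CLBINT y. (d2 y * phi u v y) *\<^sub>R e y) + of_real (x\<^sup>2) * phi_hat u v x"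
    proof -
      have "phi_hat u v x = (CLBINT y. phi u v y *\<^sub>R e y)" unfolding phi_hat_def e_def ..
      then show ?thesis
        unfolding geq Bochner_Integration.integral_add[OF i2 integrable_mult_right[OF ip]]
        by (simp only: integral_mult_right_zero)
    qed
    ultimately have "of_real (x\<^sup>2) * phi_hat u v x = - (CLBINT y. (d2 y * phi u v y) *\<^sub>R e y)"
      by (simp add: eq_neg_iff_add_eq_0 add.commute)
    then have "x\<^sup>2 * cmod (phi_hat u v x) = cmod (CLBINT y. (d2 y * phi u v y) *\<^sub>R e y)"
      by (metis norm_minus_cancel norm_mult norm_of_real abs_power2)
    also have "\<dots> \<le> (LBINT y. norm ((d2 y * phi u v y) *\<^sub>R e y))" by (rule integral_norm_bound)
    also have "\<dots> \<le> (LBINT y. M * phi u v y)"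
    proof (rule integral_mono)
      show "integrable lborel (\<lambda>y. norm ((d2 y * phi u v y) *\<^sub>R e y))" using i2 by (rule integrable_norm)
      show "integrable lborel (\<lambda>y. M * phi u v y)" using phi_integrable[OF uv] by simp
      show "norm ((d2 y * phi u v y) *\<^sub>R e y) \<le> M * phi u v y" for y
        using mult_right_mono[OF M[of y], of "phi u v y"] phi_pos[of u v y] by (simp add: ne abs_mult)
    qed
    finally have 1: "x\<^sup>2 * cmod (phi_hat u v x) \<le> M * N" by (simp add: N_def)
    have "cmod (phi_hat u v x) \<le> (LBINT y. norm (phi u v y *\<^sub>R e y))"
      unfolding phi_hat_def e_def by (rule integral_norm_bound)
    also have "\<dots> = N" using phi_pos[of u v] by (simp add: ne N_def abs_of_pos)
    finally have "(1 + x\<^sup>2) * cmod (phi_hat u v x) \<le> (M + 1) * N" using 1 by (simp add: algebra_simps)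
    then show ?thesis by (simp add: pos_le_divide_eq add_pos_nonneg mult.commute)
  qed
  then show ?thesis by (rule that)
qed

lemma phi_hat_integrable:
  assumes uv: "\<bar>v\<bar> < u"
  shows "integrable lborel (phi_hat u v)"
proof -
  obtain C where C: "\<And>x. cmod (phi_hat u v x) \<le> C / (1 + x\<^sup>2)" using phi_hat_decay[OF uv] by blast
  have "(\<lambda>x. CLBINT y. phi u v y *\<^sub>R iexp (- (x * y))) \<in> borel_measurable lborel"
    by (intro lborel.borel_measurable_lebesgue_integral) measurable
  then have "phi_hat u v \<in> borel_measurable lborel" by (simp add: phi_hat_def [abs_def])
  then show ?thesis
  proof (rule Bochner_Integration.integrable_bound[OF integrable_mult_right[OF integrable_inverse_1_plus_square_lborel, of C]])
    show "AE x in lborel. norm (phi_hat u v x) \<le> norm (C * (1 / (1 + x\<^sup>2)))"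
      using C by (intro AE_I2) (auto intro!: order_trans[OF C divide_right_mono[OF abs_ge_self]])
  qed
qed

text \<open>Fourier inversion undoes the transform, and the prefactor \<open>theta 1 powr u\<close>
  is exp (u \<open>lth 0\<close>), which makes the value at z = 0 equal to 1. The result is real and
  positive for all z, so the principal logarithm simply returns the exponent.\<close>

lemma char_fun_rho:
  assumes uv: "\<bar>v\<bar> < u"
  shows "char_fun (rho u v) z = complex_of_real (exp (v * z / 2 + u * (lth 0 - lth z)))"
proof -
  have "rho u v = (\<lambda>x. complex_of_real (1 / (2 * pi) * theta 1 powr u) * phi_hat u v x)"
    by (rule ext) (simp only: rho_def Z_Q_eq_phi_hat[OF uv])
  then have "char_fun (rho u v) z
      = complex_of_real (1 / (2 * pi) * theta 1 powr u) * (CLBINT x. iexp (z * x) * phi_hat u v x)"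
    unfolding char_fun_def by (simp add: mult_ac flip: integral_mult_right_zero)
  also have "(CLBINT x. iexp (z * x) * phi_hat u v x) = 2 * pi * phi u v z"
    by (rule fourier_inversion[OF isCont_phi phi_pos phi_integrable[OF uv] phi_hat_def phi_hat_integrable[OF uv]])
  also have "complex_of_real (1 / (2 * pi) * theta 1 powr u) * (2 * pi * phi u v z)
      = complex_of_real (theta 1 powr u * phi u v z)" by simp
  also have "theta 1 powr u = exp (u * lth 0)"
    using theta_pos[of 1] by (simp add: powr_def lth_def)
  also have "exp (u * lth 0) * phi u v z = exp (v * z / 2 + u * (lth 0 - lth z))"
    by (simp add: phi_def algebra_simps flip: exp_add)
  finally show ?thesis .
qed

lemma vector_derivative_of_real:
  fixes f :: "real \<Rightarrow> real"
  assumes "(f has_real_derivative d) (at z)"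
  shows "vector_derivative (\<lambda>z. complex_of_real (f z)) (at z) = of_real d"
  by (rule vector_derivative_at) (rule has_vector_derivative_of_real[OF assms])

theorem theorem7p7:
  shows "psi2 = pi\<^sup>2 / Gamma (3/4 :: real) ^ 4 \<and>
    (\<forall>u v :: real. 0 < u \<longrightarrow> \<bar>v\<bar> < u \<longrightarrow>
       cumulant 1 (rho u v) = - (\<i> * complex_of_real v / 2)) \<and>
    (\<exists>c :: nat \<Rightarrow> real.
       (\<forall>k\<ge>2. \<forall>u v :: real. 0 < u \<longrightarrow> \<bar>v\<bar> < u \<longrightarrow>
          cumulant k (rho u v) = complex_of_real (c k * u)) \<and>
       (\<forall>k\<ge>2. c k \<in> range (\<lambda>p :: rat poly. rat_poly_eval p psi2)) \<and>
       (\<forall>k\<ge>3. odd k \<longrightarrow> c k = 0) \<and>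
       (\<forall>k\<ge>2. even k \<longrightarrow>
          (\<exists>p :: rat poly. even_poly p \<and> degree p = k \<and> c k = rat_poly_eval p psi2)))"
proof (intro conjI)
  show "psi2 = pi\<^sup>2 / Gamma (3/4 :: real) ^ 4"
    by (simp add: psi2_def theta_1_power4 power2_eq_square)
  obtain D where D: "D 0 = lthP" "\<And>n z. (D n has_real_derivative D (Suc n) z) (at z)"
    "\<And>n. even n \<Longrightarrow> D n 0 = 0"
    "\<And>n. odd n \<Longrightarrow> \<exists>p :: rat poly. even_poly p \<and> degree p = Suc n \<and> D n 0 = rat_poly_eval p psi2"
    using lth_taylor by metis
  define dv :: "(real \<Rightarrow> complex) \<Rightarrow> real \<Rightarrow> complex" where "dv = (\<lambda>g z. vector_derivative g (at z))"
  have Ln: "(\<lambda>z. Ln (char_fun (rho u v) z)) = (\<lambda>z. complex_of_real (v * z / 2 + u * (lth 0 - lth z)))"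
    if "\<bar>v\<bar> < u" for u v
    by (rule ext) (simp only: char_fun_rho[OF that] Ln_of_real exp_gt_zero ln_exp)
  have 1: "dv (\<lambda>z. Ln (char_fun (rho u v) z)) = (\<lambda>z. complex_of_real (v / 2 - u * D 0 z))"
    if "\<bar>v\<bar> < u" for u v
    unfolding dv_def Ln[OF that] D(1)
    by (intro ext vector_derivative_of_real) (auto intro!: derivative_eq_intros lth_derivs)
  \<comment> \<open>The parameter v sits only in the linear term of the exponent, so it is gone from
    the second derivative on.\<close>
  have 2: "(dv ^^ Suc (Suc n)) (\<lambda>z. Ln (char_fun (rho u v) z)) = (\<lambda>z. complex_of_real (- u * D (Suc n) z))"
    if "\<bar>v\<bar> < u" for u v n
  proof (induction n)
    case 0
    show ?case
      unfolding funpow.simps comp_def id_def 1[OF that] unfolding dv_def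
      by (intro ext vector_derivative_of_real) (auto intro!: derivative_eq_intros D(2))
  next
    case (Suc n)
    show ?case
      unfolding funpow.simps(2)[of "Suc (Suc n)"] comp_def Suc unfolding dv_def
      by (intro ext vector_derivative_of_real) (auto intro!: derivative_eq_intros D(2))
  qed
  show "\<forall>u v :: real. 0 < u \<longrightarrow> \<bar>v\<bar> < u \<longrightarrow> cumulant 1 (rho u v) = - (\<i> * complex_of_real v / 2)"
  proof (intro allI impI)
    fix u v :: real assume "\<bar>v\<bar> < u"
    from 1[OF this] show "cumulant 1 (rho u v) = - (\<i> * complex_of_real v / 2)"
      unfolding cumulant_def dv_def [symmetric] by (simp add: D(3))
  qed
  \<comment> \<open>The sign is that of i^(-k) for even k, times the minus sign in front of
    \<open>lth\<close>. The index is k - 1 because \<open>D 0\<close> is already the first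
    derivative of \<open>lth\<close>.\<close>
  define c where "c = (\<lambda>k. if odd k then 0 else - ((- 1) ^ (k div 2)) * D (k - 1) 0)"
  have cum: "cumulant k (rho u v) = complex_of_real (c k * u)" if k: "k \<ge> 2" and uv: "\<bar>v\<bar> < u" for k u v
  proof -
    obtain n where n: "k = Suc (Suc n)" using k by (metis add_2_eq_Suc le_Suc_ex)
    have *: "cumulant k (rho u v) = inverse (\<i> ^ k) * complex_of_real (- u * D (Suc n) 0)"
      unfolding cumulant_def dv_def [symmetric] n 2[OF uv] ..
    show ?thesis
    proof (cases "odd k")
      case True
      then show ?thesis unfolding * using n by (simp add: c_def D(3))
    next
      case False
      then obtain m where m: "k = 2 * m" by auto
      have "inverse (\<i> ^ k) = (- 1) ^ m" unfolding m by (simp add: power_mult flip: power_inverse)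
      moreover have "k - 1 = Suc n" using n by simp
      ultimately show ?thesis unfolding * using False m by (simp add: c_def)
    qed
  qed
  have even: "\<exists>p :: rat poly. even_poly p \<and> degree p = k \<and> c k = rat_poly_eval p psi2" if k: "k \<ge> 2" "even k" for k
  proof -
    have "odd (k - 1)" "Suc (k - 1) = k" using k by auto
    then obtain p :: "rat poly" where p: "even_poly p" "degree p = k" "D (k - 1) 0 = rat_poly_eval p psi2"
      using D(4)[of "k - 1"] by auto
    have "even_poly (smult (- ((- 1) ^ (k div 2))) p)" using p(1) by (simp add: even_poly_def)
    moreover have "degree (smult (- ((- 1) ^ (k div 2))) p) = k" using p(2) by simp
    moreover have sm: "rat_poly_eval (smult r p) x = of_rat r * rat_poly_eval p x" for r x
      by (simp add: rat_poly_eval_def map_poly_smult of_rat_mult)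
    have "c k = of_rat (- ((- 1) ^ (k div 2))) * rat_poly_eval p psi2"
      using k p(3) by (simp add: c_def of_rat_minus of_rat_power)
    then have "c k = rat_poly_eval (smult (- ((- 1) ^ (k div 2))) p) psi2" by (simp only: sm)
    ultimately show ?thesis by blast
  qed
  show "\<exists>c :: nat \<Rightarrow> real.
       (\<forall>k\<ge>2. \<forall>u v :: real. 0 < u \<longrightarrow> \<bar>v\<bar> < u \<longrightarrow>
          cumulant k (rho u v) = complex_of_real (c k * u)) \<and>
       (\<forall>k\<ge>2. c k \<in> range (\<lambda>p :: rat poly. rat_poly_eval p psi2)) \<and>
       (\<forall>k\<ge>3. odd k \<longrightarrow> c k = 0) \<and>
       (\<forall>k\<ge>2. even k \<longrightarrow>
          (\<exists>p :: rat poly. even_poly p \<and> degree p = k \<and> c k = rat_poly_eval p psi2))"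
  proof (intro exI[of _ c] conjI allI impI)
    fix k :: nat assume k: "k \<ge> 2"
    show "c k \<in> range (\<lambda>p :: rat poly. rat_poly_eval p psi2)"
    proof (cases "odd k")
      case True
      then have "c k = rat_poly_eval 0 psi2" by (simp add: c_def rat_poly_eval_def)
      then show ?thesis by blast
    qed (use even[OF k] in blast)
  qed (use cum even in \<open>auto simp: c_def\<close>)
qed

end
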